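(* Let $(\mathcal D_n)_{n\ge1}$ be a sequence of feasible degree sequences such that there exist $\delta,\delta'>0$, $d_1=d_1(n)$ and $d_2=d_2(n)$ with $0<d_2<d_1$ and $d_1/d_2\to1$ such that (i) $|S_n(d_2)\setminus S_n(d_1)|\ge\delta n$, and (ii) for some $d=d(n)\gg d_1$, $|S_n(d)|\ge\delta' n$. Fix $\varepsilon\in(0,1)$ and let $p_1=\frac{1-\varepsilon}{d_1}$ and $p_2=\frac{1+\varepsilon}{d_2}\sim\frac{1+\varepsilon}{d_1}$, where $p_2\le 1$. Then there is a positive real number $C=C(\delta,\delta',\varepsilon)>0$ such that $$\mathbb P\left[L_1(\mathbf G(\mathcal D_n)_{p_2})-L_1(\mathbf G(\mathcal D_n)_{p_1})\ge Cn\right]=1-o(1).$$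
   Context: For each $n$, $\mathcal D_n$ is a sequence of $n$ integers, each $\ge1$, that is feasible, i.e. there is a simple graph on $[n]$ in which each vertex $i$ has the $i$-th entry of $\mathcal D_n$ as its degree. $\mathbf G(\mathcal D_n)$ is a uniformly random simple graph among those. For a graph $G$ and $p\in[0,1]$, $G_p$ is the random subgraph on the same vertex set in which each edge of $G$ is kept independently with probability $p$. For $p_1\le p_2$ the two percolations of the same graph are coupled as a two-stage process: first each edge is kept with probability $p_1$ (giving $G_{p_1}$), then each edge not kept gets a second independent chance with probability $(p_2-p_1)/(1-p_1)$ (giving $G_{p_2}\supseteq G_{p_1}$). $L_1(G)$ is the number of vertices of a largest component of $G$. $S_n(x)$ is the set of vertices in $[n]$ whose prescribed degree is at least $x$. Asymptotics are as $n\to\infty$; $f\gg g$ means $g(n)/f(n)\to0$ and $f\sim g$ means $f(n)/g(n)\to1$. *)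

theory Defs
  imports "HOL-Probability.Probability" "HOL-Probability.Product_PMF"
begin

text \<open>A graph on a vertex set \<open>V\<close> is given by its set of edges, which are two-element subsets of \<open>V\<close>.\<close>

definition simple_graph :: "'a set \<Rightarrow> 'a set set \<Rightarrow> bool" where
  "simple_graph V E \<longleftrightarrow> (\<forall>e\<in>E. e \<subseteq> V \<and> card e = 2)"

definition vertex_degree :: "'a set set \<Rightarrow> 'a \<Rightarrow> nat" where
  "vertex_degree E v = card {e \<in> E. v \<in> e}"

text \<open>A degree sequence of length \<open>n\<close> is a function of which only the values on \<open>{1..n}\<close> matter.\<close>

definition graphs_with_degrees :: "nat \<Rightarrow> (nat \<Rightarrow> nat) \<Rightarrow> nat set set set" where
  "graphs_with_degrees n ds =
     {E. simple_graph {1..n} E \<and> (\<forall>v\<in>{1..n}. vertex_degree E v = ds v)}"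

definition feasible :: "nat \<Rightarrow> (nat \<Rightarrow> nat) \<Rightarrow> bool" where
  "feasible n ds \<longleftrightarrow> graphs_with_degrees n ds \<noteq> {}"

text \<open>Meaningful only for feasible sequences: \<^const>\<open>pmf_of_set\<close> is unspecified on the empty set.\<close>

definition random_graph :: "nat \<Rightarrow> (nat \<Rightarrow> nat) \<Rightarrow> nat set set pmf" where
  "random_graph n ds = pmf_of_set (graphs_with_degrees n ds)"

definition percolation :: "real \<Rightarrow> 'e set \<Rightarrow> 'e set pmf" where
  "percolation p E =
     map_pmf (\<lambda>keep. {e \<in> E. keep e}) (Pi_pmf E False (\<lambda>_. bernoulli_pmf p))"

text \<open>The joint law of the two percolations of one and the same edge set, as a two-stage process;
  intended for \<open>0 \<le> p1 \<le> p2 \<le> 1\<close> and \<open>p1 < 1\<close>.\<close>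

definition coupled_percolation :: "real \<Rightarrow> real \<Rightarrow> 'e set \<Rightarrow> ('e set \<times> 'e set) pmf" where
  "coupled_percolation p1 p2 E =
     bind_pmf (percolation p1 E) (\<lambda>E1.
     bind_pmf (percolation ((p2 - p1) / (1 - p1)) (E - E1)) (\<lambda>F.
     return_pmf (E1, E1 \<union> F)))"

definition connected_rel :: "'a set \<Rightarrow> 'a set set \<Rightarrow> ('a \<times> 'a) set" where
  "connected_rel V E = {(u, v). u \<in> V \<and> v \<in> V \<and> (u, v) \<in> {(x, y). {x, y} \<in> E}\<^sup>*}"

definition components :: "'a set \<Rightarrow> 'a set set \<Rightarrow> 'a set set" where
  "components V E = V // connected_rel V E"

definition L1 :: "'a set \<Rightarrow> 'a set set \<Rightarrow> nat" where
  "L1 V E = Max (card ` components V E)"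

definition S :: "nat \<Rightarrow> (nat \<Rightarrow> nat) \<Rightarrow> real \<Rightarrow> nat set" where
  "S n ds x = {v \<in> {1..n}. x \<le> real (ds v)}"

end

theory Submission
  imports Defs
begin

text \<open>
  The vertices responsible for the growth are those of degree about \<open>d1\<close>. At density
  \<open>p1 = (1 - \<epsilon>) / d1\<close> such a vertex is isolated with probability bounded away from 0. Since
  \<open>p2 - p1 \<ge> 2 * \<epsilon> / d2\<close>, the second round opens, with probability bounded away from 0, an edge
  between it and any fixed set that contains half of its neighbours. So it suffices that, with high
  probability, the percolation at density \<open>p1\<close> has a component \<open>Q\<close> that is a largest one and
  contains at least \<open>d2 / 2\<close> neighbours of each of linearly many isolated vertices (\<open>ready\<close>). Then
  \<open>Q\<close> absorbs linearly many of these vertices (\<open>prob_sprinkling_fails\<close>), while every vertex of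
  \<open>Q\<close> stays in the same component.

  The existence of \<open>Q\<close> relies on the vertices of degree at least \<open>d\<close>, which make the number of
  edges much larger than \<open>n * d1\<close>. Put \<open>\<kappa> = root 3 (d / d1)\<close>, which tends to infinity, let
  \<open>H\<close> be the set of vertices of degree at least \<open>\<kappa> * d1\<close>, and let \<open>L\<close> be its complement.
  All graphs with the given degrees have the same number of edges. Hence, given the set \<open>E1\<close> of
  open edges, the graph is uniform among the graphs with these degrees that contain \<open>E1\<close>
  (\<open>prob_by_conditioning_on_open_edges\<close>). The components are then fixed, and the closed edges can
  be switched: the edges \<open>ab\<close>, \<open>ce\<close> are replaced by \<open>ae\<close>, \<open>cb\<close>. Comparing the number
  of switchings out of a bad graph with the number of switchings into any graph
  (\<open>switching_double_count\<close>) bounds the proportion of bad graphs. A single switching suffices each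
  time, because the two numbers differ by a factor that is a power of \<open>\<kappa>\<close>. This rules out:

  \<^item> a partition into two unions of components, each with linearly many vertices of \<open>H\<close>, with
    only \<open>O(n * d1)\<close> edges across (\<open>few_graphs_with_sparse_cut\<close>);
  \<^item> many closed edges between \<open>L\<close> and a small set \<open>Y \<subseteq> H\<close> when there are few between \<open>Y\<close> and
    \<open>H - Y\<close> (\<open>few_graphs_with_low_vertices_attached\<close>);
  \<^item> many edges inside \<open>L\<close> (\<open>few_graphs_with_many_low_low_edges\<close>).

  The other ingredients concern the percolation of an arbitrary fixed graph: exponential moments,
  union bounds and one variance. A cut of \<open>n * d1 / (1 - \<epsilon>)\<close> edges is entirely closed with probability at most
  \<open>exp (- n)\<close>, which beats the \<open>2 ^ n\<close> possible cuts; with the first switching this yields a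
  component \<open>Q\<close> containing all but \<open>\<rho> * n\<close> vertices of \<open>H\<close>. The set \<open>Y = H - Q\<close> is one
  of only \<open>exp (\<theta> * n)\<close> small sets, with \<open>\<theta>\<close> as small as desired, so the union bound even
  gives at most \<open>\<eta>' * n * d1\<close> edges between \<open>Y\<close> and \<open>H - Y\<close>. By the other two switchings
  only \<open>2 * \<eta> * n * d1\<close> closed edges lead from \<open>L\<close> to the outside of \<open>Q\<close>. Therefore most
  neighbours of most isolated vertices of degree about \<open>d1\<close> belong to \<open>Q\<close>, and no other
  component is larger than \<open>Q\<close>.
\<close>

section \<open>Neighbourhoods and edge counts\<close>

definition nbrs :: "'a set set \<Rightarrow> 'a \<Rightarrow> 'a set" where
  "nbrs G v = {u. {v, u} \<in> G}"

text \<open>Ordered pairs, so that an edge inside \<open>X \<inter> Y\<close> counts twice; this makes the count a sum over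
  \<open>X\<close> of numbers of neighbours in \<open>Y\<close>.\<close>
definition epairs :: "'a set set \<Rightarrow> 'a set \<Rightarrow> 'a set \<Rightarrow> ('a \<times> 'a) set" where
  "epairs G X Y = {(x, y). x \<in> X \<and> y \<in> Y \<and> {x, y} \<in> G}"

lemma simple_graph_edgeD:
  assumes "simple_graph V G" "{u, v} \<in> G"
  shows "u \<noteq> v" "u \<in> V" "v \<in> V"
  using assms by (auto simp: simple_graph_def dest!: bspec)

lemma simple_graph_edgeE:
  assumes "simple_graph V G" "e \<in> G"
  obtains u v where "e = {u, v}" "u \<noteq> v" "u \<in> V" "v \<in> V"
proof -
  have "e \<subseteq> V" "card e = 2" using assms by (auto simp: simple_graph_def)
  then show ?thesis using that by (auto simp: card_2_iff)
qed

lemma simple_graph_finite: "finite V \<Longrightarrow> simple_graph V G \<Longrightarrow> finite G"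
  by (rule finite_subset[of _ "Pow V"]) (auto simp: simple_graph_def)

lemma simple_graph_mono: "simple_graph V G \<Longrightarrow> H \<subseteq> G \<Longrightarrow> simple_graph V H"
  by (auto simp: simple_graph_def)

lemma nbrs_subset: "simple_graph V G \<Longrightarrow> nbrs G v \<subseteq> V"
  by (auto simp: nbrs_def dest: simple_graph_edgeD)

lemma nbrs_mono: "H \<subseteq> G \<Longrightarrow> nbrs H v \<subseteq> nbrs G v"
  by (auto simp: nbrs_def)

lemma finite_nbrs: "finite V \<Longrightarrow> simple_graph V G \<Longrightarrow> finite (nbrs G v)"
  by (meson nbrs_subset finite_subset)

lemma card_nbrs:
  assumes "simple_graph V G"
  shows "card (nbrs G v) = vertex_degree G v"
  unfolding vertex_degree_def
proof (rule bij_betw_same_card[of "\<lambda>u. {v, u}"], rule bij_betwI')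
  fix x y assume "x \<in> nbrs G v" "y \<in> nbrs G v"
  then show "({v, x} = {v, y}) = (x = y)" by (auto simp: doubleton_eq_iff)
next
  fix x assume "x \<in> nbrs G v"
  then show "{v, x} \<in> {e \<in> G. v \<in> e}" by (auto simp: nbrs_def)
next
  fix y assume "y \<in> {e \<in> G. v \<in> e}"
  then have y: "y \<in> G" "v \<in> y" by auto
  then obtain a b where "y = {a, b}" by (metis simple_graph_edgeE[OF assms])
  then show "\<exists>x\<in>nbrs G v. y = {v, x}" using y by (auto simp: nbrs_def insert_commute)
qed

lemma epairs_Sigma: "epairs G X Y = Sigma X (\<lambda>x. nbrs G x \<inter> Y)"
  by (auto simp: epairs_def nbrs_def)

lemma card_epairs:
  assumes "finite X" "finite Y"
  shows "card (epairs G X Y) = (\<Sum>x\<in>X. card (nbrs G x \<inter> Y))"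
  using assms by (simp add: epairs_Sigma)

lemma finite_epairs: "finite X \<Longrightarrow> finite Y \<Longrightarrow> finite (epairs G X Y)"
  by (auto simp: epairs_Sigma)

lemma epairs_mono: "H \<subseteq> G \<Longrightarrow> X \<subseteq> X' \<Longrightarrow> Y \<subseteq> Y' \<Longrightarrow> epairs H X Y \<subseteq> epairs G X' Y'"
  by (auto simp: epairs_def)

lemma card_epairs_mono:
  assumes "finite X'" "finite Y'" "H \<subseteq> G" "X \<subseteq> X'" "Y \<subseteq> Y'"
  shows "card (epairs H X Y) \<le> card (epairs G X' Y')"
  using assms by (intro card_mono finite_epairs epairs_mono)

lemma epairs_swap: "epairs G Y X = prod.swap ` epairs G X Y"
  by (auto simp: epairs_def insert_commute image_iff)

lemma card_epairs_commute: "card (epairs G X Y) = card (epairs G Y X)"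
  unfolding epairs_swap[of G Y X] by (rule card_image[symmetric]) (auto simp: inj_on_def)

lemma few_vertices_with_many_nbrs:
  fixes t :: real
  assumes "finite X" "finite Y"
  shows "real (card {x \<in> X. t \<le> real (card (nbrs G x \<inter> Y))}) * t \<le> real (card (epairs G X Y))"
proof -
  let ?B = "{x \<in> X. t \<le> real (card (nbrs G x \<inter> Y))}"
  have "real (card ?B) * t = (\<Sum>x\<in>?B. t)" by simp
  also have "\<dots> \<le> (\<Sum>x\<in>?B. real (card (nbrs G x \<inter> Y)))" by (rule sum_mono) auto
  also have "\<dots> \<le> (\<Sum>x\<in>X. real (card (nbrs G x \<inter> Y)))" using assms by (intro sum_mono2) auto
  also have "\<dots> = real (card (epairs G X Y))" using assms by (simp add: card_epairs)
  finally show ?thesis .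
qed

section \<open>Switchings\<close>

text \<open>The edges \<open>ab\<close> and \<open>ce\<close> exchange their second endpoints. The argument is a pair of ordered
  edges because switchings will be enumerated by choosing the two edges one after the other.\<close>
definition switch :: "('a \<times> 'a) \<times> ('a \<times> 'a) \<Rightarrow> 'a set set \<Rightarrow> 'a set set" where
  "switch = (\<lambda>((a, b), (c, e)) G. G - {{a, b}, {c, e}} \<union> {{a, e}, {c, b}})"

text \<open>Only edges outside \<open>E1\<close> may move, so that the switched graph still contains \<open>E1\<close>.\<close>
definition switchable :: "'a set set \<Rightarrow> 'a set set \<Rightarrow> (('a \<times> 'a) \<times> ('a \<times> 'a)) set" where
  "switchable E1 G = {((a, b), (c, e)). {a, b} \<in> G - E1 \<and> {c, e} \<in> G - E1 \<and>
     {a, e} \<notin> G \<and> {c, b} \<notin> G \<and> a \<noteq> e \<and> c \<noteq> b}"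

definition extensions :: "nat \<Rightarrow> (nat \<Rightarrow> nat) \<Rightarrow> nat set set \<Rightarrow> nat set set set" where
  "extensions n ds E1 = {G \<in> graphs_with_degrees n ds. E1 \<subseteq> G}"

lemma vertex_degree_switch:
  assumes "finite G" "((a, b), (c, e)) \<in> switchable E1 G" "simple_graph V G"
  shows "vertex_degree (switch ((a, b), (c, e)) G) v = vertex_degree G v"
proof -
  have ed: "{a, b} \<in> G" "{c, e} \<in> G" "{a, e} \<notin> G" "{c, b} \<notin> G" "a \<noteq> e" "c \<noteq> b"
    using assms(2) by (auto simp: switchable_def)
  have ne: "a \<noteq> b" "c \<noteq> e" using ed assms(3) by (auto dest: simple_graph_edgeD)
  have ne2: "a \<noteq> c" "b \<noteq> e" using ed by (auto simp: insert_commute)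
  define h where "h x = (if v \<in> x then 1 else 0::nat)" for x
  have deg: "vertex_degree E v = sum h E" if "finite E" for E
    using that by (auto simp: vertex_degree_def h_def sum.If_cases Int_def)
  have d1: "{a, b} \<noteq> {c, e}" "{a, e} \<noteq> {c, b}" using ne2 ed ne by (auto simp: doubleton_eq_iff)
  have "sum h G = sum h (G - {{a, b}, {c, e}}) + sum h {{a, b}, {c, e}}"
    using ed assms(1) by (subst sum.union_disjoint[symmetric]) (auto intro!: arg_cong2[of _ _ _ _ sum])
  also have "sum h {{a, b}, {c, e}} = h {a, b} + h {c, e}" using d1 by simp
  also have "\<dots> = h {a, e} + h {c, b}" using ne ne2 ed by (auto simp: h_def)
  also have "\<dots> = sum h {{a, e}, {c, b}}" using d1 by simp
  also have "sum h (G - {{a, b}, {c, e}}) + sum h {{a, e}, {c, b}} = sum h (switch ((a, b), (c, e)) G)"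
    unfolding switch_def prod.case using ed assms(1) by (subst sum.union_disjoint[symmetric]) auto
  finally show ?thesis using assms(1) by (simp add: deg switch_def)
qed

lemma switch_in_extensions:
  assumes "G \<in> extensions n ds E1" "\<tau> \<in> switchable E1 G"
  shows "switch \<tau> G \<in> extensions n ds E1"
proof -
  obtain a b c e where \<tau>: "\<tau> = ((a, b), (c, e))" by (metis prod.exhaust)
  have G: "simple_graph {1..n} G" "E1 \<subseteq> G" "\<forall>v\<in>{1..n}. vertex_degree G v = ds v"
    using assms(1) by (auto simp: extensions_def graphs_with_degrees_def)
  have sw: "{a, b} \<in> G" "{c, e} \<in> G" "{a, b} \<notin> E1" "{c, e} \<notin> E1" "a \<noteq> e" "c \<noteq> b"
    using assms(2) by (auto simp: switchable_def \<tau>)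
  have V: "a \<in> {1..n}" "b \<in> {1..n}" "c \<in> {1..n}" "e \<in> {1..n}"
    using simple_graph_edgeD[OF G(1) sw(1)] simple_graph_edgeD[OF G(1) sw(2)] by auto
  have "simple_graph {1..n} (switch \<tau> G)"
    using G(1) V sw unfolding simple_graph_def switch_def \<tau> by auto
  moreover have "E1 \<subseteq> switch \<tau> G" using G(2) sw by (auto simp: switch_def \<tau>)
  moreover have "vertex_degree (switch \<tau> G) v = ds v" if "v \<in> {1..n}" for v
    using vertex_degree_switch[OF _ assms(2)[unfolded \<tau>] G(1)] simple_graph_finite[OF _ G(1)] G(3) that
    by (simp add: \<tau>)
  ultimately show ?thesis by (auto simp: extensions_def graphs_with_degrees_def)
qed

text \<open>For fixed endpoints a switching is injective, which is what the double count below relies on.\<close>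
lemma switch_undo:
  assumes "((a, b), (c, e)) \<in> switchable E1 G"
  shows "switch ((a, e), (c, b)) (switch ((a, b), (c, e)) G) = G"
  using assms by (auto simp: switchable_def switch_def)

lemma finite_graphs_with_degrees: "finite (graphs_with_degrees n ds)"
  by (rule finite_subset[of _ "Pow (Pow {1..n})"])
     (auto simp: graphs_with_degrees_def simple_graph_def)

lemma finite_extensions: "finite (extensions n ds E1)"
  using finite_graphs_with_degrees by (auto simp: extensions_def)

text \<open>Count the pairs of a graph \<open>G \<in> B\<close> and a switching \<open>\<tau> \<in> \<Phi> G\<close>. There are at least \<open>f\<close> for
  each \<open>G\<close>. The pair is determined by the resulting graph and \<open>\<tau>\<close>, and each resulting graph
  arises from at most \<open>b\<close> switchings. So \<open>B\<close> is a proportion of at most \<open>b / f\<close> of the graphs.\<close>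
lemma switching_double_count:
  fixes f b :: real
  assumes B: "B \<subseteq> extensions n ds E1"
    and forward: "\<And>G. G \<in> B \<Longrightarrow> finite (\<Phi> G) \<and> f \<le> real (card (\<Phi> G))"
    and valid: "\<And>G \<tau>. G \<in> B \<Longrightarrow> \<tau> \<in> \<Phi> G \<Longrightarrow> \<tau> \<in> switchable E1 G"
    and backward: "\<And>G \<tau>. G \<in> B \<Longrightarrow> \<tau> \<in> \<Phi> G \<Longrightarrow> \<tau> \<in> \<Psi> (switch \<tau> G) \<and>
        finite (\<Psi> (switch \<tau> G)) \<and> real (card (\<Psi> (switch \<tau> G))) \<le> b"
    and b: "0 \<le> b"
  shows "real (card B) * f \<le> real (card (extensions n ds E1)) * b"
proof -
  let ?\<Omega> = "(\<lambda>(G, \<tau>). switch \<tau> G) ` Sigma B \<Phi>"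
  have fB: "finite B" using B finite_extensions finite_subset by blast
  have fS: "finite (Sigma B \<Phi>)" using fB forward by auto
  have \<Omega>: "?\<Omega> \<subseteq> extensions n ds E1" using switch_in_extensions valid B by fastforce
  have f\<Omega>: "finite ?\<Omega>" using fS by blast
  have inj: "inj_on (\<lambda>(G, \<tau>). (switch \<tau> G, \<tau>)) (Sigma B \<Phi>)"
  proof (rule inj_onI)
    fix x y
    assume xy: "x \<in> Sigma B \<Phi>" "y \<in> Sigma B \<Phi>"
      and eq: "(case x of (G, \<tau>) \<Rightarrow> (switch \<tau> G, \<tau>)) = (case y of (G, \<tau>) \<Rightarrow> (switch \<tau> G, \<tau>))"
    obtain G a b c e where x: "x = (G, (a, b), (c, e))" by (metis prod.exhaust)
    obtain G' where y: "y = (G', (a, b), (c, e))" using eq by (cases y) (simp add: x)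
    have "((a, b), (c, e)) \<in> switchable E1 G" "((a, b), (c, e)) \<in> switchable E1 G'"
      using xy valid by (auto simp: x y)
    note undo = this[THEN switch_undo]
    have "switch ((a, b), (c, e)) G = switch ((a, b), (c, e)) G'" using eq by (simp add: x y)
    with undo have "G = G'" by (metis (no_types))
    then show "x = y" by (simp add: x y)
  qed
  have "real (card B) * f = (\<Sum>G\<in>B. f)" by simp
  also have "\<dots> \<le> (\<Sum>G\<in>B. real (card (\<Phi> G)))" using forward by (intro sum_mono) auto
  also have "\<dots> = real (card (Sigma B \<Phi>))" using fB forward by simp
  also have "\<dots> \<le> real (card (Sigma ?\<Omega> \<Psi>))"
  proof -
    have "finite (Sigma ?\<Omega> \<Psi>)" using f\<Omega> backward by (intro finite_SigmaI) auto
    moreover have "(\<lambda>(G, \<tau>). (switch \<tau> G, \<tau>)) ` Sigma B \<Phi> \<subseteq> Sigma ?\<Omega> \<Psi>"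
    proof (rule image_subsetI)
      fix x assume "x \<in> Sigma B \<Phi>"
      then obtain G \<tau> where x: "x = (G, \<tau>)" "G \<in> B" "\<tau> \<in> \<Phi> G" by (metis SigmaE)
      have "switch \<tau> G \<in> ?\<Omega>" by (rule image_eqI[of _ _ x]) (use x in simp_all)
      moreover have "\<tau> \<in> \<Psi> (switch \<tau> G)" using backward[OF x(2,3)] by simp
      ultimately show "(case x of (G, \<tau>) \<Rightarrow> (switch \<tau> G, \<tau>)) \<in> Sigma ?\<Omega> \<Psi>"
        unfolding x(1) prod.case by (rule SigmaI)
    qed
    ultimately have "card (Sigma B \<Phi>) \<le> card (Sigma ?\<Omega> \<Psi>)" by (intro card_inj_on_le[OF inj])
    then show ?thesis by (simp only: of_nat_le_iff)
  qed
  also have "\<dots> = (\<Sum>G\<in>?\<Omega>. real (card (\<Psi> G)))" using f\<Omega> backward by (subst card_SigmaI) auto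
  also have "\<dots> \<le> (\<Sum>G\<in>?\<Omega>. b)" using backward by (intro sum_mono) auto
  also have "\<dots> = real (card ?\<Omega>) * b" by simp
  also have "\<dots> \<le> real (card (extensions n ds E1)) * b"
    using card_mono[OF finite_extensions \<Omega>] b by (intro mult_right_mono) auto
  finally show ?thesis .
qed

section \<open>Percolation and exponential moments\<close>

lemma prob_bind_pmf:
  "measure_pmf.prob (bind_pmf M f) X = measure_pmf.expectation M (\<lambda>x. measure_pmf.prob (f x) X)"
proof -
  have "ennreal (measure_pmf.prob (bind_pmf M f) X) = (\<integral>\<^sup>+x. ennreal (measure_pmf.prob (f x) X) \<partial>M)"
    by (simp add: measure_pmf.emeasure_eq_measure[symmetric])
  also have "\<dots> = ennreal (measure_pmf.expectation M (\<lambda>x. measure_pmf.prob (f x) X))"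
    by (intro nn_integral_eq_integral measure_pmf.integrable_const_bound[where B = 1]) auto
  finally show ?thesis by (simp add: integral_nonneg_AE)
qed

lemma prob_bind_pmf_le:
  assumes "0 \<le> s" and "\<And>x. x \<in> set_pmf M \<Longrightarrow> x \<notin> Bad \<Longrightarrow> measure_pmf.prob (f x) X \<le> s"
  shows "measure_pmf.prob (bind_pmf M f) X \<le> measure_pmf.prob M Bad + s"
proof -
  have 1: "integrable (measure_pmf M) (\<lambda>x. measure_pmf.prob (f x) X)"
    by (intro measure_pmf.integrable_const_bound[where B = 1]) auto
  have 2: "integrable (measure_pmf M) (indicator Bad :: _ \<Rightarrow> real)"
    by (intro measure_pmf.integrable_const_bound[where B = 1]) auto
  have "measure_pmf.prob (bind_pmf M f) X = measure_pmf.expectation M (\<lambda>x. measure_pmf.prob (f x) X)"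
    by (rule prob_bind_pmf)
  also have "\<dots> \<le> measure_pmf.expectation M (\<lambda>x. indicator Bad x + s)"
  proof (rule integral_mono_AE)
    show "AE x in M. measure_pmf.prob (f x) X \<le> indicator Bad x + s"
      using assms by (auto simp: AE_measure_pmf_iff indicator_def intro: add_increasing2)
  qed (use 1 2 in auto)
  also have "\<dots> = measure_pmf.prob M Bad + s"
    using 2 by (subst Bochner_Integration.integral_add) auto
  finally show ?thesis .
qed

lemma set_percolation:
  assumes "finite E"
  shows "set_pmf (percolation p E) \<subseteq> Pow E"
  by (auto simp: percolation_def)

text \<open>The joint generating function of the numbers of open and of closed edges in \<open>T\<close>, by
  independence. All tail bounds below come from it: \<open>\<alpha> = 0\<close> singles out the event that
  everything is closed, \<open>\<alpha> > 1 > \<beta>\<close> penalizes many open edges together with few closed ones.\<close>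
lemma percolation_expectation_product:
  fixes \<alpha> \<beta> p :: real
  assumes "finite E" "T \<subseteq> E" "0 \<le> p" "p \<le> 1" "0 \<le> \<alpha>" "0 \<le> \<beta>"
  shows "measure_pmf.expectation (percolation p E) (\<lambda>E1. \<alpha> ^ card (T \<inter> E1) * \<beta> ^ card (T - E1)) =
    (p * \<alpha> + (1 - p) * \<beta>) ^ card T"
proof -
  have fT: "finite T" using assms finite_subset by blast
  let ?f = "\<lambda>e v. if e \<in> T then if v then \<alpha> else \<beta> else 1 :: real"
  have prod: "\<alpha> ^ card (T \<inter> {e \<in> E. keep e}) * \<beta> ^ card (T - {e \<in> E. keep e}) = (\<Prod>e\<in>E. ?f e (keep e))" for keep
  proof -
    have "(\<Prod>e\<in>E. ?f e (keep e)) = (\<Prod>e\<in>T. if keep e then \<alpha> else \<beta>)"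
      using assms(1,2) by (simp add: prod.If_cases Int_absorb1)
    also have "\<dots> = \<alpha> ^ card (T \<inter> {e. keep e}) * \<beta> ^ card (T \<inter> - {e. keep e})"
      using fT by (simp add: prod.If_cases)
    also have "T \<inter> {e. keep e} = T \<inter> {e \<in> E. keep e}" using assms(2) by auto
    also have "T \<inter> - {e. keep e} = T - {e \<in> E. keep e}" using assms(2) by auto
    finally show ?thesis by simp
  qed
  have "measure_pmf.expectation (percolation p E) (\<lambda>E1. \<alpha> ^ card (T \<inter> E1) * \<beta> ^ card (T - E1)) =
      measure_pmf.expectation (Pi_pmf E False (\<lambda>_. bernoulli_pmf p)) (\<lambda>keep. \<Prod>e\<in>E. ?f e (keep e))"
    unfolding percolation_def integral_map_pmf prod ..
  also have "\<dots> = (\<Prod>e\<in>E. measure_pmf.expectation (bernoulli_pmf p) (?f e))"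
    by (rule expectation_prod_Pi_pmf) (use assms in \<open>auto intro!: integrable_measure_pmf_finite\<close>)
  also have "\<dots> = (\<Prod>e\<in>E. if e \<in> T then p * \<alpha> + (1 - p) * \<beta> else 1)"
    using assms by (intro prod.cong) (auto simp: mult.commute)
  also have "\<dots> = (p * \<alpha> + (1 - p) * \<beta>) ^ card T"
    using assms(1,2) by (simp add: prod.If_cases Int_absorb1)
  finally show ?thesis .
qed

lemma percolation_weight_bound:
  fixes \<alpha> \<beta> p c :: real
  assumes "finite E" "T \<subseteq> E" "0 \<le> p" "p \<le> 1" "0 \<le> \<alpha>" "0 \<le> \<beta>" "0 < c"
    and "\<And>E1. E1 \<subseteq> E \<Longrightarrow> P E1 \<Longrightarrow> c \<le> \<alpha> ^ card (T \<inter> E1) * \<beta> ^ card (T - E1)"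
  shows "measure_pmf.prob (percolation p E) {E1. P E1} \<le> (p * \<alpha> + (1 - p) * \<beta>) ^ card T / c"
proof -
  let ?w = "\<lambda>E1. \<alpha> ^ card (T \<inter> E1) * \<beta> ^ card (T - E1)"
  have fin: "finite (set_pmf (percolation p E))"
    using set_percolation[OF assms(1)] assms(1) by (meson finite_Pow_iff finite_subset)
  have "measure_pmf.prob (percolation p E) {E1. P E1} = measure_pmf.expectation (percolation p E) (indicator {E1. P E1})"
    by simp
  also have "\<dots> \<le> measure_pmf.expectation (percolation p E) (\<lambda>E1. ?w E1 / c)"
  proof (rule integral_mono_AE)
    show "AE E1 in percolation p E. indicator {E1. P E1} E1 \<le> ?w E1 / c"
      using set_percolation[OF assms(1), of p] assms by (auto simp: AE_measure_pmf_iff indicator_def field_simps)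
  qed (use fin in \<open>auto intro!: integrable_measure_pmf_finite\<close>)
  also have "\<dots> = (p * \<alpha> + (1 - p) * \<beta>) ^ card T / c"
    using percolation_expectation_product[OF assms(1-6)] by simp
  finally show ?thesis .
qed

lemma prob_all_closed:
  assumes "finite E" "T \<subseteq> E" "0 \<le> p" "p \<le> 1"
  shows "measure_pmf.prob (percolation p E) {E1. T \<inter> E1 = {}} = (1 - p) ^ card T"
proof -
  have fin: "finite T" using assms finite_subset by blast
  have "measure_pmf.prob (percolation p E) {E1. T \<inter> E1 = {}} =
      measure_pmf.expectation (percolation p E) (indicator {E1. T \<inter> E1 = {}})"
    by simp
  also have "indicator {E1. T \<inter> E1 = {}} = (\<lambda>E1. 0 ^ card (T \<inter> E1) * 1 ^ card (T - E1) :: real)"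
    using fin by (auto simp: indicator_def fun_eq_iff)
  also have "measure_pmf.expectation (percolation p E) \<dots> = (1 - p) ^ card T"
    using percolation_expectation_product[OF assms, of 0 1] by simp
  finally show ?thesis .
qed

lemma one_minus_power_le_exp:
  fixes p t :: real
  assumes "0 \<le> p" "p \<le> 1" "t \<le> real m"
  shows "(1 - p) ^ m \<le> exp (- p * t)"
proof -
  have "(1 - p) ^ m \<le> exp (- p) ^ m"
    using assms exp_ge_add_one_self[of "- p"] by (intro power_mono) auto
  also have "\<dots> = exp (- p * real m)" by (simp add: exp_of_nat_mult[symmetric] mult.commute)
  also have "\<dots> \<le> exp (- p * t)" using assms by (simp add: mult_left_mono)
  finally show ?thesis .
qed

text \<open>The entropy bound that makes union bounds over small sets affordable: weighting a subset \<open>Y\<close> by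
  \<open>x ^ card Y\<close> gives total weight \<open>(1 + x) ^ card V\<close>, while each small subset has weight at least
  \<open>x powr (\<rho> * card V)\<close>. The constant \<open>\<rho>\<close> is chosen after \<open>x = min 1 (\<theta> / 2)\<close>.\<close>
lemma few_small_subsets:
  fixes \<theta> :: real
  assumes "0 < \<theta>"
  obtains \<rho> where "0 < \<rho>" "\<And>V :: nat set. finite V \<Longrightarrow>
    real (card {Y. Y \<subseteq> V \<and> real (card Y) \<le> \<rho> * real (card V)}) \<le> exp (\<theta> * real (card V))"
proof
  define x where "x = min 1 (\<theta> / 2)"
  \<comment> \<open>The summand 1 keeps the denominator positive when x = 1.\<close>
  define \<rho> where "\<rho> = \<theta> / (2 * (1 + ln (1 / x)))"
  have x: "0 < x" "x \<le> 1" "x \<le> \<theta> / 2" using assms by (auto simp: x_def)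
  have l: "0 \<le> ln (1 / x)" using x by simp
  show "0 < \<rho>" using assms l by (simp add: \<rho>_def)
  fix V :: "nat set" assume fin: "finite V"
  let ?n = "real (card V)" and ?F = "{Y. Y \<subseteq> V \<and> real (card Y) \<le> \<rho> * real (card V)}"
  have fF: "finite ?F" using fin by auto
  have "real (card ?F) * x powr (\<rho> * ?n) = (\<Sum>Y\<in>?F. x powr (\<rho> * ?n))" by simp
  also have "\<dots> \<le> (\<Sum>Y\<in>?F. x ^ card Y)"
  proof (rule sum_mono)
    fix Y assume "Y \<in> ?F"
    then have "x powr (\<rho> * ?n) \<le> x powr real (card Y)" using x by (intro powr_mono') auto
    then show "x powr (\<rho> * ?n) \<le> x ^ card Y" using x by (simp add: powr_realpow)
  qed
  also have "\<dots> \<le> (\<Sum>Y\<in>Pow V. x ^ card Y)" using fin x by (intro sum_mono2) auto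
  also have "\<dots> = (\<Sum>Y\<in>Pow V. \<Prod>y\<in>Y. x)" by simp
  also have "\<dots> = (\<Prod>y\<in>V. 1 + x)"
    using prod_add[OF fin, of "\<lambda>_. x" "\<lambda>_. 1"] by (simp add: add.commute)
  also have "\<dots> = (1 + x) ^ card V" by simp
  also have "\<dots> \<le> exp x ^ card V" using x by (intro power_mono) auto
  also have "\<dots> = exp (x * ?n)" by (simp add: exp_of_nat_mult[symmetric] mult.commute)
  finally have "real (card ?F) * x powr (\<rho> * ?n) \<le> exp (x * ?n)" .
  moreover have "x powr (\<rho> * ?n) = exp (- (\<rho> * ln (1 / x) * ?n))"
    using x by (simp add: powr_def ln_div)
  ultimately have "real (card ?F) \<le> exp (x * ?n) * exp (\<rho> * ln (1 / x) * ?n)"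
    by (simp add: exp_minus field_simps)
  also have "\<dots> = exp ((x + \<rho> * ln (1 / x)) * ?n)" by (simp add: exp_add[symmetric] algebra_simps)
  also have "\<dots> \<le> exp (\<theta> * ?n)"
  proof -
    have "\<rho> * ln (1 / x) \<le> \<theta> / 2" using l assms by (simp add: \<rho>_def field_simps)
    then show ?thesis using x by (simp add: mult_right_mono)
  qed
  finally show "real (card ?F) \<le> exp (\<theta> * ?n)" .
qed

section \<open>The random graph together with its open edges\<close>

definition percolated_graph :: "nat \<Rightarrow> (nat \<Rightarrow> nat) \<Rightarrow> real \<Rightarrow> (nat set set \<times> nat set set) pmf" where
  "percolated_graph n ds p = bind_pmf (random_graph n ds) (\<lambda>G. map_pmf (Pair G) (percolation p G))"

lemma pmf_percolation:
  assumes "finite E" "E1 \<subseteq> E" "0 \<le> p" "p \<le> 1"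
  shows "pmf (percolation p E) E1 = p ^ card E1 * (1 - p) ^ (card E - card E1)"
proof -
  let ?M = "Pi_pmf E False (\<lambda>_. bernoulli_pmf p)"
  have "pmf (percolation p E) E1 = measure_pmf.prob ?M ((\<lambda>keep. {e \<in> E. keep e}) -` {E1})"
    unfolding percolation_def by (simp add: pmf_map)
  also have "\<dots> = measure_pmf.prob ?M {\<lambda>e. e \<in> E1}"
  proof (rule measure_prob_cong_0)
    fix keep assume "keep \<in> (\<lambda>keep. {e \<in> E. keep e}) -` {E1} - {\<lambda>e. e \<in> E1}"
    then have k: "{e \<in> E. keep e} = E1" "keep \<noteq> (\<lambda>e. e \<in> E1)" by auto
    then obtain e where "keep e \<noteq> (e \<in> E1)" by blast
    with k have "e \<notin> E" "keep e" by auto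
    then show "pmf ?M keep = 0" using assms(1) by (intro pmf_Pi_outside) auto
  next
    fix keep assume "keep \<in> {\<lambda>e. e \<in> E1} - (\<lambda>keep. {e \<in> E. keep e}) -` {E1}"
    then show "pmf ?M keep = 0" using assms(2) by auto
  qed
  also have "\<dots> = pmf ?M (\<lambda>e. e \<in> E1)" by (simp add: measure_pmf_single)
  also have "\<dots> = (\<Prod>e\<in>E. pmf (bernoulli_pmf p) (e \<in> E1))"
    using assms by (intro pmf_Pi') auto
  also have "\<dots> = (\<Prod>e\<in>E. if e \<in> E1 then p else 1 - p)" using assms by (intro prod.cong) auto
  also have "\<dots> = p ^ card (E \<inter> E1) * (1 - p) ^ card (E \<inter> - E1)"
    using assms(1) by (simp add: prod.If_cases)
  also have "E \<inter> E1 = E1" using assms by auto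
  also have "card (E \<inter> - E1) = card E - card E1"
    using assms by (simp add: Diff_eq[symmetric] card_Diff_subset finite_subset)
  finally show ?thesis .
qed

lemma handshake:
  assumes "finite V" "simple_graph V G"
  shows "(\<Sum>v\<in>V. vertex_degree G v) = 2 * card G"
proof -
  have fG: "finite G" by (rule simple_graph_finite[OF assms])
  have "(\<Sum>v\<in>V. vertex_degree G v) = (\<Sum>v\<in>V. \<Sum>e\<in>G. if v \<in> e then 1 else 0)"
    using fG by (simp add: vertex_degree_def sum.If_cases Int_def)
  also have "\<dots> = (\<Sum>e\<in>G. \<Sum>v\<in>V. if v \<in> e then 1 else 0)" by (rule sum.swap)
  also have "\<dots> = (\<Sum>e\<in>G. 2)"
  proof (rule sum.cong)
    fix e assume e: "e \<in> G"
    then have "e \<subseteq> V" "card e = 2" using assms by (auto simp: simple_graph_def)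
    then show "(\<Sum>v\<in>V. if v \<in> e then 1 else 0) = (2::nat)"
      using assms(1) by (simp add: sum.If_cases Int_absorb1)
  qed simp
  finally show ?thesis by simp
qed

lemma card_edges_const:
  assumes "G \<in> graphs_with_degrees n ds"
  shows "2 * card G = (\<Sum>v\<in>{1..n}. ds v)"
  using assms handshake[of "{1..n}" G] by (simp add: graphs_with_degrees_def)

lemma set_random_graph: "feasible n ds \<Longrightarrow> set_pmf (random_graph n ds) = graphs_with_degrees n ds"
  by (simp add: random_graph_def feasible_def finite_graphs_with_degrees)

lemma graphs_with_degrees_finite_edges: "G \<in> graphs_with_degrees n ds \<Longrightarrow> finite G"
  by (auto simp: graphs_with_degrees_def intro: simple_graph_finite[of "{1..n}"])

lemma prob_percolated_graph_le:
  assumes "feasible n ds" "0 \<le> r"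
    and "\<And>G. G \<in> graphs_with_degrees n ds \<Longrightarrow> measure_pmf.prob (percolation p G) {E1. P G E1} \<le> r"
  shows "measure_pmf.prob (percolated_graph n ds p) {(G, E1). P G E1} \<le> r"
proof -
  have "measure_pmf.prob (percolated_graph n ds p) {(G, E1). P G E1} \<le>
      measure_pmf.prob (random_graph n ds) {} + r"
    unfolding percolated_graph_def
    using assms by (intro prob_bind_pmf_le) (auto simp: set_random_graph measure_map_pmf vimage_def)
  then show ?thesis by simp
qed

lemma prob_percolated_graph_sum:
  assumes "feasible n ds" "0 \<le> p" "p \<le> 1"
  defines "m \<equiv> (\<Sum>v\<in>{1..n}. ds v) div 2"
  shows "measure_pmf.prob (percolated_graph n ds p) {(G, E1). P G E1} =
    (\<Sum>E1\<in>Pow (Pow {1..n}). p ^ card E1 * (1 - p) ^ (m - card E1) * real (card {G \<in> extensions n ds E1. P G E1}))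
     / real (card (graphs_with_degrees n ds))"
proof -
  let ?GD = "graphs_with_degrees n ds"
  let ?w = "\<lambda>E1. p ^ card E1 * (1 - p) ^ (m - card E1)"
  let ?U = "Pow (Pow {1..n})"
  have ne: "?GD \<noteq> {}" using assms(1) by (simp add: feasible_def)
  have fin: "finite ?GD" by (rule finite_graphs_with_degrees)
  have inner: "measure_pmf.prob (percolation p G) {E1. P G E1} =
      (\<Sum>E1\<in>?U. if E1 \<subseteq> G \<and> P G E1 then ?w E1 else 0)" if G: "G \<in> ?GD" for G
  proof -
    have fG: "finite G" by (rule graphs_with_degrees_finite_edges[OF G])
    have cG: "card G = m" using card_edges_const[OF G] by (simp add: m_def)
    have GU: "Pow G \<subseteq> ?U" using G by (auto simp: graphs_with_degrees_def simple_graph_def)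
    have "measure_pmf.prob (percolation p G) {E1. P G E1} =
        measure_pmf.prob (percolation p G) {E1 \<in> Pow G. P G E1}"
      using set_percolation[OF fG, of p]
      by (intro measure_prob_cong_0) (auto simp: set_pmf_eq)
    also have "\<dots> = (\<Sum>E1\<in>{E1 \<in> Pow G. P G E1}. ?w E1)"
      using fG assms(2,3) by (subst measure_measure_pmf_finite) (auto simp: pmf_percolation cG)
    also have "\<dots> = (\<Sum>E1\<in>?U. if E1 \<subseteq> G \<and> P G E1 then ?w E1 else 0)"
      using GU by (subst sum.inter_filter[symmetric]) (auto intro!: sum.cong)
    finally show ?thesis .
  qed
  have "measure_pmf.prob (percolated_graph n ds p) {(G, E1). P G E1} =
      measure_pmf.expectation (pmf_of_set ?GD) (\<lambda>G. measure_pmf.prob (percolation p G) {E1. P G E1})"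
    unfolding percolated_graph_def prob_bind_pmf random_graph_def
    by (simp add: measure_map_pmf vimage_def)
  also have "\<dots> = (\<Sum>G\<in>?GD. measure_pmf.prob (percolation p G) {E1. P G E1}) / real (card ?GD)"
    by (rule integral_pmf_of_set[OF ne fin])
  also have "(\<Sum>G\<in>?GD. measure_pmf.prob (percolation p G) {E1. P G E1}) =
      (\<Sum>G\<in>?GD. \<Sum>E1\<in>?U. if E1 \<subseteq> G \<and> P G E1 then ?w E1 else 0)"
    by (rule sum.cong) (auto simp: inner)
  also have "\<dots> = (\<Sum>E1\<in>?U. \<Sum>G\<in>?GD. if E1 \<subseteq> G \<and> P G E1 then ?w E1 else 0)" by (rule sum.swap)
  also have "\<dots> = (\<Sum>E1\<in>?U. ?w E1 * real (card {G \<in> extensions n ds E1. P G E1}))"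
  proof (rule sum.cong)
    fix E1
    have "(\<Sum>G\<in>?GD. if E1 \<subseteq> G \<and> P G E1 then ?w E1 else 0) = (\<Sum>G\<in>{G \<in> ?GD. E1 \<subseteq> G \<and> P G E1}. ?w E1)"
      using fin by (subst sum.inter_filter[symmetric]) auto
    also have "{G \<in> ?GD. E1 \<subseteq> G \<and> P G E1} = {G \<in> extensions n ds E1. P G E1}"
      by (auto simp: extensions_def)
    finally show "(\<Sum>G\<in>?GD. if E1 \<subseteq> G \<and> P G E1 then ?w E1 else 0) =
        ?w E1 * real (card {G \<in> extensions n ds E1. P G E1})"
      by simp
  qed simp
  finally show ?thesis .
qed

text \<open>A pair \<open>(G, E1)\<close> has weight \<open>p ^ card E1 * (1 - p) ^ (card G - card E1)\<close>, and \<open>card G\<close> is the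
  same for all \<open>G\<close> by the handshake lemma. So the conditional law of \<open>G\<close> given \<open>E1\<close> is uniform,
  and a bound on proportions that holds for every \<open>E1\<close> bounds the probability.\<close>
lemma prob_by_conditioning_on_open_edges:
  assumes "feasible n ds" "0 \<le> p" "p \<le> 1"
    and "\<And>E1. real (card {G \<in> extensions n ds E1. P G E1}) \<le> r * real (card (extensions n ds E1))"
  shows "measure_pmf.prob (percolated_graph n ds p) {(G, E1). P G E1} \<le> r"
proof -
  let ?m = "(\<Sum>v\<in>{1..n}. ds v) div 2"
  let ?w = "\<lambda>E1. p ^ card E1 * (1 - p) ^ (?m - card E1)"
  let ?N = "real (card (graphs_with_degrees n ds))"
  have "(\<Sum>E1\<in>Pow (Pow {1..n}). ?w E1 * real (card {G \<in> extensions n ds E1. P G E1})) \<le>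
      (\<Sum>E1\<in>Pow (Pow {1..n}). ?w E1 * (r * real (card (extensions n ds E1))))"
    using assms by (intro sum_mono mult_left_mono) auto
  also have "\<dots> = r * (\<Sum>E1\<in>Pow (Pow {1..n}). ?w E1 * real (card {G \<in> extensions n ds E1. True}))"
    by (simp add: sum_distrib_left mult_ac)
  finally have "measure_pmf.prob (percolated_graph n ds p) {(G, E1). P G E1} \<le>
      r * measure_pmf.prob (percolated_graph n ds p) {(G, E1). True}"
    unfolding prob_percolated_graph_sum[OF assms(1-3)] times_divide_eq_right by (rule divide_right_mono) simp
  then show ?thesis by simp
qed

section \<open>Three switching estimates\<close>

lemma card_Sigma_ge:
  fixes f :: real
  assumes "finite A" "\<And>x. x \<in> A \<Longrightarrow> finite (B x)" "\<And>x. x \<in> A \<Longrightarrow> f \<le> real (card (B x))"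
    "a \<le> real (card A)" "0 \<le> f"
  shows "a * f \<le> real (card (Sigma A B))"
proof -
  have "a * f \<le> (\<Sum>x\<in>A. f)" using assms by (simp add: mult_right_mono)
  also have "\<dots> \<le> (\<Sum>x\<in>A. real (card (B x)))" using assms by (intro sum_mono) auto
  also have "\<dots> = real (card (Sigma A B))" using assms by simp
  finally show ?thesis .
qed

lemma card_Diff_ge:
  assumes "finite B"
  shows "real (card A) - real (card B) \<le> real (card (A - B))"
  using diff_card_le_card_Diff[OF assms, of A] by linarith

text \<open>The switchings that create an edge of \<open>P\<close> and an edge of \<open>Q\<close>: knowing the two new ordered edges
  \<open>ae\<close> and \<open>cb\<close> means knowing all four endpoints.\<close>
definition crossed_pairs :: "('a \<times> 'a) set \<Rightarrow> ('a \<times> 'a) set \<Rightarrow> (('a \<times> 'a) \<times> ('a \<times> 'a)) set" where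
  "crossed_pairs P Q = {((a, b), (c, e)). (a, e) \<in> P \<and> (c, b) \<in> Q}"

lemma crossed_pairs_bij:
  "bij_betw (\<lambda>((a, b), (c, e)). ((a, e), (c, b))) (crossed_pairs P Q) (P \<times> Q)"
  by (rule bij_betwI[where g = "\<lambda>((a, e), (c, b)). ((a, b), (c, e))"]) (auto simp: crossed_pairs_def)

lemma card_crossed_pairs: "card (crossed_pairs P Q) = card P * card Q"
  using bij_betw_same_card[OF crossed_pairs_bij[of P Q]] by (simp add: card_cartesian_product)

lemma finite_crossed_pairs: "finite P \<Longrightarrow> finite Q \<Longrightarrow> finite (crossed_pairs P Q)"
  using bij_betw_finite[OF crossed_pairs_bij[of P Q]] by simp

lemma extensionsD:
  assumes "G \<in> extensions n ds E1"
  shows "simple_graph {1..n} G" "E1 \<subseteq> G" "v \<in> {1..n} \<Longrightarrow> card (nbrs G v) = ds v"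
    "finite (nbrs G v)" "nbrs G v \<subseteq> {1..n}"
  using assms card_nbrs[of "{1..n}" G v] finite_nbrs[of "{1..n}" G v] nbrs_subset[of "{1..n}" G v]
  by (auto simp: extensions_def graphs_with_degrees_def)

lemma card_epairs_low_le:
  fixes t :: real
  assumes "G \<in> extensions n ds E1" "\<And>v. v \<in> L \<Longrightarrow> real (ds v) \<le> t" "L \<subseteq> {1..n}" "0 \<le> t"
  shows "real (card (epairs G L {1..n})) \<le> real n * t"
proof -
  have fL: "finite L" using assms(3) finite_subset by blast
  have "real (card (epairs G L {1..n})) = (\<Sum>v\<in>L. real (card (nbrs G v \<inter> {1..n})))"
    using fL by (simp add: card_epairs)
  also have "\<dots> \<le> (\<Sum>v\<in>L. t)"
  proof (rule sum_mono)
    fix v assume v: "v \<in> L"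
    have "card (nbrs G v \<inter> {1..n}) \<le> ds v"
      using extensionsD(3,4)[OF assms(1)] v assms(3) by (metis card_mono inf_le1 subsetD)
    then show "real (card (nbrs G v \<inter> {1..n})) \<le> t" using assms(2)[OF v] by linarith
  qed
  also have "\<dots> = real (card L) * t" by simp
  also have "\<dots> \<le> real n * t"
    using card_mono[OF _ assms(3)] assms(4) by (intro mult_right_mono) auto
  finally show ?thesis .
qed

text \<open>An edge \<open>vw\<close> inside \<open>L\<close> and an arbitrary ordered edge \<open>yz\<close> are switched to \<open>vz\<close> and \<open>yw\<close>.
  At most \<open>2 * (t + 1) * n\<close> of the at least \<open>W\<close> ordered edges are unusable, since \<open>v\<close> and \<open>w\<close>
  have degree at most \<open>t\<close> and every vertex at most \<open>n\<close>. In return each new edge has an endpoint in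
  \<open>L\<close>, which leaves only \<open>n * t\<close> possibilities for it.\<close>
lemma few_graphs_with_many_low_low_edges:
  fixes t x W :: real
  assumes low: "\<And>v. v \<in> L \<Longrightarrow> real (ds v) \<le> t" and L: "L \<subseteq> {1..n}"
    and t: "0 \<le> t" and W: "W \<le> (\<Sum>v\<in>{1..n}. real (ds v))" "4 * (t + 1) * real n \<le> W"
    and x: "0 \<le> x"
  shows "real (card {G \<in> extensions n ds {}. x \<le> real (card (epairs G L L))}) * (x * (W / 2))
    \<le> real (card (extensions n ds {})) * ((real n * t) * (real n * t))"
proof (rule switching_double_count[where
      \<Phi> = "\<lambda>G. Sigma (epairs G L L) (\<lambda>(v, w). epairs G {1..n} {1..n} -
        ({1..n} \<times> insert v (nbrs G v)) - (insert w (nbrs G w) \<times> {1..n}))"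
      and \<Psi> = "\<lambda>G. crossed_pairs (epairs G L {1..n}) (epairs G {1..n} L)"])
  have fL: "finite L" using L finite_subset by blast
  show "{G \<in> extensions n ds {}. x \<le> real (card (epairs G L L))} \<subseteq> extensions n ds {}" by auto
  show "0 \<le> real n * t * (real n * t)" using t by simp
  fix G assume "G \<in> {G \<in> extensions n ds {}. x \<le> real (card (epairs G L L))}"
  then have G: "G \<in> extensions n ds {}" and xG: "x \<le> real (card (epairs G L L))" by auto
  note GD = extensionsD[OF G]
  let ?V = "{1..n}"
  let ?T = "\<lambda>(v, w). epairs G ?V ?V - (?V \<times> insert v (nbrs G v)) - (insert w (nbrs G w) \<times> ?V)"
  have all: "real (card (epairs G ?V ?V)) = (\<Sum>v\<in>?V. real (ds v))"
    using GD(3,5) by (simp add: card_epairs Int_absorb2)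
  have ins: "real (card (insert v (nbrs G v))) \<le> t + 1" if "v \<in> L" for v
    using low[OF that] GD(3)[of v] GD(4)[of v] that L by (auto simp: card_insert_if)
  have T: "W / 2 \<le> real (card (?T vw))" if "vw \<in> epairs G L L" for vw
  proof -
    obtain v w where vw: "vw = (v, w)" "v \<in> L" "w \<in> L" using \<open>vw \<in> epairs G L L\<close> by (auto simp: epairs_def)
    have 1: "real (card (?V \<times> insert v (nbrs G v))) \<le> real n * (t + 1)"
      using ins[OF vw(2)] by (simp add: card_cartesian_product mult_left_mono)
    have 2: "real (card (insert w (nbrs G w) \<times> ?V)) \<le> real n * (t + 1)"
      using mult_right_mono[OF ins[OF vw(3)], of "real n"] by (simp add: card_cartesian_product mult.commute)
    have "real (card (epairs G ?V ?V)) - real n * (t + 1) - real n * (t + 1) \<le> real (card (?T vw))"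
      using card_Diff_ge[of "?V \<times> insert v (nbrs G v)" "epairs G ?V ?V"]
        card_Diff_ge[of "insert w (nbrs G w) \<times> ?V" "epairs G ?V ?V - ?V \<times> insert v (nbrs G v)"]
        1 2 GD(4) by (simp add: vw)
    moreover have "4 * (t + 1) * real n = 4 * (real n * (t + 1))" by simp
    ultimately show ?thesis using all W by linarith
  qed
  have fin: "finite (?T vw)" for vw by (cases vw) (auto intro: finite_epairs)
  show "finite (Sigma (epairs G L L) ?T) \<and> x * (W / 2) \<le> real (card (Sigma (epairs G L L) ?T))"
  proof
    show "finite (Sigma (epairs G L L) ?T)" by (rule finite_SigmaI[where B = ?T, OF finite_epairs[OF fL fL] fin])
    have "0 \<le> W" using order_trans[OF _ W(2), of 0] t by simp
    then have "0 \<le> W / 2" by simp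
    then show "x * (W / 2) \<le> real (card (Sigma (epairs G L L) ?T))"
      using card_Sigma_ge[of "epairs G L L" ?T "W / 2" x] finite_epairs[OF fL fL, of G] fin T xG by blast
  qed
  fix \<tau> assume "\<tau> \<in> Sigma (epairs G L L) ?T"
  moreover obtain v w y z where \<tau>: "\<tau> = ((v, w), (y, z))" by (metis prod.exhaust)
  ultimately have e: "v \<in> L" "w \<in> L" "{v, w} \<in> G" "{y, z} \<in> G" "y \<in> ?V" "z \<in> ?V" "z \<noteq> v" "y \<noteq> w"
    "{v, z} \<notin> G" "{y, w} \<notin> G"
    by (auto simp: epairs_def nbrs_def insert_commute)
  show sw: "\<tau> \<in> switchable {} G" using e by (auto simp: switchable_def \<tau>)
  let ?G' = "switch \<tau> G"
  have G': "?G' \<in> extensions n ds {}" by (rule switch_in_extensions[OF G sw])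
  have c1: "real (card (epairs ?G' L ?V)) \<le> real n * t" by (rule card_epairs_low_le[OF G' low L t])
  then have c2: "real (card (epairs ?G' ?V L)) \<le> real n * t" by (simp add: card_epairs_commute)
  have "\<tau> \<in> crossed_pairs (epairs ?G' L ?V) (epairs ?G' ?V L)"
    using e by (auto simp: crossed_pairs_def \<tau> epairs_def switch_def)
  then show "\<tau> \<in> crossed_pairs (epairs ?G' L ?V) (epairs ?G' ?V L) \<and>
      finite (crossed_pairs (epairs ?G' L ?V) (epairs ?G' ?V L)) \<and>
      real (card (crossed_pairs (epairs ?G' L ?V) (epairs ?G' ?V L))) \<le> real n * t * (real n * t)"
    using fL mult_mono[OF c1 c2] t by (simp add: finite_crossed_pairs finite_epairs card_crossed_pairs)
qed

text \<open>Both sides contain many vertices with at least \<open>4 * k\<close> closed edges. As at most \<open>m \<le> s * k\<close> edges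
  cross, at least half of these vertices have fewer than \<open>k\<close> neighbours on the other side. For two of them,
  \<open>x \<in> X\<close> and \<open>y \<in> Y\<close>, there remain \<open>2 * k\<close> closed neighbours \<open>u \<in> X\<close> of \<open>x\<close> that are not
  adjacent to \<open>y\<close>, and likewise \<open>w \<in> Y\<close>. Switching \<open>xu\<close>, \<open>yw\<close> to \<open>xw\<close>, \<open>yu\<close> creates two
  crossing edges, and a graph with at most \<open>m + 2\<close> of them has few pairs to offer. Choosing \<open>x\<close> and \<open>y\<close>
  before \<open>u\<close> and \<open>w\<close> avoids any assumption on the largest degree.\<close>
lemma few_graphs_with_sparse_cut:
  fixes k m s :: real
  assumes XY: "X \<subseteq> {1..n}" "Y \<subseteq> {1..n}" "X \<inter> Y = {}" "X \<union> Y = {1..n}"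
    and X': "X' \<subseteq> X" "\<And>v. v \<in> X' \<Longrightarrow> 4 * k \<le> real (ds v) - real (card (nbrs E1 v))" "2 * s \<le> real (card X')"
    and Y': "Y' \<subseteq> Y" "\<And>v. v \<in> Y' \<Longrightarrow> 4 * k \<le> real (ds v) - real (card (nbrs E1 v))" "2 * s \<le> real (card Y')"
    and k: "0 < k" and m: "0 \<le> m" "m \<le> s * k" and s: "0 \<le> s"
  shows "real (card {G \<in> extensions n ds E1. real (card (epairs G X Y)) \<le> m}) * ((s * s) * (2 * k * (2 * k)))
    \<le> real (card (extensions n ds E1)) * ((m + 2) * (m + 2))"
proof -
  let ?V = "{1..n}"
  have fX: "finite X" and fY: "finite Y" using XY finite_subset by blast+
  define U where "U G x y = nbrs (G - E1) x \<inter> X - nbrs G y" for G :: "nat set set" and x y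
  define W where "W G x y = nbrs (G - E1) y \<inter> Y - nbrs G x" for G :: "nat set set" and x y
  \<comment> \<open>Vertices of X' and Y' with few neighbours across the cut.\<close>
  define gX where "gX G = X' - {x \<in> X. k \<le> real (card (nbrs G x \<inter> Y))}" for G :: "nat set set"
  define gY where "gY G = Y' - {y \<in> Y. k \<le> real (card (nbrs G y \<inter> X))}" for G :: "nat set set"
  define r :: "(nat \<times> nat) \<times> (nat \<times> nat) \<Rightarrow> (nat \<times> nat) \<times> (nat \<times> nat)"
    where "r = (\<lambda>((x, y), (u, w)). ((x, u), (y, w)))"
  define \<Phi> where "\<Phi> G = r ` Sigma (gX G \<times> gY G) (\<lambda>(x, y). U G x y \<times> W G x y)" for G
  have many_good: "s \<le> real (card (Z' - {z \<in> Z. k \<le> real (card (nbrs G z \<inter> Z2))}))"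
    if "2 * s \<le> real (card Z')" "real (card (epairs G Z Z2)) \<le> m" "finite Z" "finite Z2" for Z' Z Z2 G
  proof -
    have "real (card {z \<in> Z. k \<le> real (card (nbrs G z \<inter> Z2))}) * k \<le> s * k"
      using few_vertices_with_many_nbrs[OF that(3,4), of k G] that(2) m by linarith
    then have "real (card {z \<in> Z. k \<le> real (card (nbrs G z \<inter> Z2))}) \<le> s" using k by simp
    then show ?thesis using card_Diff_ge[of "{z \<in> Z. k \<le> real (card (nbrs G z \<inter> Z2))}" Z'] that(1,3) by simp
  qed
  have many_choices: "2 * k \<le> real (card (nbrs (G - E1) x \<inter> Z - nbrs G y))"
    if G: "G \<in> extensions n ds E1" and Z: "Z \<union> Z2 = ?V" and x: "x \<in> ?V"
      and cl: "4 * k \<le> real (ds x) - real (card (nbrs E1 x))"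
      and x2: "real (card (nbrs G x \<inter> Z2)) < k" and y: "real (card (nbrs G y \<inter> Z)) < k" for G Z Z2 x y
  proof -
    note GD = extensionsD[OF G]
    have f1: "finite (nbrs E1 x)" using GD(4)[of x] nbrs_mono[OF GD(2), of x] finite_subset by blast
    have sub: "nbrs G x - nbrs E1 x - nbrs G x \<inter> Z2 - nbrs G y \<inter> Z \<subseteq> nbrs (G - E1) x \<inter> Z - nbrs G y"
      using Z GD(5)[of x] by (auto simp: nbrs_def)
    have "real (card (nbrs G x)) - real (card (nbrs E1 x)) - real (card (nbrs G x \<inter> Z2)) - real (card (nbrs G y \<inter> Z))
        \<le> real (card (nbrs G x - nbrs E1 x - nbrs G x \<inter> Z2 - nbrs G y \<inter> Z))"
      using card_Diff_ge[OF f1, of "nbrs G x"]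
        card_Diff_ge[of "nbrs G x \<inter> Z2" "nbrs G x - nbrs E1 x"]
        card_Diff_ge[of "nbrs G y \<inter> Z" "nbrs G x - nbrs E1 x - nbrs G x \<inter> Z2"] GD(4) by simp
    also have "\<dots> \<le> real (card (nbrs (G - E1) x \<inter> Z - nbrs G y))"
    proof -
      have "finite (nbrs (G - E1) x)" using GD(4)[of x] nbrs_mono[of "G - E1" G x] finite_subset by blast
      then show ?thesis using sub by (intro of_nat_mono card_mono) auto
    qed
    finally show ?thesis using GD(3)[OF x] cl x2 y by linarith
  qed
  show ?thesis
  proof (rule switching_double_count[where \<Phi> = \<Phi> and
        \<Psi> = "\<lambda>G. crossed_pairs (epairs G X Y) (epairs G Y X)"])
    show "{G \<in> extensions n ds E1. real (card (epairs G X Y)) \<le> m} \<subseteq> extensions n ds E1" by auto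
    show "0 \<le> (m + 2) * (m + 2)" using m by simp
    fix G assume "G \<in> {G \<in> extensions n ds E1. real (card (epairs G X Y)) \<le> m}"
    then have G: "G \<in> extensions n ds E1" and mG: "real (card (epairs G X Y)) \<le> m" by auto
    note GD = extensionsD[OF G]
    have mG': "real (card (epairs G Y X)) \<le> m" using mG by (simp add: card_epairs_commute)
    have fg: "finite (gX G)" "finite (gY G)"
      using X'(1) Y'(1) fX fY finite_subset by (auto simp: gX_def gY_def)
    have fUW: "finite (U G x y)" "finite (W G x y)" for x y using fX fY by (auto simp: U_def W_def)
    have cX: "s \<le> real (card (gX G))" unfolding gX_def by (rule many_good[OF X'(3) mG fX fY])
    have cY: "s \<le> real (card (gY G))" unfolding gY_def by (rule many_good[OF Y'(3) mG' fY fX])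
    have cU: "2 * k \<le> real (card (U G x y))" and cW: "2 * k \<le> real (card (W G x y))"
      if xy: "x \<in> gX G" "y \<in> gY G" for x y
    proof -
      have x: "x \<in> X'" "real (card (nbrs G x \<inter> Y)) < k" using xy X'(1) by (auto simp: gX_def not_le)
      have y: "y \<in> Y'" "real (card (nbrs G y \<inter> X)) < k" using xy Y'(1) by (auto simp: gY_def not_le)
      have V: "x \<in> ?V" "y \<in> ?V" "X \<union> Y = ?V" "Y \<union> X = ?V" using x y X'(1) Y'(1) XY by auto
      show "2 * k \<le> real (card (U G x y))"
        unfolding U_def by (rule many_choices[OF G V(3) V(1) X'(2)[OF x(1)] x(2) y(2)])
      show "2 * k \<le> real (card (W G x y))"
        unfolding W_def by (rule many_choices[OF G V(4) V(2) Y'(2)[OF y(1)] y(2) x(2)])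
    qed
    let ?S = "Sigma (gX G \<times> gY G) (\<lambda>(x, y). U G x y \<times> W G x y)"
    have fS: "finite ?S" using fg fUW by (intro finite_SigmaI) auto
    have "s * s \<le> real (card (gX G \<times> gY G))"
      using mult_mono[OF cX cY] s by (simp add: card_cartesian_product)
    moreover have "2 * k * (2 * k) \<le> real (card (case z of (x, y) \<Rightarrow> U G x y \<times> W G x y))"
      if zz: "z \<in> gX G \<times> gY G" for z
    proof -
      obtain x y where z: "z = (x, y)" "x \<in> gX G" "y \<in> gY G" using zz by auto
      show ?thesis using mult_mono[OF cU[OF z(2,3)] cW[OF z(2,3)]] k
        by (simp add: z card_cartesian_product)
    qed
    moreover have "finite (gX G \<times> gY G)" using fg by simp
    moreover have "finite (case z of (x, y) \<Rightarrow> U G x y \<times> W G x y)" for z using fUW by (cases z) auto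
    moreover have "0 \<le> 2 * k * (2 * k)" using k by simp
    ultimately have "s * s * (2 * k * (2 * k)) \<le> real (card ?S)"
      using card_Sigma_ge[of "gX G \<times> gY G" "\<lambda>(x, y). U G x y \<times> W G x y" "2 * k * (2 * k)" "s * s"] by blast
    moreover have "card (\<Phi> G) = card ?S"
      unfolding \<Phi>_def by (rule card_image) (auto simp: inj_on_def r_def)
    ultimately show "finite (\<Phi> G) \<and> s * s * (2 * k * (2 * k)) \<le> real (card (\<Phi> G))"
      using fS by (simp add: \<Phi>_def)
    fix \<tau> assume "\<tau> \<in> \<Phi> G"
    then obtain x y u w where \<tau>: "\<tau> = ((x, u), (y, w))" and g: "x \<in> gX G" "y \<in> gY G" "u \<in> U G x y" "w \<in> W G x y"
      by (auto simp: \<Phi>_def r_def)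
    then have e: "x \<in> X" "y \<in> Y" "u \<in> X" "w \<in> Y" "{x, u} \<in> G - E1" "{y, w} \<in> G - E1" "{y, u} \<notin> G" "{x, w} \<notin> G"
      using X'(1) Y'(1) by (auto simp: gX_def gY_def U_def W_def nbrs_def)
    have ne: "x \<noteq> w" "y \<noteq> u" using e XY(3) by auto
    show sw: "\<tau> \<in> switchable E1 G" using e ne by (auto simp: switchable_def \<tau>)
    let ?G' = "switch \<tau> G"
    have "epairs ?G' X Y \<subseteq> insert (x, w) (insert (u, y) (epairs G X Y))"
      using e XY(3) by (auto simp: epairs_def switch_def \<tau> doubleton_eq_iff)
    then have "card (epairs ?G' X Y) \<le> card (insert (x, w) (insert (u, y) (epairs G X Y)))"
      using fX fY by (intro card_mono) (auto intro: finite_epairs)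
    also have "\<dots> \<le> card (epairs G X Y) + 2"
      using finite_epairs[OF fX fY, of G] by (simp add: card_insert_if)
    finally have c1: "real (card (epairs ?G' X Y)) \<le> m + 2" using mG by linarith
    then have c2: "real (card (epairs ?G' Y X)) \<le> m + 2" by (simp add: card_epairs_commute)
    have "\<tau> \<in> crossed_pairs (epairs ?G' X Y) (epairs ?G' Y X)"
      using e by (auto simp: crossed_pairs_def \<tau> epairs_def switch_def)
    then show "\<tau> \<in> crossed_pairs (epairs ?G' X Y) (epairs ?G' Y X) \<and>
        finite (crossed_pairs (epairs ?G' X Y) (epairs ?G' Y X)) \<and>
        real (card (crossed_pairs (epairs ?G' X Y) (epairs ?G' Y X))) \<le> (m + 2) * (m + 2)"
      using fX fY mult_mono[OF c1 c2] m by (simp add: finite_crossed_pairs finite_epairs card_crossed_pairs)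
  qed
qed

text \<open>An edge \<open>ly\<close> between a vertex \<open>l\<close> of low degree and \<open>y \<in> Y\<close> is traded for an edge \<open>hy\<close> with
  \<open>h \<in> H - Y\<close>, by moving another edge \<open>hz\<close> to \<open>lz\<close>. Because \<open>h\<close> has far more closed edges than
  \<open>l\<close> has edges, there are at least \<open>k\<close> choices for \<open>z\<close>; but the new edge \<open>hy\<close> is one of at most
  \<open>m + 1\<close>, and \<open>lz\<close> one of at most \<open>n * t\<close>. The only obstacle is a \<open>y\<close> that is already adjacent to
  half of \<open>S'\<close>. There are at most \<open>m / (2 * s)\<close> of those, so they account for at most half of the
  edges \<open>ly\<close>.\<close>
lemma few_graphs_with_low_vertices_attached:
  fixes k m s t x :: real
  assumes H: "H \<subseteq> {1..n}" and low: "\<And>v. v \<in> {1..n} - H \<Longrightarrow> real (ds v) \<le> t" and t: "0 \<le> t" "t + 1 \<le> 2 * k"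
    and Y: "Y \<subseteq> H"
    and S': "S' \<subseteq> H - Y" "\<And>v. v \<in> S' \<Longrightarrow> 4 * k \<le> real (ds v) - real (card (nbrs E1 v))" "4 * s \<le> real (card S')"
    and k: "0 < k" and s: "0 < s" and m: "0 \<le> m" "m \<le> s * k" "real n * m \<le> x * s" and x: "0 \<le> x"
  shows "real (card {G \<in> extensions n ds E1. real (card (epairs G (H - Y) Y)) \<le> m \<and>
        x \<le> real (card (epairs (G - E1) ({1..n} - H) Y))}) * (x / 2 * (s * k))
    \<le> real (card (extensions n ds E1)) * (real n * t * (m + 1))"
proof -
  let ?V = "{1..n}" and ?L = "{1..n} - H"
  have fH: "finite H" and fY: "finite Y" and fS: "finite S'"
    using H Y S'(1) by (meson finite_atLeastAtMost finite_subset Diff_subset subset_trans)+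
  \<comment> \<open>Vertices of Y adjacent to too much of S', the usable edges into Y, and the choices of h and z.\<close>
  define Yb where "Yb G = {y \<in> Y. 2 * s \<le> real (card (nbrs G y \<inter> S'))}" for G :: "nat set set"
  define Pr where "Pr G = epairs (G - E1) ?L Y - ?L \<times> Yb G" for G
  define hs where "hs G y = S' - nbrs G y \<inter> S' - {h \<in> H - Y. k \<le> real (card (nbrs G h \<inter> Y))}" for G y
  define zs where "zs G l h = nbrs G h - nbrs E1 h - nbrs G h \<inter> Y - nbrs G l - {l}" for G l h
  define \<Phi> where "\<Phi> G = Sigma (Pr G) (\<lambda>ly. Sigma (hs G (snd ly)) (zs G (fst ly)))" for G
  show ?thesis
  proof (rule switching_double_count[where \<Phi> = \<Phi> and
        \<Psi> = "\<lambda>G. crossed_pairs (epairs G ?L ?V) (epairs G (H - Y) Y)"])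
    let ?B = "{G \<in> extensions n ds E1. real (card (epairs G (H - Y) Y)) \<le> m \<and>
        x \<le> real (card (epairs (G - E1) ?L Y))}"
    show "?B \<subseteq> extensions n ds E1" by auto
    show "0 \<le> real n * t * (m + 1)" using m t by simp
    fix G assume "G \<in> ?B"
    then have G: "G \<in> extensions n ds E1" and mG: "real (card (epairs G (H - Y) Y)) \<le> m"
      and xG: "x \<le> real (card (epairs (G - E1) ?L Y))" by auto
    note GD = extensionsD[OF G]
    have cPr: "x / 2 \<le> real (card (Pr G))"
    proof -
      have "card (epairs G Y S') \<le> card (epairs G Y (H - Y))"
        using fH fY S'(1) by (intro card_epairs_mono) auto
      then have "real (card (epairs G Y S')) \<le> m" using mG by (simp add: card_epairs_commute[of G Y])
      then have "real (card (Yb G)) * (2 * s) \<le> m"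
        using few_vertices_with_many_nbrs[OF fY fS, of "2 * s" G] unfolding Yb_def by linarith
      then have "real n * (real (card (Yb G)) * (2 * s)) \<le> real n * m" by (rule mult_left_mono) simp
      then have "(real n * real (card (Yb G)) * 2) * s \<le> x * s" using m(3) by (simp add: mult_ac)
      then have "real n * real (card (Yb G)) \<le> x / 2" using s by simp
      moreover have "real (card (?L \<times> Yb G)) \<le> real n * real (card (Yb G))"
      proof -
        have "card ?L \<le> n" using card_mono[of ?V ?L] by simp
        then show ?thesis by (simp add: card_cartesian_product mult_right_mono)
      qed
      moreover have "finite (?L \<times> Yb G)" using fY by (simp add: Yb_def)
      ultimately show ?thesis
        using card_Diff_ge[of "?L \<times> Yb G" "epairs (G - E1) ?L Y"] xG unfolding Pr_def by linarith
    qed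
    have chs: "s \<le> real (card (hs G y))" if y: "y \<in> Y" "y \<notin> Yb G" for y
    proof -
      let ?Z = "{h \<in> H - Y. k \<le> real (card (nbrs G h \<inter> Y))}"
      have "real (card ?Z) * k \<le> s * k"
        using few_vertices_with_many_nbrs[of "H - Y" Y k G] fH fY mG m by fastforce
      then have "real (card ?Z) \<le> s" using k by simp
      moreover have "real (card (nbrs G y \<inter> S')) < 2 * s" using y by (auto simp: Yb_def not_le)
      ultimately show ?thesis
        using card_Diff_ge[of "nbrs G y \<inter> S'" S'] card_Diff_ge[of ?Z "S' - nbrs G y \<inter> S'"] S'(3) fS fH
        unfolding hs_def by simp
    qed
    have czs: "k \<le> real (card (zs G l h))" if l: "l \<in> ?L" and h: "h \<in> S'" "h \<notin> {h \<in> H - Y. k \<le> real (card (nbrs G h \<inter> Y))}" for l h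
    proof -
      have f1: "finite (nbrs E1 h)" using GD(4)[of h] nbrs_mono[OF GD(2), of h] finite_subset by blast
      have hV: "h \<in> ?V" using h S'(1) H by auto
      have "real (card (nbrs G h \<inter> Y)) < k" using h S'(1) by (auto simp: not_le)
      moreover have "real (card (nbrs G l)) \<le> t" using low[OF l] GD(3)[of l] l by auto
      moreover have "real (card (nbrs G h)) - real (card (nbrs E1 h)) - real (card (nbrs G h \<inter> Y)) -
          real (card (nbrs G l)) - 1 \<le> real (card (zs G l h))"
        unfolding zs_def
        using card_Diff_ge[OF f1, of "nbrs G h"]
          card_Diff_ge[of "nbrs G h \<inter> Y" "nbrs G h - nbrs E1 h"]
          card_Diff_ge[of "nbrs G l" "nbrs G h - nbrs E1 h - nbrs G h \<inter> Y"]
          card_Diff_ge[of "{l}" "nbrs G h - nbrs E1 h - nbrs G h \<inter> Y - nbrs G l"] GD(4)[of h] GD(4)[of l] fY by simp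
      ultimately show ?thesis using GD(3)[OF hV] S'(2)[OF h(1)] t by linarith
    qed
    have fPr: "finite (Pr G)" using fY by (simp add: Pr_def finite_epairs)
    have fhs: "finite (hs G y)" for y using fS by (simp add: hs_def)
    have fzs: "finite (zs G l h)" for l h using GD(4) by (simp add: zs_def)
    have fin2: "finite (Sigma (hs G y) (zs G l))" for y l using fhs fzs by blast
    have inner: "s * k \<le> real (card (Sigma (hs G (snd ly)) (zs G (fst ly))))" if ly: "ly \<in> Pr G" for ly
    proof -
      have y: "snd ly \<in> Y" "snd ly \<notin> Yb G" and l: "fst ly \<in> ?L"
        using ly by (cases ly; auto simp: Pr_def epairs_def)+
      have "k \<le> real (card (zs G (fst ly) h))" if "h \<in> hs G (snd ly)" for h
        by (rule czs[OF l]) (use that in \<open>auto simp: hs_def\<close>)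
      then show ?thesis using card_Sigma_ge[of "hs G (snd ly)" "zs G (fst ly)" k s] fhs fzs chs[OF y] k by simp
    qed
    have "x / 2 * (s * k) \<le> real (card (\<Phi> G))"
      unfolding \<Phi>_def
      using card_Sigma_ge[of "Pr G" "\<lambda>ly. Sigma (hs G (snd ly)) (zs G (fst ly))" "s * k" "x / 2"] fPr fin2 inner cPr s k
      by simp
    moreover have "finite (\<Phi> G)" unfolding \<Phi>_def using fPr fin2 by blast
    ultimately show "finite (\<Phi> G) \<and> x / 2 * (s * k) \<le> real (card (\<Phi> G))" by simp
    fix \<tau> assume \<tau>\<Phi>: "\<tau> \<in> \<Phi> G"
    obtain l y h z where \<tau>: "\<tau> = ((l, y), (h, z))" by (metis prod.exhaust)
    have e: "l \<in> ?L" "y \<in> Y" "{l, y} \<in> G - E1" "h \<in> S'" "y \<notin> nbrs G h" "{h, z} \<in> G - E1" "z \<notin> nbrs G l" "z \<noteq> l"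
      using \<tau>\<Phi> by (auto simp: \<tau> \<Phi>_def Pr_def hs_def zs_def epairs_def nbrs_def insert_commute)
    have hH: "h \<in> H" "h \<notin> Y" using e S'(1) by auto
    have zV: "z \<in> ?V" using e simple_graph_edgeD(3)[OF GD(1)] by blast
    show sw: "\<tau> \<in> switchable E1 G" using e hH by (auto simp: switchable_def \<tau> nbrs_def)
    let ?G' = "switch \<tau> G"
    have G': "?G' \<in> extensions n ds E1" by (rule switch_in_extensions[OF G sw])
    have c1: "real (card (epairs ?G' ?L ?V)) \<le> real n * t"
      by (rule card_epairs_low_le[OF G' low _ t(1)]) auto
    have "epairs ?G' (H - Y) Y \<subseteq> insert (h, y) (epairs G (H - Y) Y)"
      using e hH Y by (auto simp: epairs_def switch_def \<tau> doubleton_eq_iff)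
    then have "card (epairs ?G' (H - Y) Y) \<le> card (insert (h, y) (epairs G (H - Y) Y))"
      using fH fY by (intro card_mono) (auto intro: finite_epairs)
    also have "\<dots> \<le> card (epairs G (H - Y) Y) + 1"
      using finite_epairs[of "H - Y" Y G] fH fY by (simp add: card_insert_if)
    finally have c2: "real (card (epairs ?G' (H - Y) Y)) \<le> m + 1" using mG by linarith
    have "\<tau> \<in> crossed_pairs (epairs ?G' ?L ?V) (epairs ?G' (H - Y) Y)"
      using e hH zV by (auto simp: crossed_pairs_def \<tau> epairs_def switch_def)
    then show "\<tau> \<in> crossed_pairs (epairs ?G' ?L ?V) (epairs ?G' (H - Y) Y) \<and>
        finite (crossed_pairs (epairs ?G' ?L ?V) (epairs ?G' (H - Y) Y)) \<and>
        real (card (crossed_pairs (epairs ?G' ?L ?V) (epairs ?G' (H - Y) Y))) \<le> real n * t * (m + 1)"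
      using fH fY mult_mono[OF c1 c2] m t by (simp add: finite_crossed_pairs finite_epairs card_crossed_pairs)
  qed
qed

section \<open>Percolation of a fixed graph\<close>

definition cut :: "'a set set \<Rightarrow> 'a set \<Rightarrow> 'a set \<Rightarrow> 'a set set" where
  "cut G X Y = (\<lambda>(x, y). {x, y}) ` epairs G X Y"

lemma cut_subset: "cut G X Y \<subseteq> G"
  by (auto simp: cut_def epairs_def)

lemma cut_Int: "E1 \<subseteq> G \<Longrightarrow> cut G X Y \<inter> E1 = cut E1 X Y"
  by (auto simp: cut_def epairs_def image_iff)

lemma cut_Diff: "cut G X Y - E1 = cut (G - E1) X Y"
  by (auto simp: cut_def epairs_def image_iff)

lemma finite_cut: "finite X \<Longrightarrow> finite Y \<Longrightarrow> finite (cut G X Y)"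
  by (simp add: cut_def finite_epairs)

lemma card_cut_le: "finite X \<Longrightarrow> finite Y \<Longrightarrow> card (cut G X Y) \<le> card (epairs G X Y)"
  unfolding cut_def by (intro card_image_le finite_epairs)

lemma card_cut_disjoint: "X \<inter> Y = {} \<Longrightarrow> card (cut G X Y) = card (epairs G X Y)"
  unfolding cut_def by (intro card_image) (auto simp: inj_on_def epairs_def doubleton_eq_iff)

lemma card_epairs_le_cut:
  fixes G :: "nat set set"
  assumes "simple_graph V G" "finite X" "finite Y"
  shows "card (epairs G X Y) \<le> 2 * card (cut G X Y)"
proof -
  let ?P = "epairs G X Y"
  let ?u = "{p \<in> ?P. fst p < snd p}" and ?d = "{p \<in> ?P. snd p < fst p}"
  have "?P \<subseteq> ?u \<union> ?d" using simple_graph_edgeD(1)[OF assms(1)] by (force simp: epairs_def)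
  then have "card ?P \<le> card (?u \<union> ?d)" using finite_epairs[OF assms(2,3)] by (intro card_mono) auto
  also have "\<dots> \<le> card ?u + card ?d" by (rule card_Un_le)
  also have "card ?u \<le> card (cut G X Y)"
    using finite_cut[OF assms(2,3)]
    by (intro card_inj_on_le[of "\<lambda>(x, y). {x, y}"]) (auto simp: inj_on_def doubleton_eq_iff cut_def)
  also have "card ?d \<le> card (cut G X Y)"
    using finite_cut[OF assms(2,3)]
    by (intro card_inj_on_le[of "\<lambda>(x, y). {x, y}"]) (auto simp: inj_on_def doubleton_eq_iff cut_def)
  finally show ?thesis by simp
qed

lemma prob_mono_percolation:
  assumes "finite E" "\<And>E1. E1 \<subseteq> E \<Longrightarrow> P E1 \<Longrightarrow> Q E1"
  shows "measure_pmf.prob (percolation p E) {E1. P E1} \<le> measure_pmf.prob (percolation p E) {E1. Q E1}"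
  using set_percolation[OF assms(1), of p] assms(2)
  by (intro measure_pmf.finite_measure_mono_AE) (auto simp: AE_measure_pmf_iff)

lemma prob_exists_le:
  assumes "finite \<Y>" "real (card \<Y>) \<le> s" "0 \<le> r" "\<And>Y. Y \<in> \<Y> \<Longrightarrow> measure_pmf.prob M {x. P Y x} \<le> r"
  shows "measure_pmf.prob M {x. \<exists>Y\<in>\<Y>. P Y x} \<le> s * r"
proof -
  have "measure_pmf.prob M {x. \<exists>Y\<in>\<Y>. P Y x} = measure_pmf.prob M (\<Union>Y\<in>\<Y>. {x. P Y x})"
    by (rule arg_cong[where f = "measure_pmf.prob _"]) auto
  also have "\<dots> \<le> (\<Sum>Y\<in>\<Y>. measure_pmf.prob M {x. P Y x})"
    using assms by (intro measure_pmf.finite_measure_subadditive_finite) auto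
  also have "\<dots> \<le> (\<Sum>Y\<in>\<Y>. r)" using assms by (intro sum_mono) auto
  also have "\<dots> \<le> s * r" using assms by (simp add: mult_right_mono)
  finally show ?thesis .
qed

lemma prob_closed_cut_le:
  fixes p t :: real
  assumes "finite E" "0 \<le> p" "p \<le> 1" "finite \<Y>" "real (card \<Y>) \<le> s"
    and "\<And>Y. Y \<in> \<Y> \<Longrightarrow> X Y \<inter> Z Y = {}"
  shows "measure_pmf.prob (percolation p E)
    {E1. \<exists>Y\<in>\<Y>. t \<le> real (card (epairs E (X Y) (Z Y))) \<and> epairs E1 (X Y) (Z Y) = {}} \<le> s * exp (- p * t)"
proof (rule prob_exists_le[OF assms(4,5)])
  fix Y assume Y: "Y \<in> \<Y>"
  show "measure_pmf.prob (percolation p E)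
      {E1. t \<le> real (card (epairs E (X Y) (Z Y))) \<and> epairs E1 (X Y) (Z Y) = {}} \<le> exp (- p * t)"
  proof (cases "t \<le> real (card (epairs E (X Y) (Z Y)))")
    case True
    have "measure_pmf.prob (percolation p E)
        {E1. t \<le> real (card (epairs E (X Y) (Z Y))) \<and> epairs E1 (X Y) (Z Y) = {}} \<le>
        measure_pmf.prob (percolation p E) {E1. cut E (X Y) (Z Y) \<inter> E1 = {}}"
      by (rule prob_mono_percolation[OF assms(1)]) (simp add: cut_Int, simp add: cut_def)
    also have "\<dots> = (1 - p) ^ card (cut E (X Y) (Z Y))"
      by (rule prob_all_closed[OF assms(1) cut_subset assms(2,3)])
    also have "\<dots> \<le> exp (- p * t)"
      using True assms(2,3) by (intro one_minus_power_le_exp) (simp_all add: card_cut_disjoint[OF assms(6)[OF Y]])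
    finally show ?thesis .
  qed simp
qed simp

text \<open>With weight \<open>1 + \<epsilon>\<close> for an open and \<open>1 - p\<close> for a closed edge, each edge has expected weight
  \<open>1 - p * (1 - \<epsilon> - p) \<le> 1\<close>. The factor 2 accounts for edges inside \<open>L\<close>, which occur in two ordered
  pairs.\<close>
lemma prob_many_open_few_closed:
  fixes p \<epsilon> a b :: real and G :: "nat set set"
  assumes V: "finite V" "simple_graph V G" and p: "0 \<le> p" "p \<le> 1 - \<epsilon>" "0 < \<epsilon>"
    and fin: "finite \<Y>" "real (card \<Y>) \<le> s" "\<And>Y. Y \<in> \<Y> \<Longrightarrow> finite Y" "finite L"
  shows "measure_pmf.prob (percolation p G)
    {E1. \<exists>Y\<in>\<Y>. 2 * a \<le> real (card (epairs E1 L (L \<union> Y))) \<and> real (card (epairs (G - E1) L (L \<union> Y))) \<le> b}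
     \<le> s * (1 / ((1 + \<epsilon>) powr a * (1 - p) powr b))"
proof (rule prob_exists_le[OF fin(1,2)])
  have fG: "finite G" by (rule simple_graph_finite[OF V])
  have p1: "p \<le> 1" "0 < 1 - p" using p by auto
  show "0 \<le> 1 / ((1 + \<epsilon>) powr a * (1 - p) powr b)" by simp
  fix Y assume "Y \<in> \<Y>"
  then have fY: "finite (L \<union> Y)" using fin by auto
  let ?T = "cut G L (L \<union> Y)"
  have "measure_pmf.prob (percolation p G)
      {E1. 2 * a \<le> real (card (epairs E1 L (L \<union> Y))) \<and> real (card (epairs (G - E1) L (L \<union> Y))) \<le> b}
      \<le> (p * (1 + \<epsilon>) + (1 - p) * (1 - p)) ^ card ?T / ((1 + \<epsilon>) powr a * (1 - p) powr b)"
  proof (rule percolation_weight_bound[OF fG cut_subset p(1) p1(1)])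
    show "0 < (1 + \<epsilon>) powr a * (1 - p) powr b" using p p1 by simp
    fix E1 assume E1: "E1 \<subseteq> G"
      and P: "2 * a \<le> real (card (epairs E1 L (L \<union> Y))) \<and> real (card (epairs (G - E1) L (L \<union> Y))) \<le> b"
    have sE1: "simple_graph V E1" by (rule simple_graph_mono[OF V(2) E1])
    have "a \<le> real (card (?T \<inter> E1))"
      using P card_epairs_le_cut[OF sE1 fin(4) fY] unfolding cut_Int[OF E1] by linarith
    then have 1: "(1 + \<epsilon>) powr a \<le> (1 + \<epsilon>) ^ card (?T \<inter> E1)"
      using p by (subst powr_realpow[symmetric]) (auto intro: powr_mono)
    have "real (card (?T - E1)) \<le> b"
      using P card_cut_le[OF fin(4) fY, of "G - E1"] unfolding cut_Diff by linarith
    then have 2: "(1 - p) powr b \<le> (1 - p) ^ card (?T - E1)"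
      using p p1 by (subst powr_realpow[symmetric]) (auto intro: powr_mono')
    show "(1 + \<epsilon>) powr a * (1 - p) powr b \<le> (1 + \<epsilon>) ^ card (?T \<inter> E1) * (1 - p) ^ card (?T - E1)"
      using 1 2 p by (intro mult_mono) auto
  qed (use p p1 in auto)
  also have "\<dots> \<le> 1 / ((1 + \<epsilon>) powr a * (1 - p) powr b)"
  proof (rule divide_right_mono)
    have "p * (1 + \<epsilon>) + (1 - p) * (1 - p) = 1 - p * (1 - \<epsilon> - p)" by (simp add: algebra_simps)
    also have "\<dots> \<le> 1" using p by simp
    finally show "(p * (1 + \<epsilon>) + (1 - p) * (1 - p)) ^ card ?T \<le> 1"
      using p p1 by (intro power_le_one) auto
  qed simp
  finally show "measure_pmf.prob (percolation p G)
      {E1. 2 * a \<le> real (card (epairs E1 L (L \<union> Y))) \<and> real (card (epairs (G - E1) L (L \<union> Y))) \<le> b}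
      \<le> 1 / ((1 + \<epsilon>) powr a * (1 - p) powr b)" .
qed

lemma prob_count_le:
  fixes z r :: real
  assumes "finite V" "0 < z" "\<And>v. v \<in> V \<Longrightarrow> measure_pmf.prob M {x. P v x} \<le> r"
  shows "measure_pmf.prob M {x. z \<le> real (card {v \<in> V. P v x})} \<le> real (card V) * r / z"
proof -
  let ?I = "\<lambda>x. \<Sum>v\<in>V. indicator {x. P v x} x :: real"
  have I: "real (card {v \<in> V. P v x}) = ?I x" for x
    using assms(1) by (simp add: indicator_def sum.If_cases Int_def)
  have int: "integrable M (indicator {x. P v x} :: _ \<Rightarrow> real)" for v
    by (intro measure_pmf.integrable_const_bound[where B = 1]) auto
  have intI: "integrable M ?I" using int by (intro Bochner_Integration.integrable_sum)
  have "measure_pmf.prob M {x \<in> space M. z \<le> ?I x} \<le> measure_pmf.expectation M ?I / z"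
    by (rule integral_Markov_inequality_measure[where A = UNIV]) (use intI assms in \<open>auto intro!: sum_nonneg\<close>)
  also have "measure_pmf.expectation M ?I = (\<Sum>v\<in>V. measure_pmf.prob M {x. P v x})"
    using int by (subst Bochner_Integration.integral_sum) auto
  also have "\<dots> / z \<le> (\<Sum>v\<in>V. r) / z" using assms by (intro divide_right_mono sum_mono) auto
  finally show ?thesis by (simp add: I)
qed

definition star :: "'a set set \<Rightarrow> 'a \<Rightarrow> 'a set set" where
  "star G v = {e \<in> G. v \<in> e}"

lemma card_star: "simple_graph V G \<Longrightarrow> card (star G v) = card (nbrs G v)"
  by (simp add: card_nbrs star_def vertex_degree_def)

lemma star_Int: "E1 \<subseteq> G \<Longrightarrow> star G v \<inter> E1 = star E1 v"
  by (auto simp: star_def)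

text \<open>Although \<open>p\<close> may be close to 1, an edge is closed with probability at least \<open>\<epsilon>\<close>. Giving
  each closed edge the weight \<open>exp (- 1)\<close> turns this into an exponential lower tail bound.\<close>
lemma prob_few_closed_nbrs:
  fixes p \<epsilon> t :: real
  assumes V: "finite V" "simple_graph V G" and p: "0 \<le> p" "p \<le> 1 - \<epsilon>" "0 < \<epsilon>"
    and t: "t \<le> real (card (nbrs G v))"
  shows "measure_pmf.prob (percolation p G)
    {E1. real (card (nbrs G v)) - real (card (nbrs E1 v)) < \<epsilon> / 4 * real (card (nbrs G v))} \<le> exp (- \<epsilon> * t / 4)"
proof -
  let ?D = "real (card (nbrs G v))" and ?T = "star G v"
  have fG: "finite G" by (rule simple_graph_finite[OF V])
  have cT: "card ?T = card (nbrs G v)" by (rule card_star[OF V(2)])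
  have fT: "finite ?T" using fG by (simp add: star_def)
  have "measure_pmf.prob (percolation p G) {E1. ?D - real (card (nbrs E1 v)) < \<epsilon> / 4 * ?D}
      \<le> (p * 1 + (1 - p) * exp (- 1)) ^ card ?T / exp (- (\<epsilon> / 4 * ?D))"
  proof (rule percolation_weight_bound[OF fG])
    show "?T \<subseteq> G" by (auto simp: star_def)
    fix E1 assume E1: "E1 \<subseteq> G" and P: "?D - real (card (nbrs E1 v)) < \<epsilon> / 4 * ?D"
    have "card (?T \<inter> E1) = card (nbrs E1 v)"
      unfolding star_Int[OF E1] by (rule card_star[OF simple_graph_mono[OF V(2) E1]])
    then have "real (card (?T - E1)) = ?D - real (card (nbrs E1 v))"
      using card_Diff_subset_Int[of ?T E1] fT cT card_mono[OF fT, of "?T \<inter> E1"] by simp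
    then have "exp (- (\<epsilon> / 4 * ?D)) \<le> exp (- real (card (?T - E1)))" using P by simp
    then show "exp (- (\<epsilon> / 4 * ?D)) \<le> 1 ^ card (?T \<inter> E1) * exp (- 1) ^ card (?T - E1)"
      by (simp add: exp_of_nat_mult[symmetric])
  qed (use p in auto)
  also have "\<dots> \<le> exp (- \<epsilon> * ?D / 2) / exp (- (\<epsilon> / 4 * ?D))"
  proof (rule divide_right_mono)
    have "exp (- 1 :: real) \<le> 1 / 2" using exp_ge_add_one_self[of "1 :: real"] by (simp add: exp_minus field_simps)
    then have "p * 1 + (1 - p) * exp (- 1) \<le> p + (1 - p) * (1 / 2)" using p by (intro add_mono mult_left_mono) auto
    also have "\<dots> \<le> 1 - \<epsilon> / 2" using p by (simp add: field_simps)
    finally have "p * 1 + (1 - p) * exp (- 1) \<le> 1 - \<epsilon> / 2" .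
    then have "(p * 1 + (1 - p) * exp (- 1)) ^ card ?T \<le> (1 - \<epsilon> / 2) ^ card ?T"
      using p by (intro power_mono) auto
    also have "\<dots> \<le> exp (- (\<epsilon> / 2) * ?D)" using p cT by (intro one_minus_power_le_exp) auto
    finally show "(p * 1 + (1 - p) * exp (- 1)) ^ card ?T \<le> exp (- \<epsilon> * ?D / 2)" by simp
  qed simp
  also have "\<dots> = exp (- \<epsilon> * ?D / 4)" by (simp add: exp_diff[symmetric])
  also have "\<dots> \<le> exp (- \<epsilon> * t / 4)" using t p by simp
  finally show ?thesis .
qed

text \<open>Chebyshev's inequality. Non-adjacent vertices are isolated independently of each other, since no
  edge contains both; so only the diagonal and the at most \<open>card A * D\<close> ordered pairs of adjacent vertices
  contribute to the variance.\<close>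
lemma prob_few_isolated:
  fixes p D \<mu> :: real
  assumes V: "finite V" "simple_graph V G" and A: "A \<subseteq> V" and p: "0 \<le> p" "p \<le> 1"
    and D: "\<And>v. v \<in> A \<Longrightarrow> real (card (nbrs G v)) \<le> D"
    and \<mu>: "0 < \<mu>" "\<mu> \<le> (\<Sum>v\<in>A. (1 - p) ^ card (nbrs G v))"
  shows "measure_pmf.prob (percolation p G) {E1. real (card {v \<in> A. nbrs E1 v = {}}) < \<mu> / 2}
    \<le> 4 * real (card A) * (1 + D) / \<mu>\<^sup>2"
proof -
  let ?M = "percolation p G"
  have fG: "finite G" by (rule simple_graph_finite[OF V])
  have fA: "finite A" using V A finite_subset by blast
  define iso where "iso v = (indicator {E1. star G v \<inter> E1 = {}} :: _ \<Rightarrow> real)" for v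
  define X where "X E1 = (\<Sum>v\<in>A. iso v E1)" for E1
  define \<pi> where "\<pi> v = (1 - p) ^ card (nbrs G v)" for v
  define \<mu>' where "\<mu>' = (\<Sum>v\<in>A. \<pi> v)"
  have bounded: "integrable ?M f" if "\<And>x. \<bar>f x\<bar> \<le> B" for f :: "_ \<Rightarrow> real" and B
    using that by (intro measure_pmf.integrable_const_bound[where B = B]) auto
  have iso01: "0 \<le> iso v E1" "iso v E1 \<le> 1" for v E1 by (auto simp: iso_def indicator_def)
  have Eiso: "measure_pmf.expectation ?M (iso v) = \<pi> v" for v
  proof -
    have "measure_pmf.expectation ?M (iso v) = measure_pmf.prob ?M {E1. star G v \<inter> E1 = {}}" by (simp add: iso_def)
    also have "\<dots> = (1 - p) ^ card (star G v)" by (rule prob_all_closed[OF fG _ p]) (auto simp: star_def)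
    finally show ?thesis by (simp add: \<pi>_def card_star[OF V(2)])
  qed
  have Eiso2: "measure_pmf.expectation ?M (\<lambda>E1. iso v E1 * iso w E1) \<le>
      \<pi> v * \<pi> w + (if w = v \<or> w \<in> nbrs G v then 1 else 0)" for v w
  proof -
    have 1: "measure_pmf.expectation ?M (\<lambda>E1. iso v E1 * iso w E1) = (1 - p) ^ card (star G v \<union> star G w)"
    proof -
      have "(\<lambda>E1. iso v E1 * iso w E1) = indicator {E1. (star G v \<union> star G w) \<inter> E1 = {}}"
        by (auto simp: iso_def indicator_def fun_eq_iff)
      then have "measure_pmf.expectation ?M (\<lambda>E1. iso v E1 * iso w E1) =
          measure_pmf.prob ?M {E1. (star G v \<union> star G w) \<inter> E1 = {}}" by simp
      also have "\<dots> = (1 - p) ^ card (star G v \<union> star G w)"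
        by (rule prob_all_closed[OF fG _ p]) (auto simp: star_def)
      finally show ?thesis .
    qed
    have pi: "0 \<le> \<pi> v" "0 \<le> \<pi> w" using p by (auto simp: \<pi>_def)
    show ?thesis
    proof (cases "w = v \<or> w \<in> nbrs G v")
      case True
      have "(1 - p) ^ card (star G v \<union> star G w) \<le> 1" using p by (intro power_le_one) auto
      then show ?thesis using True pi by (auto simp: 1 intro: order_trans)
    next
      case False
      have "star G v \<inter> star G w = {}"
      proof (rule ccontr)
        assume "star G v \<inter> star G w \<noteq> {}"
        then obtain e where e: "e \<in> G" "v \<in> e" "w \<in> e" by (auto simp: star_def)
        then obtain a b where "e = {a, b}" using simple_graph_edgeE[OF V(2)] by metis
        then have "e = {v, w}" using e False by auto
        then show False using e False by (auto simp: nbrs_def)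
      qed
      moreover have "finite (star G v)" "finite (star G w)" using fG by (auto simp: star_def)
      ultimately have "card (star G v \<union> star G w) = card (nbrs G v) + card (nbrs G w)"
        by (simp add: card_Un_disjoint card_star[OF V(2)])
      then show ?thesis using False by (simp add: 1 \<pi>_def power_add)
    qed
  qed
  have bX: "\<bar>X E1\<bar> \<le> real (card A)" for E1
  proof -
    have "\<bar>X E1\<bar> = X E1" using iso01 by (simp add: X_def sum_nonneg)
    also have "\<dots> \<le> (\<Sum>v\<in>A. 1)" unfolding X_def using iso01 by (intro sum_mono) auto
    finally show ?thesis by simp
  qed
  have intX: "integrable ?M X" using bX by (rule bounded)
  have bX2: "\<bar>(X E1)\<^sup>2\<bar> \<le> (real (card A))\<^sup>2" for E1
    using bX[of E1] by (simp add: abs_le_square_iff[symmetric])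
  have intX2: "integrable ?M (\<lambda>E1. (X E1)\<^sup>2)" using bX2 by (rule bounded)
  have intiso: "integrable ?M (iso v)" for v using iso01 by (intro bounded[of _ 1]) auto
  have intiso2: "integrable ?M (\<lambda>E1. iso v E1 * iso w E1)" for v w
  proof (rule bounded)
    show "\<bar>iso v E1 * iso w E1\<bar> \<le> 1" for E1
      using mult_le_one[OF iso01(2)[of v E1] iso01(1)[of w E1] iso01(2)[of w E1]] iso01(1)[of v E1] iso01(1)[of w E1]
      by simp
  qed
  have EX: "measure_pmf.expectation ?M X = \<mu>'"
    unfolding X_def \<mu>'_def using intiso by (subst Bochner_Integration.integral_sum) (auto simp: Eiso)
  have EX2: "measure_pmf.expectation ?M (\<lambda>E1. (X E1)\<^sup>2) \<le> \<mu>'\<^sup>2 + real (card A) * (1 + D)"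
  proof -
    have "(\<lambda>E1. (X E1)\<^sup>2) = (\<lambda>E1. \<Sum>v\<in>A. \<Sum>w\<in>A. iso v E1 * iso w E1)"
      by (simp add: X_def power2_eq_square sum_product)
    then have "measure_pmf.expectation ?M (\<lambda>E1. (X E1)\<^sup>2) =
        (\<Sum>v\<in>A. \<Sum>w\<in>A. measure_pmf.expectation ?M (\<lambda>E1. iso v E1 * iso w E1))"
      using intiso2 by (simp add: Bochner_Integration.integral_sum Bochner_Integration.integrable_sum)
    also have "\<dots> \<le> (\<Sum>v\<in>A. \<Sum>w\<in>A. \<pi> v * \<pi> w + (if w = v \<or> w \<in> nbrs G v then 1 else 0))"
      by (intro sum_mono Eiso2)
    also have "\<dots> = \<mu>'\<^sup>2 + (\<Sum>v\<in>A. \<Sum>w\<in>A. if w = v \<or> w \<in> nbrs G v then 1 else 0)"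
      by (simp add: sum.distrib \<mu>'_def power2_eq_square sum_product)
    also have "(\<Sum>v\<in>A. \<Sum>w\<in>A. if w = v \<or> w \<in> nbrs G v then 1 else 0) \<le> (\<Sum>v\<in>A. 1 + D)"
    proof (rule sum_mono)
      fix v assume v: "v \<in> A"
      let ?N = "insert v (nbrs G v)"
      have "(\<Sum>w\<in>A. if w = v \<or> w \<in> nbrs G v then 1 else 0) = (\<Sum>w\<in>A \<inter> ?N. 1 :: real)"
        unfolding sum.inter_restrict[OF fA] by simp
      moreover have "card (A \<inter> ?N) \<le> card ?N" using finite_nbrs[OF V] by (intro card_mono) auto
      moreover have "card ?N \<le> 1 + card (nbrs G v)" using finite_nbrs[OF V] by (simp add: card_insert_if)
      ultimately show "(\<Sum>w\<in>A. if w = v \<or> w \<in> nbrs G v then 1 else 0) \<le> 1 + D" using D[OF v] by simp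
    qed
    finally show ?thesis by simp
  qed
  have \<mu>': "\<mu> \<le> \<mu>'" using \<mu> by (simp add: \<mu>'_def \<pi>_def)
  have "measure_pmf.prob ?M {E1. real (card {v \<in> A. nbrs E1 v = {}}) < \<mu> / 2} \<le>
      measure_pmf.prob ?M {E1. \<mu>' / 2 \<le> \<bar>X E1 - measure_pmf.expectation ?M X\<bar>}"
  proof (rule prob_mono_percolation[OF fG])
    fix E1 assume E1: "E1 \<subseteq> G" and P: "real (card {v \<in> A. nbrs E1 v = {}}) < \<mu> / 2"
    have "star G v \<inter> E1 = {} \<longleftrightarrow> nbrs E1 v = {}" for v
    proof -
      have "card (star E1 v) = card (nbrs E1 v)" by (rule card_star[OF simple_graph_mono[OF V(2) E1]])
      moreover have "finite (star E1 v)" using finite_subset[OF E1 fG] by (auto simp: star_def)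
      moreover have "finite (nbrs E1 v)" by (rule finite_nbrs[OF V(1) simple_graph_mono[OF V(2) E1]])
      ultimately show ?thesis by (metis star_Int[OF E1] card_0_eq)
    qed
    then have "X E1 = real (card {v \<in> A. nbrs E1 v = {}})"
      using fA by (simp add: X_def iso_def indicator_def sum.If_cases Int_def)
    then show "\<mu>' / 2 \<le> \<bar>X E1 - measure_pmf.expectation ?M X\<bar>" using P EX \<mu>' \<mu>(1) by auto
  qed
  also have "\<dots> \<le> measure_pmf.variance ?M X / (\<mu>' / 2)\<^sup>2"
    using measure_pmf.Chebyshev_inequality[of X ?M "\<mu>' / 2"] intX2 \<mu> \<mu>' by simp
  also have "\<dots> \<le> (real (card A) * (1 + D)) / (\<mu>' / 2)\<^sup>2"
  proof (rule divide_right_mono)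
    have "measure_pmf.variance ?M X = measure_pmf.expectation ?M (\<lambda>E1. (X E1)\<^sup>2) - (measure_pmf.expectation ?M X)\<^sup>2"
      by (rule measure_pmf.variance_eq[OF intX intX2])
    then show "measure_pmf.variance ?M X \<le> real (card A) * (1 + D)" using EX EX2 by simp
  qed simp
  also have "\<dots> = 4 * real (card A) * (1 + D) / \<mu>'\<^sup>2" by (simp add: power2_eq_square)
  also have "\<dots> \<le> 4 * real (card A) * (1 + D) / \<mu>\<^sup>2"
  proof (cases "A = {}")
    case False
    then obtain v where "v \<in> A" by auto
    then have "0 \<le> D" using D[of v] by linarith
    then show ?thesis using \<mu> \<mu>' by (intro divide_left_mono) (auto intro: power_mono)
  qed simp
  finally show ?thesis .
qed

section \<open>Components\<close>

lemma equiv_connected_rel: "equiv V (connected_rel V E)"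
proof (rule equivI)
  show "connected_rel V E \<subseteq> V \<times> V" by (auto simp: connected_rel_def)
  show "refl_on V (connected_rel V E)" by (auto simp: refl_on_def connected_rel_def)
  have "sym {(x, y). {x, y} \<in> E}" by (auto simp: sym_def insert_commute)
  then have "sym ({(x, y). {x, y} \<in> E}\<^sup>*)" by (rule sym_rtrancl)
  then show "sym (connected_rel V E)" by (auto simp: sym_def connected_rel_def)
  show "trans (connected_rel V E)" by (auto simp: trans_def connected_rel_def)
qed

lemma component_subset: "K \<in> components V E \<Longrightarrow> K \<subseteq> V"
  unfolding components_def using equiv_connected_rel by (metis Union_quotient Union_upper)

lemma finite_components: "finite V \<Longrightarrow> finite (components V E)"
  by (rule finite_subset[of _ "Pow V"]) (auto dest: component_subset)

lemma component_ne: "K \<in> components V E \<Longrightarrow> K \<noteq> {}"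
  unfolding components_def using equiv_connected_rel by (metis in_quotient_imp_non_empty)

lemma component_disjoint: "K \<in> components V E \<Longrightarrow> K' \<in> components V E \<Longrightarrow> K = K' \<or> K \<inter> K' = {}"
  unfolding components_def by (rule quotient_disj[OF equiv_connected_rel])

lemma component_reach:
  assumes "K \<in> components V E" "u \<in> K" "v \<in> K"
  shows "(u, v) \<in> {(x, y). {x, y} \<in> E}\<^sup>*"
proof -
  have "(u, v) \<in> connected_rel V E"
    using assms unfolding components_def by (intro in_quotient_imp_in_rel[OF equiv_connected_rel]) auto
  then show ?thesis by (simp add: connected_rel_def)
qed

lemma component_edge_closed:
  assumes "K \<in> components V E" "{u, v} \<in> E" "u \<in> K" "v \<in> V"
  shows "v \<in> K"
proof -
  have "u \<in> V" using assms component_subset by blast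
  then have "(u, v) \<in> connected_rel V E" using assms by (auto simp: connected_rel_def)
  then show ?thesis
    using assms unfolding components_def by (metis in_quotient_imp_closed equiv_connected_rel)
qed

lemma component_of_vertex:
  assumes "v \<in> V"
  obtains K where "K \<in> components V E" "v \<in> K"
proof
  show "connected_rel V E `` {v} \<in> components V E" using assms by (auto simp: components_def quotientI)
  show "v \<in> connected_rel V E `` {v}" using assms by (auto simp: connected_rel_def)
qed

lemma card_connected_le_L1:
  assumes "finite V" "U \<subseteq> V" "q \<in> U" "\<And>u. u \<in> U \<Longrightarrow> (q, u) \<in> {(x, y). {x, y} \<in> E}\<^sup>*"
  shows "card U \<le> L1 V E"
proof -
  let ?K = "connected_rel V E `` {q}"
  have K: "?K \<in> components V E" using assms by (auto simp: components_def quotientI)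
  have "U \<subseteq> ?K" using assms by (auto simp: connected_rel_def)
  then have "card U \<le> card ?K" using component_subset[OF K] assms(1) finite_subset by (metis card_mono)
  also have "\<dots> \<le> L1 V E" unfolding L1_def using K finite_components[OF assms(1)] by (intro Max_ge) auto
  finally show ?thesis .
qed

lemma L1_le:
  assumes "finite V" "V \<noteq> {}" "\<And>K. K \<in> components V E \<Longrightarrow> card K \<le> m"
  shows "L1 V E \<le> m"
proof -
  have "components V E \<noteq> {}" using assms(2) component_of_vertex by (metis ex_in_conv)
  then show ?thesis unfolding L1_def using assms finite_components by (subst Max_le_iff) auto
qed

definition edge_closed :: "'a set set \<Rightarrow> 'a set \<Rightarrow> bool" where
  "edge_closed E Y \<longleftrightarrow> (\<forall>u v. {u, v} \<in> E \<longrightarrow> u \<in> Y \<longrightarrow> v \<in> Y)"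

text \<open>A smallest union of components that contains at least \<open>r\<close> vertices of \<open>H\<close> is a single component:
  otherwise it would be the union of two smaller ones, each with fewer than \<open>r\<close> vertices of \<open>H\<close>, and
  \<open>H\<close> would have fewer than \<open>3 * r\<close> vertices.\<close>
lemma dominating_component:
  fixes r :: real
  assumes V: "finite V" "simple_graph V E" and H: "H \<subseteq> V" "3 * r \<le> real (card H)" and r: "0 < r"
    and no_split: "\<And>Y. Y \<subseteq> V \<Longrightarrow> edge_closed E Y \<Longrightarrow> r \<le> real (card (Y \<inter> H)) \<Longrightarrow> real (card (H - Y)) < r"
  obtains Q where "Q \<in> components V E" "real (card (H - Q)) < r"
proof -
  let ?P = "\<lambda>Y. Y \<subseteq> V \<and> edge_closed E Y \<and> r \<le> real (card (Y \<inter> H))"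
  have fH: "finite H" using V H finite_subset by blast
  have "?P V" using V H r by (auto simp: edge_closed_def Int_absorb1 dest: simple_graph_edgeD)
  then obtain Y where Y: "?P Y" and min: "\<And>Z. ?P Z \<Longrightarrow> card Y \<le> card Z"
    using ex_has_least_nat[of ?P V card] by blast
  have HY: "real (card (H - Y)) < r" using no_split Y by blast
  have fY: "finite Y" using Y V finite_subset by blast
  have "Y \<inter> H \<noteq> {}" using Y r by auto
  then obtain v where v: "v \<in> Y" "v \<in> V" using Y by auto
  obtain K where K: "K \<in> components V E" "v \<in> K" using component_of_vertex[OF v(2)] by blast
  have KY: "K \<subseteq> Y"
  proof
    fix u assume "u \<in> K"
    have "(v, u) \<in> {(x, y). {x, y} \<in> E}\<^sup>*" by (rule component_reach[OF K \<open>u \<in> K\<close>])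
    then show "u \<in> Y"
      by (induction rule: rtrancl_induct) (use v(1) Y in \<open>auto simp: edge_closed_def\<close>)
  qed
  have cK: "edge_closed E K"
    unfolding edge_closed_def using component_edge_closed[OF K(1)] simple_graph_edgeD[OF V(2)] by blast
  show thesis
  proof (cases "K = Y")
    case True
    then show thesis using that[OF K(1)] HY by simp
  next
    case False
    have cYK: "edge_closed E (Y - K)"
      unfolding edge_closed_def
    proof (intro allI impI)
      fix a b assume ab: "{a, b} \<in> E" "a \<in> Y - K"
      then have "b \<in> Y" using Y by (auto simp: edge_closed_def)
      moreover have "b \<notin> K" using cK ab unfolding edge_closed_def by (metis DiffD2 insert_commute)
      ultimately show "b \<in> Y - K" by simp
    qed
    have lt: "card K < card Y" "card (Y - K) < card Y"
      using KY False K(2) fY by (auto intro!: psubset_card_mono)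
    have 1: "real (card (K \<inter> H)) < r" using min[of K] cK KY Y lt(1) by fastforce
    have 2: "real (card ((Y - K) \<inter> H)) < r" using min[of "Y - K"] cYK Y lt(2) by fastforce
    have "H \<subseteq> (K \<inter> H) \<union> ((Y - K) \<inter> H) \<union> (H - Y)" by auto
    then have "card H \<le> card ((K \<inter> H) \<union> ((Y - K) \<inter> H) \<union> (H - Y))" using fH by (intro card_mono) auto
    also have "\<dots> \<le> card (K \<inter> H) + card ((Y - K) \<inter> H) + card (H - Y)"
      by (meson add_mono card_Un_le le_refl order_trans)
    finally show thesis using 1 2 HY H(2) by linarith
  qed
qed

text \<open>In a component other than \<open>Q\<close> with at least two vertices, every vertex outside \<open>H\<close> has an edge
  inside the component, and this edge leads to a vertex outside \<open>H\<close> or to \<open>H - Q\<close>.\<close>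
lemma other_components_small:
  assumes V: "finite V" "simple_graph V E" and H: "H \<subseteq> V"
    and K: "K \<in> components V E" "Q \<in> components V E" "K \<noteq> Q"
  shows "card K \<le> max 1 (card (H - Q) + card (epairs E (V - H) ((V - H) \<union> (H - Q))))"
proof (cases "card K \<le> 1")
  case False
  let ?L = "V - H" and ?Z = "(V - H) \<union> (H - Q)"
  have fH: "finite H" using V H finite_subset by blast
  have KV: "K \<subseteq> V" and KQ: "K \<inter> Q = {}" using component_subset component_disjoint K by blast+
  have fK: "finite K" using KV V finite_subset by blast
  have "K - H \<subseteq> fst ` epairs E ?L ?Z"
  proof
    fix l assume l: "l \<in> K - H"
    obtain u where u: "u \<in> K" "u \<noteq> l"
      using False l fK by (metis DiffD1 One_nat_def card_le_Suc0_iff_eq order_refl)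
    have "(l, u) \<in> {(x, y). {x, y} \<in> E}\<^sup>*" by (rule component_reach[OF K(1)]) (use l u in auto)
    then obtain z where z: "{l, z} \<in> E" using u(2) by (auto elim: converse_rtranclE)
    have "z \<in> V" by (rule simple_graph_edgeD(3)[OF V(2) z])
    moreover from this have "z \<in> K" using component_edge_closed[OF K(1) z] l by auto
    ultimately have "(l, z) \<in> epairs E ?L ?Z" using z l KQ KV by (auto simp: epairs_def)
    then show "l \<in> fst ` epairs E ?L ?Z" by force
  qed
  then have "card (K - H) \<le> card (fst ` epairs E ?L ?Z)"
    using V fH by (intro card_mono) (auto intro!: finite_epairs)
  also have "\<dots> \<le> card (epairs E ?L ?Z)" using V fH by (intro card_image_le finite_epairs) auto
  finally have 1: "card (K - H) \<le> card (epairs E ?L ?Z)" .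
  have "card (K \<inter> H) \<le> card (H - Q)" using KQ fH by (intro card_mono) auto
  moreover have "card K = card (K \<inter> H) + card (K - H)"
    using fK by (metis Int_Diff_disjoint Un_Diff_Int card_Un_disjoint finite_Diff finite_Int inf_commute sup_commute)
  ultimately show ?thesis using 1 by simp
qed simp

lemma L1_growth:
  assumes V: "finite V" and Q: "Q \<in> components V E1" and U: "U \<subseteq> V - Q" "\<And>u. u \<in> U \<Longrightarrow> nbrs F u \<inter> Q \<noteq> {}"
  shows "card Q + card U \<le> L1 V (E1 \<union> F)"
proof -
  obtain q where q: "q \<in> Q" using component_ne[OF Q] by auto
  have QV: "Q \<subseteq> V" by (rule component_subset[OF Q])
  let ?R = "\<lambda>E. {(x, y). {x, y} \<in> E}\<^sup>*"
  have mono: "?R E1 \<subseteq> ?R (E1 \<union> F)" by (intro rtrancl_mono) auto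
  have "(q, u) \<in> ?R (E1 \<union> F)" if u: "u \<in> Q \<union> U" for u
  proof (cases "u \<in> Q")
    case True
    then show ?thesis using component_reach[OF Q q] mono by blast
  next
    case False
    then obtain z where z: "z \<in> Q" "{u, z} \<in> F" using u U(2)[of u] by (auto simp: nbrs_def)
    have "(q, z) \<in> ?R (E1 \<union> F)" using component_reach[OF Q q z(1)] mono by blast
    moreover have "(z, u) \<in> {(x, y). {x, y} \<in> E1 \<union> F}" using z by (simp add: insert_commute)
    ultimately show ?thesis by (rule rtrancl_into_rtrancl)
  qed
  then have "card (Q \<union> U) \<le> L1 V (E1 \<union> F)"
    using V QV U q by (intro card_connected_le_L1[of V _ q]) auto
  moreover have "card (Q \<union> U) = card Q + card U"
    using V QV U(1) finite_subset[of U "V - Q"] finite_subset[of Q V] by (intro card_Un_disjoint) auto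
  ultimately show ?thesis by simp
qed

text \<open>If the growth is less than \<open>c\<close>, then some set \<open>Y\<close> of at most \<open>c\<close> vertices comprises all vertices of \<open>A'\<close> that
  got an edge to \<open>Q\<close>, and all edges from \<open>A' - Y\<close> to \<open>Q\<close> stayed closed. A union bound over \<open>Y\<close> is
  affordable because such sets are few.\<close>
lemma prob_sprinkling_fails:
  fixes q b c w s :: real
  assumes V: "finite V" "simple_graph V G" "E1 \<subseteq> G"
    and Q: "Q \<in> components V E1" "L1 V E1 \<le> card Q"
    and A': "A' \<subseteq> V - Q" "b + c \<le> real (card A')" "\<And>a. a \<in> A' \<Longrightarrow> w \<le> real (card (nbrs (G - E1) a \<inter> Q))"
    and q: "0 \<le> q" "q \<le> 1" and w: "0 \<le> w"
    and s: "real (card {Y. Y \<subseteq> V \<and> real (card Y) \<le> c}) \<le> s"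
  shows "measure_pmf.prob (percolation q (G - E1)) {F. real (L1 V (E1 \<union> F)) - real (L1 V E1) < c}
    \<le> s * exp (- q * (b * w))"
proof -
  let ?F = "{Y. Y \<subseteq> V \<and> real (card Y) \<le> c}"
  have fG: "finite (G - E1)" using simple_graph_finite[OF V(1,2)] by simp
  have QV: "Q \<subseteq> V" and fQ: "finite Q" using component_subset[OF Q(1)] V finite_subset by blast+
  have fA: "finite A'" using A' V finite_subset by blast
  have "measure_pmf.prob (percolation q (G - E1)) {F. real (L1 V (E1 \<union> F)) - real (L1 V E1) < c} \<le>
      measure_pmf.prob (percolation q (G - E1))
        {F. \<exists>Y\<in>?F. b * w \<le> real (card (epairs (G - E1) (A' - Y) Q)) \<and> epairs F (A' - Y) Q = {}}"
  proof (rule prob_mono_percolation[OF fG])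
    fix F assume F: "real (L1 V (E1 \<union> F)) - real (L1 V E1) < c"
    define Y where "Y = {a \<in> A'. nbrs F a \<inter> Q \<noteq> {}}"
    have "card Q + card Y \<le> L1 V (E1 \<union> F)"
      using A' by (intro L1_growth[OF V(1) Q(1)]) (auto simp: Y_def)
    then have Yc: "real (card Y) \<le> c" using F Q(2) by linarith
    have YA: "Y \<subseteq> A'" by (auto simp: Y_def)
    then have YV: "Y \<subseteq> V" using A' by auto
    have "b \<le> real (card (A' - Y))" using card_Diff_ge[of Y A'] finite_subset[OF YA fA] A'(2) Yc by linarith
    then have "b * w \<le> real (card (epairs (G - E1) (A' - Y) Q))"
      unfolding epairs_Sigma using fA fQ A'(3) w by (intro card_Sigma_ge) auto
    moreover have "epairs F (A' - Y) Q = {}" by (auto simp: epairs_def Y_def nbrs_def)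
    ultimately show "\<exists>Y\<in>?F. b * w \<le> real (card (epairs (G - E1) (A' - Y) Q)) \<and> epairs F (A' - Y) Q = {}"
      using YV Yc by blast
  qed
  also have "\<dots> \<le> s * exp (- q * (b * w))"
    using V A' by (intro prob_closed_cut_le[OF fG q _ s]) auto
  finally show ?thesis .
qed

section \<open>Typical configurations at the lower density\<close>

lemma exp_le_one_minus:
  fixes p \<epsilon> :: real
  assumes "0 \<le> p" "p \<le> 1 - \<epsilon>" "0 < \<epsilon>"
  shows "exp (- p / \<epsilon>) \<le> 1 - p"
proof -
  have pos: "0 < 1 - p" using assms by simp
  have "1 / (1 - p) = 1 + p / (1 - p)" using pos by (simp add: field_simps)
  also have "\<dots> \<le> exp (p / (1 - p))" by (rule exp_ge_add_one_self)
  also have "\<dots> \<le> exp (p / \<epsilon>)" using assms by (simp add: frac_le)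
  finally have "1 \<le> (1 - p) * exp (p / \<epsilon>)" using pos by (simp add: field_simps)
  then show ?thesis by (simp add: exp_minus field_simps)
qed

text \<open>
  One value of \<open>n\<close>. The parameter \<open>\<kappa>\<close> separates the scales \<open>d1\<close>, \<open>\<kappa> * d1\<close> and
  \<open>d = \<kappa> ^ 3 * d1\<close>; the switching estimates need that \<open>\<kappa> * d1\<close> is much larger than
  \<open>d1\<close> and that \<open>(\<kappa> * d1)\<^sup>2\<close> is much smaller than \<open>d * d1\<close>. The constants are chosen in the
  order \<open>\<kappa>1\<close>, \<open>\<eta>\<close>, \<open>\<eta>'\<close>, \<open>\<theta>\<close>, \<open>\<rho>\<close>, and \<open>\<kappa>\<close> is large in terms of all of them:

  \<^item> \<open>\<eta> * n * d1\<close> ordered edges inside \<open>L\<close>, and as many closed edges between \<open>L\<close> and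
    \<open>H - Q\<close>, are tolerated;
  \<^item> \<open>\<eta>' * n * d1\<close> edges between the small set \<open>H - Q\<close> and \<open>H \<inter> Q\<close> are tolerated;
  \<^item> \<open>\<kappa>1 * n\<close> open ordered edges from \<open>L\<close> to the outside of \<open>Q\<close> are tolerated;
  \<^item> \<open>\<rho> * n\<close> vertices of \<open>H\<close> may lie outside \<open>Q\<close>, where \<open>\<rho>\<close> is so small that the number of
    such sets is at most \<open>exp (\<theta> * n)\<close>.
\<close>
locale percolation_setting =
  fixes n :: nat and ds :: "nat \<Rightarrow> nat" and d1 d2 p \<kappa> \<epsilon> \<delta> \<delta>' \<eta> \<eta>' \<rho> \<kappa>1 \<theta> :: real
  assumes feas: "feasible n ds" and n: "0 < n"
    and eps: "0 < \<epsilon>" "\<epsilon> < 1"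
    and d1: "1 < d1" and d2: "0 < d2" "d1 \<le> 2 * d2" and p: "p = (1 - \<epsilon>) / d1"
    and A: "\<delta> * real n \<le> real (card (S n ds d2 - S n ds d1))" "0 < \<delta>"
    and top: "\<delta>' * real n \<le> real (card (S n ds (\<kappa> ^ 3 * d1)))" "0 < \<delta>'"
    and eta: "0 < \<eta>" "\<eta> \<le> exp (- 1 / \<epsilon>) * \<delta> / 32" "2 * \<eta> / \<epsilon> \<le> \<kappa>1 * ln (1 + \<epsilon>) / 8"
    and eta': "0 < \<eta>'" "\<eta>' \<le> \<eta> * \<delta>' / 8"
    and kappa1: "0 < \<kappa>1" "\<kappa>1 \<le> \<delta>' / 4"
    and theta: "\<theta> \<le> (1 - \<epsilon>) * \<eta>' / 2" "\<theta> \<le> \<kappa>1 * ln (1 + \<epsilon>) / 8"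
    and rho: "0 < \<rho>" "\<rho> \<le> \<delta>' / 4"
      "real (card {Y. Y \<subseteq> {1..n} \<and> real (card Y) \<le> \<rho> * real n}) \<le> exp (\<theta> * real n)"
    and kappa: "1 \<le> \<kappa>" "64 / (\<rho> * \<epsilon> * (1 - \<epsilon>)) \<le> \<kappa>" "\<kappa> + 1 \<le> \<epsilon> * \<kappa> ^ 3 / 8"
      "128 * \<eta>' \<le> \<delta>' * \<epsilon> * \<kappa> ^ 3" "8 \<le> \<delta>' * \<kappa>\<^sup>2"
begin

abbreviation "V \<equiv> {1..n}"
abbreviation "N \<equiv> real n"

definition "H = S n ds (\<kappa> * d1)"
definition "L = V - H"
definition "T = S n ds (\<kappa> ^ 3 * d1)"
definition "A = S n ds d2 - S n ds d1"

text \<open>Vertices of \<open>H\<close> with too few closed edges to take part in a switching. Since degrees are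
  prescribed, this depends on the open edges only and is thus fixed under the conditioning.\<close>
definition poor :: "nat set set \<Rightarrow> nat set" where
  "poor E1 = {v \<in> H. real (ds v) - real (card (nbrs E1 v)) < \<epsilon> / 4 * real (ds v)}"

definition splits :: "nat set set \<Rightarrow> nat set \<Rightarrow> bool" where
  "splits E1 Y \<longleftrightarrow> Y \<subseteq> V \<and> edge_closed E1 Y \<and> \<rho> * N \<le> real (card (Y \<inter> H)) \<and> \<rho> * N \<le> real (card (H - Y))"

text \<open>The switching estimates apply to one set determined by \<open>E1\<close>, so a set is selected among all
  candidates.\<close>
definition chosen_split :: "nat set set \<Rightarrow> nat set" where
  "chosen_split E1 = (SOME Y. splits E1 Y)"

definition dominates :: "nat set set \<Rightarrow> nat set \<Rightarrow> bool" where
  "dominates E1 Q \<longleftrightarrow> Q \<in> components V E1 \<and> real (card (H - Q)) < \<rho> * N"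

definition giant :: "nat set set \<Rightarrow> nat set" where
  "giant E1 = (SOME Q. dominates E1 Q)"

lemma chosen_split_splits: "splits E1 Y \<Longrightarrow> splits E1 (chosen_split E1)"
  unfolding chosen_split_def by (rule someI)

lemma giant_dominates: "dominates E1 Q \<Longrightarrow> dominates E1 (giant E1)"
  unfolding giant_def by (rule someI)

lemma p_bounds: "0 < p" "p \<le> 1" "p \<le> 1 - \<epsilon>" "p * d1 = 1 - \<epsilon>"
proof -
  show 1: "p * d1 = 1 - \<epsilon>" using p d1 by simp
  show 2: "0 < p" using p d1 eps by simp
  have "p * 1 \<le> p * d1" using 2 d1 by (intro mult_left_mono) auto
  then show "p \<le> 1 - \<epsilon>" using 1 by simp
  then show "p \<le> 1" using eps by simp
qed

lemma N_pos: "0 < N" "1 \<le> N" using n by auto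

lemma Nd1_ge_1: "1 \<le> N * d1"
  using mult_mono[of 1 N 1 d1] N_pos d1 by simp

lemma sets_V: "H \<subseteq> V" "L \<subseteq> V" "T \<subseteq> V" "A \<subseteq> V"
  by (auto simp: H_def L_def T_def A_def S_def)

lemma finite_sets [simp]: "finite H" "finite L" "finite T" "finite A"
  using sets_V finite_subset by blast+

lemma kappa_cube: "\<kappa> \<le> \<kappa> ^ 3"
  using kappa(1) power_increasing[of 1 3 \<kappa>] by simp

lemma T_subset_H: "T \<subseteq> H"
proof -
  have "\<kappa> * d1 \<le> \<kappa> ^ 3 * d1" using kappa_cube d1 by simp
  then show ?thesis by (auto simp: T_def H_def S_def)
qed

lemma H_degree: "v \<in> H \<Longrightarrow> \<kappa> * d1 \<le> real (ds v)"
  by (simp add: H_def S_def)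

lemma L_degree: "v \<in> L \<Longrightarrow> real (ds v) \<le> \<kappa> * d1"
  by (auto simp: L_def H_def S_def)

lemma A_degree: "v \<in> A \<Longrightarrow> d2 \<le> real (ds v)" "v \<in> A \<Longrightarrow> real (ds v) < d1"
  by (auto simp: A_def S_def)

lemma A_subset_L: "A \<subseteq> L"
proof -
  have "1 * d1 \<le> \<kappa> * d1" using kappa(1) d1 by (intro mult_right_mono) auto
  then show ?thesis by (auto simp: A_def L_def H_def S_def)
qed

lemma card_H: "\<delta>' * N \<le> real (card H)"
  using top(1) card_mono[OF _ T_subset_H] by (simp add: T_def[symmetric])

lemma realizationD:
  assumes "G \<in> graphs_with_degrees n ds"
  shows "simple_graph V G" "v \<in> V \<Longrightarrow> card (nbrs G v) = ds v" "finite (nbrs G v)"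
  using assms extensionsD[of G n ds "{}"] by (auto simp: extensions_def)

lemma T_degree_le_n: "\<kappa> ^ 3 * d1 \<le> N"
proof -
  have "0 < real (card T)" using top N_pos by (metis T_def less_le_trans mult_pos_pos)
  then obtain v where v: "v \<in> T" by (metis card_gt_0_iff ex_in_conv of_nat_0_less_iff)
  obtain G where G: "G \<in> graphs_with_degrees n ds" using feas by (auto simp: feasible_def)
  have "ds v \<le> n"
    using realizationD(2)[OF G, of v] v sets_V(3) card_mono[OF _ nbrs_subset[OF realizationD(1)[OF G]], of v] by auto
  then show ?thesis using v by (auto simp: T_def S_def)
qed

lemma prob_many_poor:
  "measure_pmf.prob (percolated_graph n ds p) {(G, E1). \<rho> * N / 4 \<le> real (card (poor E1))}
    \<le> 4 * exp (- \<epsilon> * \<kappa> / 4) / \<rho>"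
proof (rule prob_percolated_graph_le[OF feas])
  show "0 \<le> 4 * exp (- \<epsilon> * \<kappa> / 4) / \<rho>" using rho by simp
  fix G assume G: "G \<in> graphs_with_degrees n ds"
  have "measure_pmf.prob (percolation p G) {E1. real (ds v) - real (card (nbrs E1 v)) < \<epsilon> / 4 * real (ds v)}
      \<le> exp (- \<epsilon> * \<kappa> / 4)" if v: "v \<in> H" for v
  proof -
    have vV: "v \<in> V" using v sets_V by auto
    have "\<kappa> * 1 \<le> \<kappa> * d1" using kappa d1 by (intro mult_left_mono) auto
    then have "\<kappa> \<le> real (card (nbrs G v))" using H_degree[OF v] realizationD(2)[OF G vV] by simp
    then show ?thesis
      using prob_few_closed_nbrs[OF _ realizationD(1)[OF G], of p \<epsilon> \<kappa> v] p_bounds eps realizationD(2)[OF G vV] by simp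
  qed
  then have "measure_pmf.prob (percolation p G) {E1. \<rho> * N / 4 \<le> real (card (poor E1))} \<le>
      real (card H) * exp (- \<epsilon> * \<kappa> / 4) / (\<rho> * N / 4)"
    unfolding poor_def using rho N_pos by (intro prob_count_le) auto
  also have "\<dots> \<le> N * exp (- \<epsilon> * \<kappa> / 4) / (\<rho> * N / 4)"
    using card_mono[OF _ sets_V(1)] rho N_pos by (intro divide_right_mono mult_right_mono) auto
  also have "\<dots> = 4 * exp (- \<epsilon> * \<kappa> / 4) / \<rho>" using N_pos by simp
  finally show "measure_pmf.prob (percolation p G) {E1. \<rho> * N / 4 \<le> real (card (poor E1))} \<le>
      4 * exp (- \<epsilon> * \<kappa> / 4) / \<rho>" .
qed

text \<open>The cut size \<open>n * d1 / (1 - \<epsilon>) = n / p\<close> is chosen such that \<open>exp (- n)\<close> beats the number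
  \<open>2 ^ n\<close> of cuts.\<close>
lemma prob_large_closed_cut:
  "measure_pmf.prob (percolated_graph n ds p)
    {(G, E1). \<exists>Y\<in>Pow V. N * d1 / (1 - \<epsilon>) \<le> real (card (epairs G Y (V - Y))) \<and> epairs E1 Y (V - Y) = {}}
    \<le> (2 / exp 1) ^ n"
proof (rule prob_percolated_graph_le[OF feas])
  fix G assume G: "G \<in> graphs_with_degrees n ds"
  have "measure_pmf.prob (percolation p G)
      {E1. \<exists>Y\<in>Pow V. N * d1 / (1 - \<epsilon>) \<le> real (card (epairs G Y (V - Y))) \<and> epairs E1 Y (V - Y) = {}}
      \<le> 2 ^ n * exp (- p * (N * d1 / (1 - \<epsilon>)))"
    using p_bounds by (intro prob_closed_cut_le graphs_with_degrees_finite_edges[OF G]) (auto simp: card_Pow)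
  also have "- p * (N * d1 / (1 - \<epsilon>)) = - ((p * d1) * N / (1 - \<epsilon>))" by simp
  also have "(p * d1) * N / (1 - \<epsilon>) = N" unfolding p_bounds(4) using eps by simp
  also have "2 ^ n * exp (- N) = (2 / exp 1) ^ n"
    by (simp add: power_divide exp_of_nat_mult[symmetric] exp_minus field_simps)
  finally show "measure_pmf.prob (percolation p G)
      {E1. \<exists>Y\<in>Pow V. N * d1 / (1 - \<epsilon>) \<le> real (card (epairs G Y (V - Y))) \<and> epairs E1 Y (V - Y) = {}}
      \<le> (2 / exp 1) ^ n" .
qed simp

lemma prob_closed_cut_small_side:
  "measure_pmf.prob (percolated_graph n ds p)
    {(G, E1). \<exists>Y\<in>{Y. Y \<subseteq> V \<and> real (card Y) \<le> \<rho> * N}.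
       \<eta>' * N * d1 \<le> real (card (epairs G Y (H - Y))) \<and> epairs E1 Y (H - Y) = {}}
    \<le> exp (- ((1 - \<epsilon>) * \<eta>' / 2) * N)"
proof (rule prob_percolated_graph_le[OF feas])
  let ?F = "{Y. Y \<subseteq> V \<and> real (card Y) \<le> \<rho> * N}"
  fix G assume G: "G \<in> graphs_with_degrees n ds"
  have "measure_pmf.prob (percolation p G)
      {E1. \<exists>Y\<in>?F. \<eta>' * N * d1 \<le> real (card (epairs G Y (H - Y))) \<and> epairs E1 Y (H - Y) = {}}
      \<le> exp (\<theta> * N) * exp (- p * (\<eta>' * N * d1))"
    using p_bounds rho by (intro prob_closed_cut_le graphs_with_degrees_finite_edges[OF G]) auto
  also have "\<dots> = exp (\<theta> * N - p * (\<eta>' * N * d1))" by (simp add: exp_add[symmetric])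
  also have "p * (\<eta>' * N * d1) = (1 - \<epsilon>) * \<eta>' * N" using p_bounds(4) by (metis mult.commute mult.assoc)
  also have "exp (\<theta> * N - (1 - \<epsilon>) * \<eta>' * N) \<le> exp (- ((1 - \<epsilon>) * \<eta>' / 2) * N)"
  proof -
    have "(1 - \<epsilon>) * \<eta>' / 2 * N = (1 - \<epsilon>) * \<eta>' * N / 2" by simp
    moreover have "\<theta> * N \<le> (1 - \<epsilon>) * \<eta>' / 2 * N" using theta(1) by (intro mult_right_mono) auto
    ultimately show ?thesis by simp
  qed
  finally show "measure_pmf.prob (percolation p G)
      {E1. \<exists>Y\<in>?F. \<eta>' * N * d1 \<le> real (card (epairs G Y (H - Y))) \<and> epairs E1 Y (H - Y) = {}}
      \<le> exp (- ((1 - \<epsilon>) * \<eta>' / 2) * N)" .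
qed simp

lemma prob_many_open_at_low:
  "measure_pmf.prob (percolated_graph n ds p)
    {(G, E1). \<exists>Y\<in>{Y. Y \<subseteq> V \<and> real (card Y) \<le> \<rho> * N}.
       2 * (\<kappa>1 * N / 2) \<le> real (card (epairs E1 L (L \<union> Y))) \<and> real (card (epairs (G - E1) L (L \<union> Y))) \<le> 2 * \<eta> * N * d1}
    \<le> exp (- (\<kappa>1 * ln (1 + \<epsilon>) / 4) * N)"
proof (rule prob_percolated_graph_le[OF feas])
  let ?F = "{Y. Y \<subseteq> V \<and> real (card Y) \<le> \<rho> * N}"
  fix G assume G: "G \<in> graphs_with_degrees n ds"
  let ?b = "2 * \<eta> * N * d1" and ?a = "\<kappa>1 * N / 2"
  have "measure_pmf.prob (percolation p G)
      {E1. \<exists>Y\<in>?F. 2 * ?a \<le> real (card (epairs E1 L (L \<union> Y))) \<and> real (card (epairs (G - E1) L (L \<union> Y))) \<le> ?b}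
      \<le> exp (\<theta> * N) * (1 / ((1 + \<epsilon>) powr ?a * (1 - p) powr ?b))"
    using p_bounds rho eps by (intro prob_many_open_few_closed[OF _ realizationD(1)[OF G]]) (auto intro: finite_subset)
  also have "\<dots> \<le> exp (\<theta> * N) * (1 / (exp (ln (1 + \<epsilon>) * ?a) * exp (- (2 * \<eta> / \<epsilon>) * N)))"
  proof -
    have "exp (- (2 * \<eta> / \<epsilon>) * N) \<le> exp (- p / \<epsilon>) powr ?b"
    proof -
      have "p * ?b = (1 - \<epsilon>) * (2 * \<eta> * N)" using p_bounds(4) by (metis mult.commute mult.assoc)
      also have "\<dots> \<le> 1 * (2 * \<eta> * N)" using eps eta N_pos by (intro mult_right_mono) auto
      finally have "p * ?b / \<epsilon> \<le> 2 * \<eta> * N / \<epsilon>" using eps by (intro divide_right_mono) auto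
      then show ?thesis by (simp add: powr_def mult_ac)
    qed
    also have "\<dots> \<le> (1 - p) powr ?b"
      using exp_le_one_minus[of p \<epsilon>] p_bounds eps eta N_pos d1 by (intro powr_mono2) auto
    finally have 1: "exp (- (2 * \<eta> / \<epsilon>) * N) \<le> (1 - p) powr ?b" .
    have 2: "(1 + \<epsilon>) powr ?a = exp (ln (1 + \<epsilon>) * ?a)" using eps by (simp add: powr_def mult.commute)
    have "exp (ln (1 + \<epsilon>) * ?a) * exp (- (2 * \<eta> / \<epsilon>) * N) \<le> (1 + \<epsilon>) powr ?a * (1 - p) powr ?b"
      unfolding 2 using 1 by (rule mult_left_mono) simp
    moreover have "0 < (1 + \<epsilon>) powr ?a * (1 - p) powr ?b" using p_bounds eps by simp
    ultimately show ?thesis by (intro mult_left_mono divide_left_mono mult_pos_pos[of "_ * _"]) auto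
  qed
  also have "\<dots> = exp (\<theta> * N - ln (1 + \<epsilon>) * ?a + (2 * \<eta> / \<epsilon>) * N)"
  proof -
    have "1 / (exp x * exp y) = exp (- (x + y))" for x y :: real by (metis exp_add exp_minus inverse_eq_divide)
    then show ?thesis by (simp add: exp_add[symmetric] exp_diff[symmetric] diff_diff_eq2 add_diff_eq diff_add_eq)
  qed
  also have "\<dots> \<le> exp (- (\<kappa>1 * ln (1 + \<epsilon>) / 4) * N)"
  proof -
    define X where "X = \<kappa>1 * ln (1 + \<epsilon>) * N"
    have "\<theta> * N \<le> \<kappa>1 * ln (1 + \<epsilon>) / 8 * N" "2 * \<eta> / \<epsilon> * N \<le> \<kappa>1 * ln (1 + \<epsilon>) / 8 * N"
      using theta(2) eta(3) by (intro mult_right_mono; simp)+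
    then have ab: "\<theta> * N \<le> X / 8" "2 * \<eta> / \<epsilon> * N \<le> X / 8" by (simp_all add: X_def)
    have c: "ln (1 + \<epsilon>) * ?a = X / 2" "- (\<kappa>1 * ln (1 + \<epsilon>) / 4) * N = - (X / 4)" by (simp_all add: X_def)
    show ?thesis unfolding c exp_le_cancel_iff using ab by linarith
  qed
  finally show "measure_pmf.prob (percolation p G)
      {E1. \<exists>Y\<in>?F. 2 * ?a \<le> real (card (epairs E1 L (L \<union> Y))) \<and> real (card (epairs (G - E1) L (L \<union> Y))) \<le> ?b}
      \<le> exp (- (\<kappa>1 * ln (1 + \<epsilon>) / 4) * N)" .
qed simp

text \<open>Each vertex of \<open>A\<close> is isolated with probability at least \<open>exp (- 1 / \<epsilon>)\<close> because
  \<open>p * d1 \<le> 1\<close> and \<open>1 - p \<ge> \<epsilon>\<close>; and \<open>d1 / n \<le> 1 / \<kappa> ^ 3\<close> makes the variance negligible.\<close>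
lemma prob_isolated_rare:
  "measure_pmf.prob (percolated_graph n ds p)
    {(G, E1). real (card {v \<in> A. nbrs E1 v = {}}) < exp (- 1 / \<epsilon>) * \<delta> * N / 2}
    \<le> 8 / ((exp (- 1 / \<epsilon>) * \<delta>)\<^sup>2 * \<kappa> ^ 3)"
proof (rule prob_percolated_graph_le[OF feas])
  let ?\<mu> = "exp (- 1 / \<epsilon>) * \<delta> * N"
  have kc: "0 < \<kappa> ^ 3" using kappa(1) by simp
  then show "0 \<le> 8 / ((exp (- 1 / \<epsilon>) * \<delta>)\<^sup>2 * \<kappa> ^ 3)" by simp
  fix G assume G: "G \<in> graphs_with_degrees n ds"
  have deg: "card (nbrs G v) = ds v" if "v \<in> A" for v using realizationD(2)[OF G] that sets_V by auto
  have "exp (- 1 / \<epsilon>) \<le> (1 - p) ^ card (nbrs G v)" if v: "v \<in> A" for v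
  proof -
    have "p * real (ds v) \<le> p * d1" using p_bounds A_degree(2)[OF v] by (intro mult_left_mono) auto
    then have "p * real (ds v) \<le> 1" using p_bounds(4) eps by simp
    then have "exp (- 1 / \<epsilon>) \<le> exp (- (p * real (ds v)) / \<epsilon>)" using eps by (simp add: divide_right_mono)
    also have "\<dots> = exp (- p / \<epsilon>) ^ ds v" by (simp add: exp_of_nat_mult[symmetric] mult_ac)
    also have "\<dots> \<le> (1 - p) ^ ds v" using exp_le_one_minus[of p \<epsilon>] p_bounds eps by (intro power_mono) auto
    finally show ?thesis by (simp add: deg[OF v])
  qed
  then have "real (card A) * exp (- 1 / \<epsilon>) \<le> (\<Sum>v\<in>A. (1 - p) ^ card (nbrs G v))"
    by (rule sum_bounded_below)
  moreover have "?\<mu> \<le> real (card A) * exp (- 1 / \<epsilon>)"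
    using mult_right_mono[OF A(1), of "exp (- 1 / \<epsilon>)"] by (simp add: A_def mult_ac)
  ultimately have \<mu>: "?\<mu> \<le> (\<Sum>v\<in>A. (1 - p) ^ card (nbrs G v))" by linarith
  have "measure_pmf.prob (percolation p G) {E1. real (card {v \<in> A. nbrs E1 v = {}}) < ?\<mu> / 2}
      \<le> 4 * real (card A) * (1 + d1) / ?\<mu>\<^sup>2"
  proof (rule prob_few_isolated[OF _ realizationD(1)[OF G] sets_V(4) _ _ _ _ \<mu>])
    show "real (card (nbrs G v)) \<le> d1" if "v \<in> A" for v using A_degree(2)[OF that] deg[OF that] by simp
  qed (use p_bounds A N_pos in auto)
  also have "\<dots> \<le> 4 * N * (2 * d1) / ?\<mu>\<^sup>2"
    using card_mono[OF _ sets_V(4)] d1 by (intro divide_right_mono mult_mono) auto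
  also have "\<dots> = 8 * d1 / ((exp (- 1 / \<epsilon>) * \<delta>)\<^sup>2 * N)" using N_pos by (simp add: power2_eq_square)
  also have "\<dots> \<le> 8 * d1 / ((exp (- 1 / \<epsilon>) * \<delta>)\<^sup>2 * (\<kappa> ^ 3 * d1))"
    using T_degree_le_n d1 A N_pos kc by (intro divide_left_mono mult_left_mono mult_pos_pos) auto
  also have "\<dots> = 8 / ((exp (- 1 / \<epsilon>) * \<delta>)\<^sup>2 * \<kappa> ^ 3)" using d1 by simp
  finally show "measure_pmf.prob (percolation p G) {E1. real (card {v \<in> A. nbrs E1 v = {}}) < ?\<mu> / 2}
      \<le> 8 / ((exp (- 1 / \<epsilon>) * \<delta>)\<^sup>2 * \<kappa> ^ 3)" .
qed

end

section \<open>Atypical closed edges given the open edges\<close>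

lemma ratio_bound:
  fixes a c f b r :: real
  assumes "a * f \<le> c * b" "b \<le> r * f" "0 < f" "0 \<le> c"
  shows "a \<le> r * c"
proof -
  have "a * f \<le> c * (r * f)" using assms mult_left_mono[OF assms(2,4)] by linarith
  then have "a * f \<le> (r * c) * f" by (simp add: mult_ac)
  then show ?thesis using assms(3) by simp
qed

lemma card_Collect_conj_le:
  assumes "C \<Longrightarrow> real (card {x \<in> A. P x}) \<le> r" "0 \<le> r"
  shows "real (card {x \<in> A. C \<and> P x}) \<le> r"
  using assms by (cases C) simp_all

lemma set_percolated_graph:
  assumes "feasible n ds" "(G, E1) \<in> set_pmf (percolated_graph n ds p)"
  shows "G \<in> graphs_with_degrees n ds" "E1 \<subseteq> G"
proof -
  have "G \<in> graphs_with_degrees n ds \<and> E1 \<in> set_pmf (percolation p G)"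
    using assms by (auto simp: percolated_graph_def set_random_graph)
  then show "G \<in> graphs_with_degrees n ds" "E1 \<subseteq> G"
    using set_percolation[OF graphs_with_degrees_finite_edges] by blast+
qed

context percolation_setting
begin

lemma rich_degree:
  assumes "v \<in> H" "v \<notin> poor E1" "t \<le> real (ds v)"
  shows "4 * (\<epsilon> * t / 16) \<le> real (ds v) - real (card (nbrs E1 v))"
proof -
  have "\<epsilon> / 4 * t \<le> \<epsilon> / 4 * real (ds v)" using assms(3) eps by (intro mult_left_mono) auto
  then show ?thesis using assms by (auto simp: poor_def)
qed

lemma finite_poor [simp]: "finite (poor E1)"
  by (simp add: poor_def)

text \<open>The switching estimate with \<open>k = \<epsilon> * \<kappa> * d1 / 16\<close> and \<open>s = \<rho> * n / 4\<close>: a factor \<open>\<kappa>\<close> is gained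
  for each of the two new edges.\<close>
lemma prob_sparse_split:
  "measure_pmf.prob (percolated_graph n ds p)
    {(G, E1). (real (card (poor E1)) < \<rho> * N / 4 \<and> (\<exists>Y. splits E1 Y)) \<and>
       real (card (epairs G (chosen_split E1) (V - chosen_split E1))) \<le> N * d1 / (1 - \<epsilon>)}
    \<le> (32 * (1 / (1 - \<epsilon>) + 2) / (\<rho> * \<epsilon> * \<kappa>))\<^sup>2"
proof (rule prob_by_conditioning_on_open_edges[OF feas])
  fix E1
  let ?r = "(32 * (1 / (1 - \<epsilon>) + 2) / (\<rho> * \<epsilon> * \<kappa>))\<^sup>2"
  let ?m = "N * d1 / (1 - \<epsilon>)" and ?s = "\<rho> * N / 4" and ?k = "\<epsilon> * (\<kappa> * d1) / 16"
  let ?B = "{G \<in> extensions n ds E1. (real (card (poor E1)) < \<rho> * N / 4 \<and> (\<exists>Y. splits E1 Y)) \<and>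
       real (card (epairs G (chosen_split E1) (V - chosen_split E1))) \<le> ?m}"
  show "real (card ?B) \<le> ?r * real (card (extensions n ds E1))"
  proof (cases "real (card (poor E1)) < \<rho> * N / 4 \<and> (\<exists>Y. splits E1 Y)")
    case True
    let ?Y = "chosen_split E1"
    have sp: "splits E1 ?Y" using True chosen_split_splits by blast
    have few: "2 * ?s \<le> real (card (Z - poor E1))" if "\<rho> * N \<le> real (card Z)" for Z
      using card_Diff_ge[of "poor E1" Z] True that by simp
    have rich: "4 * ?k \<le> real (ds v) - real (card (nbrs E1 v))" if "v \<in> H" "v \<notin> poor E1" for v
      by (rule rich_degree[OF that H_degree[OF that(1)]])
    have pos: "0 < ?k" "0 < ?s" using eps kappa(1) d1 rho N_pos by auto
    have mk: "?m \<le> ?s * ?k"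
    proof -
      have "0 < \<rho> * \<epsilon> * (1 - \<epsilon>)" using rho eps by simp
      then have "64 \<le> \<kappa> * (\<rho> * \<epsilon> * (1 - \<epsilon>))" using kappa(2) by (simp add: pos_divide_le_eq)
      then have "N * d1 * 64 \<le> N * d1 * (\<kappa> * (\<rho> * \<epsilon> * (1 - \<epsilon>)))" using d1 N_pos by (intro mult_left_mono) auto
      then have "N * d1 \<le> ?s * ?k * (1 - \<epsilon>)" by (simp add: mult_ac)
      then show ?thesis using eps by (simp add: pos_divide_le_eq)
    qed
    have "real (card {G \<in> extensions n ds E1. real (card (epairs G ?Y (V - ?Y))) \<le> ?m}) * ((?s * ?s) * (2 * ?k * (2 * ?k)))
        \<le> real (card (extensions n ds E1)) * ((?m + 2) * (?m + 2))"
    proof (rule few_graphs_with_sparse_cut[where X' = "?Y \<inter> H - poor E1" and Y' = "H - ?Y - poor E1"])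
      show "2 * ?s \<le> real (card (?Y \<inter> H - poor E1))" "2 * ?s \<le> real (card (H - ?Y - poor E1))"
        by (rule few; use sp in \<open>simp add: splits_def\<close>)+
      show "?Y \<subseteq> V" "?Y \<union> (V - ?Y) = V" using sp by (auto simp: splits_def)
      show "H - ?Y - poor E1 \<subseteq> V - ?Y" using sets_V by auto
      show "0 \<le> ?m" using d1 eps by simp
    qed (use rich pos mk in auto)
    moreover have "(?m + 2) * (?m + 2) \<le> ?r * ((?s * ?s) * (2 * ?k * (2 * ?k)))"
    proof -
      have "?m + 2 \<le> (1 / (1 - \<epsilon>) + 2) * (N * d1)" using Nd1_ge_1 by (simp add: algebra_simps)
      also have "\<dots> = 32 * (1 / (1 - \<epsilon>) + 2) / (\<rho> * \<epsilon> * \<kappa>) * (?s * (2 * ?k))"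
        using rho eps kappa(1) by simp
      finally have le: "?m + 2 \<le> 32 * (1 / (1 - \<epsilon>) + 2) / (\<rho> * \<epsilon> * \<kappa>) * (?s * (2 * ?k))" .
      have "0 \<le> ?m + 2" using d1 eps by simp
      then have "(?m + 2) * (?m + 2) \<le> (32 * (1 / (1 - \<epsilon>) + 2) / (\<rho> * \<epsilon> * \<kappa>) * (?s * (2 * ?k))) *
          (32 * (1 / (1 - \<epsilon>) + 2) / (\<rho> * \<epsilon> * \<kappa>) * (?s * (2 * ?k)))"
        using le by (intro mult_mono) auto
      then show ?thesis by (simp only: power2_eq_square mult_ac)
    qed
    moreover have "0 < (?s * ?s) * (2 * ?k * (2 * ?k))" using pos by simp
    ultimately have "real (card {G \<in> extensions n ds E1. real (card (epairs G ?Y (V - ?Y))) \<le> ?m})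
        \<le> ?r * real (card (extensions n ds E1))"
      by (rule ratio_bound) simp
    then show ?thesis using True by simp
  next
    case False
    then have "?B = {}" by blast
    then show ?thesis by (simp only: card.empty) simp
  qed
qed (use p_bounds in auto)

text \<open>The switching estimate with \<open>k = \<epsilon> * \<kappa> ^ 3 * d1 / 16\<close>, \<open>s = \<delta>' * n / 8\<close> and
  \<open>t = \<kappa> * d1\<close>: vertices of degree at least \<open>\<kappa> ^ 3 * d1\<close> are compared with vertices of degree at
  most \<open>\<kappa> * d1\<close>.\<close>
lemma prob_low_vertices_avoid_giant:
  "measure_pmf.prob (percolated_graph n ds p)
    {(G, E1). (real (card (poor E1)) < \<rho> * N / 4 \<and> (\<exists>Q. dominates E1 Q)) \<and>
       real (card (epairs G (H - (H - giant E1)) (H - giant E1))) \<le> \<eta>' * N * d1 \<and>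
       \<eta> * N * d1 \<le> real (card (epairs (G - E1) (V - H) (H - giant E1)))}
    \<le> 256 * (\<eta>' + 1) / (\<eta> * \<delta>' * \<epsilon> * \<kappa>\<^sup>2)"
proof (rule prob_by_conditioning_on_open_edges[OF feas])
  fix E1
  let ?r = "256 * (\<eta>' + 1) / (\<eta> * \<delta>' * \<epsilon> * \<kappa>\<^sup>2)"
  let ?m = "\<eta>' * N * d1" and ?x = "\<eta> * N * d1" and ?s = "\<delta>' * N / 8" and ?k = "\<epsilon> * (\<kappa> ^ 3 * d1) / 16"
  let ?Y = "H - giant E1"
  let ?C = "real (card (poor E1)) < \<rho> * N / 4 \<and> (\<exists>Q. dominates E1 Q)"
  let ?B = "{G \<in> extensions n ds E1. real (card (epairs G (H - ?Y) ?Y)) \<le> ?m \<and>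
       ?x \<le> real (card (epairs (G - E1) (V - H) ?Y))}"
  have "real (card ?B) \<le> ?r * real (card (extensions n ds E1))" if C: ?C
  proof -
    have dom: "real (card ?Y) < \<rho> * N" using C giant_dominates unfolding dominates_def by blast
    let ?S' = "T - ?Y - poor E1"
    have pos: "0 < ?k" "0 < ?s" using eps kappa(1) d1 top N_pos by auto
    have cS: "4 * ?s \<le> real (card ?S')"
    proof -
      have "\<delta>' * N \<le> real (card T)" using top by (simp add: T_def)
      moreover have "\<rho> * N \<le> \<delta>' / 4 * N" using rho by (intro mult_right_mono) auto
      moreover have "\<delta>' / 4 * N = \<delta>' * N / 4" "4 * ?s = \<delta>' * N / 2" by simp_all
      moreover have "real (card T) - real (card ?Y) \<le> real (card (T - ?Y))" by (rule card_Diff_ge) simp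
      moreover have "real (card (T - ?Y)) - real (card (poor E1)) \<le> real (card ?S')" by (rule card_Diff_ge) simp
      ultimately show ?thesis using C dom by linarith
    qed
    have ks: "\<kappa> * d1 + 1 \<le> 2 * ?k"
    proof -
      have "(\<kappa> + 1) * d1 \<le> \<epsilon> * \<kappa> ^ 3 / 8 * d1" using kappa(3) d1 by (intro mult_right_mono) auto
      then show ?thesis using d1 by (simp add: algebra_simps)
    qed
    have mk: "?m \<le> ?s * ?k"
    proof -
      have "128 * \<eta>' * (N * d1) \<le> \<delta>' * \<epsilon> * \<kappa> ^ 3 * (N * d1)" using kappa(4) d1 by (intro mult_right_mono) auto
      then show ?thesis by (simp add: mult_ac)
    qed
    have mx: "N * ?m \<le> ?x * ?s"
    proof -
      have "\<eta>' * (N * N * d1) \<le> \<eta> * \<delta>' / 8 * (N * N * d1)" using eta'(2) d1 by (intro mult_right_mono) auto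
      then show ?thesis by (simp add: mult_ac)
    qed
    have "real (card ?B) * (?x / 2 * (?s * ?k)) \<le> real (card (extensions n ds E1)) * (N * (\<kappa> * d1) * (?m + 1))"
    proof (rule few_graphs_with_low_vertices_attached[where S' = ?S'])
      show "real (ds v) \<le> \<kappa> * d1" if "v \<in> V - H" for v using L_degree that by (simp add: L_def)
      show "?S' \<subseteq> H - ?Y" using T_subset_H by auto
      show "4 * ?k \<le> real (ds v) - real (card (nbrs E1 v))" if "v \<in> ?S'" for v
        using that T_subset_H by (intro rich_degree) (auto simp: T_def S_def)
      show "0 \<le> ?m" "0 \<le> ?x" "0 \<le> \<kappa> * d1" using eta eta' d1 kappa(1) by simp_all
    qed (use sets_V cS ks mk mx pos in auto)
    moreover have "N * (\<kappa> * d1) * (?m + 1) \<le> ?r * (?x / 2 * (?s * ?k))"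
    proof -
      have "?m + 1 \<le> (\<eta>' + 1) * (N * d1)" using Nd1_ge_1 by (simp add: algebra_simps)
      then have "N * (\<kappa> * d1) * (?m + 1) \<le> N * (\<kappa> * d1) * ((\<eta>' + 1) * (N * d1))"
        using kappa(1) d1 by (intro mult_left_mono) auto
      also have "\<dots> = ?r * (?x / 2 * (?s * ?k))"
        using eta top eps kappa(1) by (simp add: power2_eq_square power3_eq_cube)
      finally show ?thesis .
    qed
    moreover have "0 < ?x / 2 * (?s * ?k)" using pos eta d1 N_pos by simp
    ultimately show ?thesis by (rule ratio_bound) simp
  qed
  moreover have "0 \<le> ?r" using eta eta' top eps by simp
  moreover have "0 \<le> ?r * real (card (extensions n ds E1))"
    using \<open>0 \<le> ?r\<close> by (intro mult_nonneg_nonneg) auto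
  ultimately show "real (card {G \<in> extensions n ds E1. ?C \<and> real (card (epairs G (H - ?Y) ?Y)) \<le> ?m \<and>
       ?x \<le> real (card (epairs (G - E1) (V - H) ?Y))}) \<le> ?r * real (card (extensions n ds E1))"
    by (intro card_Collect_conj_le)
qed (use p_bounds in auto)

lemma prob_many_low_low_edges:
  "measure_pmf.prob (percolated_graph n ds p) {(G, E1). \<eta> * N * d1 \<le> real (card (epairs G L L))}
    \<le> 2 / (\<eta> * \<delta>' * \<kappa>)"
proof -
  let ?W = "\<delta>' * N * (\<kappa> ^ 3 * d1)" and ?x = "\<eta> * N * d1" and ?r = "2 / (\<eta> * \<delta>' * \<kappa>)"
  let ?B = "{G \<in> extensions n ds {}. ?x \<le> real (card (epairs G L L))}"
  have kc: "0 < \<kappa> ^ 3" using kappa(1) by simp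
  have W: "?W \<le> (\<Sum>v\<in>V. real (ds v))"
  proof -
    have "?W \<le> real (card T) * (\<kappa> ^ 3 * d1)"
      using top kc d1 by (intro mult_right_mono) (auto simp: T_def)
    also have "\<dots> \<le> (\<Sum>v\<in>T. real (ds v))" by (rule sum_bounded_below) (auto simp: T_def S_def)
    also have "\<dots> \<le> (\<Sum>v\<in>V. real (ds v))" using sets_V by (intro sum_mono2) auto
    finally show ?thesis .
  qed
  have W2: "4 * (\<kappa> * d1 + 1) * N \<le> ?W"
  proof -
    have "1 \<le> \<kappa> * d1" using mult_mono[of 1 \<kappa> 1 d1] kappa(1) d1 by simp
    then have "4 * (\<kappa> * d1 + 1) \<le> 8 * (\<kappa> * d1)" by simp
    also have "\<dots> \<le> \<delta>' * \<kappa>\<^sup>2 * (\<kappa> * d1)" using kappa(1,5) d1 by (intro mult_right_mono) auto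
    also have "\<dots> = \<delta>' * (\<kappa> ^ 3 * d1)" by (simp add: power2_eq_square power3_eq_cube)
    finally have "4 * (\<kappa> * d1 + 1) * N \<le> \<delta>' * (\<kappa> ^ 3 * d1) * N" by (rule mult_right_mono) simp
    then show ?thesis by (simp add: mult_ac)
  qed
  have "real (card ?B) * (?x * (?W / 2)) \<le> real (card (extensions n ds {})) * ((N * (\<kappa> * d1)) * (N * (\<kappa> * d1)))"
    by (rule few_graphs_with_many_low_low_edges[OF L_degree sets_V(2) _ W W2])
      (use kappa(1) d1 eta in auto)
  moreover have "(N * (\<kappa> * d1)) * (N * (\<kappa> * d1)) \<le> ?r * (?x * (?W / 2))"
    using eta top kappa(1) by (simp add: power3_eq_cube)
  moreover have "0 < ?x * (?W / 2)" using eta top kc d1 N_pos by simp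
  ultimately have B: "real (card ?B) \<le> ?r * real (card (extensions n ds {}))"
    by (rule ratio_bound) simp
  have ext: "extensions n ds {} = graphs_with_degrees n ds" by (auto simp: extensions_def)
  have ne: "graphs_with_degrees n ds \<noteq> {}" using feas by (simp add: feasible_def)
  have "map_pmf fst (percolated_graph n ds p) = random_graph n ds"
    by (simp add: percolated_graph_def map_bind_pmf pmf.map_comp o_def map_pmf_const bind_return_pmf')
  moreover have "measure_pmf.prob (map_pmf fst (percolated_graph n ds p)) {G. ?x \<le> real (card (epairs G L L))} =
      measure_pmf.prob (percolated_graph n ds p) {(G, E1). ?x \<le> real (card (epairs G L L))}"
    by (simp add: measure_map_pmf vimage_def case_prod_unfold)
  ultimately have "measure_pmf.prob (percolated_graph n ds p) {(G, E1). ?x \<le> real (card (epairs G L L))} =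
      measure_pmf.prob (random_graph n ds) {G. ?x \<le> real (card (epairs G L L))}"
    by simp
  also have "\<dots> = real (card ?B) / real (card (graphs_with_degrees n ds))"
  proof -
    have "graphs_with_degrees n ds \<inter> {G. ?x \<le> real (card (epairs G L L))} = ?B" unfolding ext by blast
    then show ?thesis unfolding random_graph_def measure_pmf_of_set[OF ne finite_graphs_with_degrees] by simp
  qed
  also have "\<dots> \<le> ?r"
  proof -
    have "0 < card (graphs_with_degrees n ds)" using ne finite_graphs_with_degrees by (simp add: card_gt_0_iff)
    then show ?thesis using B unfolding ext by (subst pos_divide_le_eq) auto
  qed
  finally show ?thesis .
qed

end

section \<open>Growth of the largest component for one degree sequence\<close>

text \<open>The sum of the bounds on the eight atypical events; the terms involving \<open>\<kappa>\<close> vanish as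
  \<open>\<kappa> \<rightarrow> \<infinity>\<close>, the others as \<open>n \<rightarrow> \<infinity>\<close>.\<close>
definition failure_bound ::
    "real \<Rightarrow> real \<Rightarrow> real \<Rightarrow> real \<Rightarrow> real \<Rightarrow> real \<Rightarrow> real \<Rightarrow> real \<Rightarrow> nat \<Rightarrow> real" where
  "failure_bound \<epsilon> \<delta> \<delta>' \<eta> \<eta>' \<rho> \<kappa>1 \<kappa> n =
    4 * exp (- \<epsilon> * \<kappa> / 4) / \<rho> + ((2 / exp 1) ^ n + (exp (- ((1 - \<epsilon>) * \<eta>' / 2) * real n) +
    (exp (- (\<kappa>1 * ln (1 + \<epsilon>) / 4) * real n) + (8 / ((exp (- 1 / \<epsilon>) * \<delta>)\<^sup>2 * \<kappa> ^ 3) +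
    ((32 * (1 / (1 - \<epsilon>) + 2) / (\<rho> * \<epsilon> * \<kappa>))\<^sup>2 + (256 * (\<eta>' + 1) / (\<eta> * \<delta>' * \<epsilon> * \<kappa>\<^sup>2) +
    2 / (\<eta> * \<delta>' * \<kappa>)))))))"

lemma prob_disj_le:
  assumes "measure_pmf.prob M {(x, y). P x y} \<le> a" "measure_pmf.prob M {(x, y). Q x y} \<le> b"
  shows "measure_pmf.prob M {(x, y). P x y \<or> Q x y} \<le> a + b"
proof -
  have "{(x, y). P x y \<or> Q x y} = {(x, y). P x y} \<union> {(x, y). Q x y}" by auto
  then show ?thesis
    using measure_Un_le[of "{(x, y). P x y}" "measure_pmf M" "{(x, y). Q x y}"] assms by simp
qed

context percolation_setting
begin

text \<open>A largest component \<open>Q\<close> and linearly many vertices outside it that the second round may attach.\<close>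
definition ready :: "nat set set \<Rightarrow> nat set set \<Rightarrow> bool" where
  "ready G E1 \<longleftrightarrow> (\<exists>Q A'. Q \<in> components V E1 \<and> L1 V E1 \<le> card Q \<and> A' \<subseteq> V - Q \<and>
     exp (- 1 / \<epsilon>) * \<delta> * N / 4 \<le> real (card A') \<and> (\<forall>a\<in>A'. d2 / 2 \<le> real (card (nbrs (G - E1) a \<inter> Q))))"

text \<open>A split would have a large closed cut or be atypically sparse; so there is none, and a component \<open>Q\<close>
  dominates \<open>H\<close>. All closed edges from \<open>L\<close> to the outside of \<open>Q\<close> end in \<open>L\<close> or in \<open>Y = H - Q\<close>, and
  there are fewer than \<open>2 * \<eta> * n * d1\<close> of them. Hence fewer than \<open>\<kappa>1 * n\<close> open edges end
  there, which makes the other components small, and at most \<open>8 * \<eta> * n\<close> vertices have \<open>d2 / 2\<close>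
  closed edges to the outside of \<open>Q\<close>. The remaining isolated vertices of \<open>A\<close> serve as \<open>A'\<close>.\<close>
lemma ready_if_typical:
  assumes G: "G \<in> graphs_with_degrees n ds" and E1: "E1 \<subseteq> G"
    and few_poor: "\<not> \<rho> * N / 4 \<le> real (card (poor E1))"
    and cuts: "\<not> (\<exists>Y\<in>Pow V. N * d1 / (1 - \<epsilon>) \<le> real (card (epairs G Y (V - Y))) \<and> epairs E1 Y (V - Y) = {})"
    and small_cuts: "\<not> (\<exists>Y\<in>{Y. Y \<subseteq> V \<and> real (card Y) \<le> \<rho> * N}.
       \<eta>' * N * d1 \<le> real (card (epairs G Y (H - Y))) \<and> epairs E1 Y (H - Y) = {})"
    and open_low: "\<not> (\<exists>Y\<in>{Y. Y \<subseteq> V \<and> real (card Y) \<le> \<rho> * N}.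
       2 * (\<kappa>1 * N / 2) \<le> real (card (epairs E1 L (L \<union> Y))) \<and> real (card (epairs (G - E1) L (L \<union> Y))) \<le> 2 * \<eta> * N * d1)"
    and isolated: "\<not> real (card {v \<in> A. nbrs E1 v = {}}) < exp (- 1 / \<epsilon>) * \<delta> * N / 2"
    and sparse_split: "\<not> ((real (card (poor E1)) < \<rho> * N / 4 \<and> (\<exists>Y. splits E1 Y)) \<and>
       real (card (epairs G (chosen_split E1) (V - chosen_split E1))) \<le> N * d1 / (1 - \<epsilon>))"
    and avoid: "\<not> ((real (card (poor E1)) < \<rho> * N / 4 \<and> (\<exists>Q. dominates E1 Q)) \<and>
       real (card (epairs G (H - (H - giant E1)) (H - giant E1))) \<le> \<eta>' * N * d1 \<and>
       \<eta> * N * d1 \<le> real (card (epairs (G - E1) (V - H) (H - giant E1))))"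
    and low_low: "\<not> \<eta> * N * d1 \<le> real (card (epairs G L L))"
  shows "ready G E1"
proof -
  have sE1: "simple_graph V E1" by (rule simple_graph_mono[OF realizationD(1)[OF G] E1])
  have no_split: "\<not> splits E1 Y" for Y
  proof
    assume "splits E1 Y"
    then have sp: "splits E1 (chosen_split E1)" by (rule chosen_split_splits)
    then have "epairs E1 (chosen_split E1) (V - chosen_split E1) = {}" "chosen_split E1 \<in> Pow V"
      by (auto simp: splits_def edge_closed_def epairs_def)
    then have "real (card (epairs G (chosen_split E1) (V - chosen_split E1))) < N * d1 / (1 - \<epsilon>)"
      using cuts by (meson not_le)
    then show False using sparse_split few_poor sp by (meson less_imp_le not_le)
  qed
  have rN: "\<rho> * N \<le> \<delta>' * N / 4" "\<kappa>1 * N \<le> \<delta>' * N / 4" "0 < \<rho> * N"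
    using mult_right_mono[OF rho(2), of N] mult_right_mono[OF kappa1(2), of N] rho N_pos by auto
  obtain Q0 where "Q0 \<in> components V E1" "real (card (H - Q0)) < \<rho> * N"
  proof (rule dominating_component[OF _ sE1 sets_V(1) _ rN(3)])
    show "3 * (\<rho> * N) \<le> real (card H)" using card_H rN by linarith
    show "real (card (H - Y)) < \<rho> * N" if "Y \<subseteq> V" "edge_closed E1 Y" "\<rho> * N \<le> real (card (Y \<inter> H))" for Y
      using no_split[of Y] that by (auto simp: splits_def not_le)
  qed auto
  then have dom0: "dominates E1 Q0" by (simp add: dominates_def)
  define Q where "Q = giant E1"
  define Y where "Y = H - Q"
  have Q: "Q \<in> components V E1" "real (card Y) < \<rho> * N"
    using giant_dominates[OF dom0] by (auto simp: dominates_def Q_def Y_def)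
  have QV: "Q \<subseteq> V" by (rule component_subset[OF Q(1)])
  have fQ: "finite Q" using QV finite_subset by blast
  have fY: "finite Y" by (simp add: Y_def)
  have Yfam: "Y \<in> {Y. Y \<subseteq> V \<and> real (card Y) \<le> \<rho> * N}" using Q(2) sets_V(1) by (auto simp: Y_def)
  have "epairs E1 Y (H - Y) = {}"
  proof (rule ccontr)
    assume "epairs E1 Y (H - Y) \<noteq> {}"
    then obtain y x where yx: "y \<in> H" "y \<notin> Q" "x \<in> Q" "{x, y} \<in> E1"
      by (auto simp: epairs_def Y_def insert_commute)
    then show False using component_edge_closed[OF Q(1) yx(4,3)] sets_V by auto
  qed
  then have "\<not> \<eta>' * N * d1 \<le> real (card (epairs G Y (H - Y)))" using small_cuts Yfam by blast
  then have "real (card (epairs G (H - Y) Y)) \<le> \<eta>' * N * d1" by (simp add: card_epairs_commute)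
  then have LY: "real (card (epairs (G - E1) L Y)) < \<eta> * N * d1"
    using avoid few_poor dom0 unfolding Y_def Q_def L_def by (meson not_le)
  have closed_low: "real (card (epairs (G - E1) L (L \<union> Y))) < 2 * \<eta> * N * d1"
  proof -
    have "epairs (G - E1) L (L \<union> Y) = epairs (G - E1) L L \<union> epairs (G - E1) L Y" by (auto simp: epairs_def)
    then have "card (epairs (G - E1) L (L \<union> Y)) \<le> card (epairs (G - E1) L L) + card (epairs (G - E1) L Y)"
      by (simp add: card_Un_le)
    moreover have "card (epairs (G - E1) L L) \<le> card (epairs G L L)" by (intro card_epairs_mono) auto
    ultimately show ?thesis using low_low LY by linarith
  qed
  have open_few: "real (card (epairs E1 L (L \<union> Y))) < \<kappa>1 * N"
  proof (rule ccontr)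
    assume "\<not> ?thesis"
    then have "2 * (\<kappa>1 * N / 2) \<le> real (card (epairs E1 L (L \<union> Y)))" by simp
    then show False using open_low Yfam closed_low by (meson less_imp_le)
  qed
  have cQ: "\<delta>' * N / 2 \<le> real (card Q)" "Q \<inter> H \<noteq> {}"
  proof -
    have "H - Y = Q \<inter> H" by (auto simp: Y_def)
    then have "real (card H) - real (card Y) \<le> real (card (Q \<inter> H))" using card_Diff_ge[OF fY, of H] by simp
    moreover have "0 < \<delta>' * N" using top N_pos by simp
    ultimately have 1: "\<delta>' * N / 2 < real (card (Q \<inter> H))" using card_H Q(2) rN(1) by linarith
    then have "0 < real (card (Q \<inter> H))" using \<open>0 < \<delta>' * N\<close> by linarith
    then show "Q \<inter> H \<noteq> {}" by auto
    have "card (Q \<inter> H) \<le> card Q" using fQ by (intro card_mono) auto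
    then show "\<delta>' * N / 2 \<le> real (card Q)" using 1 by linarith
  qed
  have L1Q: "L1 V E1 \<le> card Q"
  proof (rule L1_le)
    show "V \<noteq> {}" using n by simp
    fix K assume K: "K \<in> components V E1"
    show "card K \<le> card Q"
    proof (cases "K = Q")
      case False
      have "card K \<le> max 1 (card (H - Q) + card (epairs E1 (V - H) ((V - H) \<union> (H - Q))))"
        by (rule other_components_small[OF _ sE1 sets_V(1) K Q(1) False]) simp
      then have "card K \<le> max 1 (card Y + card (epairs E1 L (L \<union> Y)))" by (simp add: Y_def L_def)
      moreover have "1 \<le> card Q" using component_ne[OF Q(1)] fQ by (simp add: Suc_le_eq card_gt_0_iff)
      moreover have "real (card Y) + real (card (epairs E1 L (L \<union> Y))) \<le> real (card Q)"
        using Q(2) open_few cQ(1) rN by linarith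
      ultimately show ?thesis by (auto simp: max_def split: if_splits)
    qed simp
  qed simp
  define I where "I = {v \<in> A. nbrs E1 v = {}}"
  define Bd where "Bd = {v \<in> L. d2 / 2 \<le> real (card (nbrs (G - E1) v \<inter> (L \<union> Y)))}"
  have cBd: "real (card Bd) \<le> exp (- 1 / \<epsilon>) * \<delta> * N / 4"
  proof -
    have "real (card Bd) * (d2 / 2) \<le> real (card (epairs (G - E1) L (L \<union> Y)))"
      unfolding Bd_def using fY by (intro few_vertices_with_many_nbrs) auto
    also have "\<dots> \<le> 2 * \<eta> * N * d1" using closed_low by simp
    also have "\<dots> \<le> 2 * \<eta> * N * (2 * d2)" using d2 eta by (intro mult_left_mono) auto
    also have "\<dots> = 8 * \<eta> * N * (d2 / 2)" by simp
    finally have "real (card Bd) \<le> 8 * \<eta> * N" by (rule mult_right_le_imp_le) (use d2 in simp)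
    also have "\<dots> \<le> 8 * (exp (- 1 / \<epsilon>) * \<delta> / 32) * N" using eta by (intro mult_right_mono mult_left_mono) auto
    finally show ?thesis by (simp add: mult.commute)
  qed
  have fBd: "finite Bd" by (simp add: Bd_def)
  show ?thesis
    unfolding ready_def
  proof (intro exI conjI ballI)
    show "Q \<in> components V E1" "L1 V E1 \<le> card Q" by fact+
    show "I - Bd \<subseteq> V - Q"
    proof
      fix a assume "a \<in> I - Bd"
      then have a: "a \<in> A" "nbrs E1 a = {}" by (auto simp: I_def)
      obtain h where h: "h \<in> Q" "h \<in> H" using cQ(2) by auto
      have "a \<notin> H" using a A_subset_L by (auto simp: L_def)
      then have "h \<noteq> a" using h by auto
      have "a \<notin> Q"
      proof
        assume "a \<in> Q"
        then have "(a, h) \<in> {(x, y). {x, y} \<in> E1}\<^sup>*" using component_reach[OF Q(1)] h by blast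
        then obtain z where "{a, z} \<in> E1" using \<open>h \<noteq> a\<close> by (auto elim: converse_rtranclE)
        then show False using a by (auto simp: nbrs_def)
      qed
      then show "a \<in> V - Q" using a sets_V by auto
    qed
    show "exp (- 1 / \<epsilon>) * \<delta> * N / 4 \<le> real (card (I - Bd))"
      using isolated card_Diff_ge[OF fBd, of I] cBd by (simp add: I_def)
    fix a assume "a \<in> I - Bd"
    then have a: "a \<in> A" "nbrs E1 a = {}" and nB: "a \<notin> Bd" by (auto simp: I_def)
    have aV: "a \<in> V" using a sets_V by auto
    have "\<not> d2 / 2 \<le> real (card (nbrs (G - E1) a \<inter> (L \<union> Y)))" using a nB A_subset_L by (auto simp: Bd_def)
    moreover have eq: "nbrs (G - E1) a = nbrs G a" using a by (auto simp: nbrs_def)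
    moreover have "real (card (nbrs G a)) - real (card (nbrs G a \<inter> (L \<union> Y))) \<le> real (card (nbrs G a - nbrs G a \<inter> (L \<union> Y)))"
      using realizationD(3)[OF G] by (intro card_Diff_ge) auto
    moreover have "card (nbrs G a - nbrs G a \<inter> (L \<union> Y)) \<le> card (nbrs G a \<inter> Q)"
      using nbrs_subset[OF realizationD(1)[OF G], of a] realizationD(3)[OF G] by (intro card_mono) (auto simp: L_def Y_def)
    moreover have "d2 \<le> real (card (nbrs G a))" using A_degree(1)[OF a(1)] realizationD(2)[OF G aV] by simp
    ultimately show "d2 / 2 \<le> real (card (nbrs (G - E1) a \<inter> Q))" by simp
  qed
qed

lemma prob_not_ready:
  "measure_pmf.prob (percolated_graph n ds p) {(G, E1). \<not> ready G E1} \<le> failure_bound \<epsilon> \<delta> \<delta>' \<eta> \<eta>' \<rho> \<kappa>1 \<kappa> n"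
proof -
  have "measure_pmf.prob (percolated_graph n ds p) {(G, E1). \<not> ready G E1} \<le>
    measure_pmf.prob (percolated_graph n ds p) {(G, E1).
      \<rho> * N / 4 \<le> real (card (poor E1)) \<or>
      (\<exists>Y\<in>Pow V. N * d1 / (1 - \<epsilon>) \<le> real (card (epairs G Y (V - Y))) \<and> epairs E1 Y (V - Y) = {}) \<or>
      (\<exists>Y\<in>{Y. Y \<subseteq> V \<and> real (card Y) \<le> \<rho> * N}.
         \<eta>' * N * d1 \<le> real (card (epairs G Y (H - Y))) \<and> epairs E1 Y (H - Y) = {}) \<or>
      (\<exists>Y\<in>{Y. Y \<subseteq> V \<and> real (card Y) \<le> \<rho> * N}.
         2 * (\<kappa>1 * N / 2) \<le> real (card (epairs E1 L (L \<union> Y))) \<and>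
         real (card (epairs (G - E1) L (L \<union> Y))) \<le> 2 * \<eta> * N * d1) \<or>
      real (card {v \<in> A. nbrs E1 v = {}}) < exp (- 1 / \<epsilon>) * \<delta> * N / 2 \<or>
      (real (card (poor E1)) < \<rho> * N / 4 \<and> (\<exists>Y. splits E1 Y)) \<and>
        real (card (epairs G (chosen_split E1) (V - chosen_split E1))) \<le> N * d1 / (1 - \<epsilon>) \<or>
      (real (card (poor E1)) < \<rho> * N / 4 \<and> (\<exists>Q. dominates E1 Q)) \<and>
        real (card (epairs G (H - (H - giant E1)) (H - giant E1))) \<le> \<eta>' * N * d1 \<and>
        \<eta> * N * d1 \<le> real (card (epairs (G - E1) (V - H) (H - giant E1))) \<or>
      \<eta> * N * d1 \<le> real (card (epairs G L L))}"
    (is "_ \<le> measure_pmf.prob _ {(G, E1). ?atypical G E1}")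
  proof (rule measure_pmf.finite_measure_mono_AE, rule AE_pmfI, rule impI)
    fix x assume x: "x \<in> set_pmf (percolated_graph n ds p)" "x \<in> {(G, E1). \<not> ready G E1}"
    obtain G E1 where xe: "x = (G, E1)" by (cases x)
    have GE: "G \<in> graphs_with_degrees n ds" "E1 \<subseteq> G" using set_percolated_graph[OF feas] x(1) xe by auto
    have "\<not> ready G E1" using x xe by simp
    with ready_if_typical[OF GE] have "?atypical G E1" by satx
    then show "x \<in> {(G, E1). ?atypical G E1}" unfolding xe mem_Collect_eq prod.case .
  qed simp
  also have "\<dots> \<le> failure_bound \<epsilon> \<delta> \<delta>' \<eta> \<eta>' \<rho> \<kappa>1 \<kappa> n"
    unfolding failure_bound_def
    by (intro prob_disj_le prob_many_poor prob_large_closed_cut prob_closed_cut_small_side prob_many_open_at_low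
        prob_isolated_rare prob_sparse_split prob_low_vertices_avoid_giant prob_many_low_low_edges)
  finally show ?thesis .
qed

end

lemma coupled_percolation_of_random_graph:
  "bind_pmf (random_graph n ds) (coupled_percolation p1 p2) =
    bind_pmf (percolated_graph n ds p1)
      (\<lambda>(G, E1). map_pmf (\<lambda>F. (E1, E1 \<union> F)) (percolation ((p2 - p1) / (1 - p1)) (G - E1)))"
  by (simp add: percolated_graph_def coupled_percolation_def[abs_def] bind_assoc_pmf bind_map_pmf map_pmf_def[of "\<lambda>F. (_, _ \<union> F)"])

context percolation_setting
begin

text \<open>Each vertex of \<open>A'\<close> has at least \<open>d2 / 2\<close> closed edges to \<open>Q\<close>, and the opening probability \<open>q\<close> of the
  second round satisfies \<open>q * d2 \<ge> 2 * \<epsilon>\<close>. So all edges from half of \<open>A'\<close> to \<open>Q\<close>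
  stay closed with probability at most \<open>exp (- \<epsilon> * exp (- 1 / \<epsilon>) * \<delta> * n / 8)\<close>, and the choice
  of these vertices costs half of the exponent.\<close>
lemma prob_no_growth:
  assumes p2: "p2 = (1 + \<epsilon>) / d2" "p2 \<le> 1" and d21: "d2 \<le> d1"
    and c: "c \<le> exp (- 1 / \<epsilon>) * \<delta> / 8" "\<sigma> \<le> \<epsilon> * exp (- 1 / \<epsilon>) * \<delta> / 16"
      "real (card {Y. Y \<subseteq> V \<and> real (card Y) \<le> c * N}) \<le> exp (\<sigma> * N)"
  shows "measure_pmf.prob (bind_pmf (random_graph n ds) (coupled_percolation p p2))
      {(G1, G2). \<not> c * N \<le> real (L1 V G2) - real (L1 V G1)}
    \<le> failure_bound \<epsilon> \<delta> \<delta>' \<eta> \<eta>' \<rho> \<kappa>1 \<kappa> n + exp (- (\<epsilon> * exp (- 1 / \<epsilon>) * \<delta> / 16) * N)"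
proof -
  let ?q = "(p2 - p) / (1 - p)" and ?\<pi> = "exp (- 1 / \<epsilon>) * \<delta>"
  have p1: "0 < 1 - p" using p_bounds eps by simp
  have gap: "2 * \<epsilon> \<le> (p2 - p) * d2"
  proof -
    have "p * d2 \<le> p * d1" using d21 p_bounds by (intro mult_left_mono) auto
    moreover have "p2 * d2 = 1 + \<epsilon>" using p2 d2 by simp
    ultimately show ?thesis using p_bounds(4) by (simp add: left_diff_distrib)
  qed
  then have gap0: "0 \<le> p2 - p" using d2 eps by (smt (verit) mult_nonpos_nonneg)
  have q: "0 \<le> ?q" "?q \<le> 1" "p2 - p \<le> ?q"
    using gap0 p1 p2(2) p_bounds mult_left_mono[of "1 - p" 1 "p2 - p"] by (auto simp: field_simps)
  have sprinkle: "measure_pmf.prob (percolation ?q (G - E1)) {F. real (L1 V (E1 \<union> F)) - real (L1 V E1) < c * N}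
      \<le> exp (- (\<epsilon> * ?\<pi> / 16) * N)" if GE: "G \<in> graphs_with_degrees n ds" "E1 \<subseteq> G" and r: "ready G E1" for G E1
  proof -
    obtain Q A' where Q: "Q \<in> components V E1" "L1 V E1 \<le> card Q" "A' \<subseteq> V - Q" "?\<pi> * N / 4 \<le> real (card A')"
      "\<And>a. a \<in> A' \<Longrightarrow> d2 / 2 \<le> real (card (nbrs (G - E1) a \<inter> Q))"
      using r unfolding ready_def by blast
    have "c * N \<le> ?\<pi> / 8 * N" using c(1) by (intro mult_right_mono) auto
    then have cA: "?\<pi> * N / 8 + c * N \<le> real (card A')" using Q(4) by simp
    have "measure_pmf.prob (percolation ?q (G - E1)) {F. real (L1 V (E1 \<union> F)) - real (L1 V E1) < c * N}
        \<le> exp (\<sigma> * N) * exp (- ?q * (?\<pi> * N / 8 * (d2 / 2)))"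
      by (rule prob_sprinkling_fails[OF _ realizationD(1)[OF GE(1)] GE(2) Q(1,2,3) cA Q(5) q(1,2) _ c(3)])
        (use d2 in auto)
    also have "\<dots> \<le> exp (\<epsilon> * ?\<pi> / 16 * N) * exp (- (\<epsilon> * ?\<pi> / 8 * N))"
    proof (intro mult_mono)
      show "exp (\<sigma> * N) \<le> exp (\<epsilon> * ?\<pi> / 16 * N)"
        using mult_right_mono[OF c(2), of N] by (simp add: mult_ac)
      have "2 * \<epsilon> \<le> ?q * d2" using gap mult_right_mono[OF q(3), of d2] d2 by linarith
      then have "2 * \<epsilon> * (?\<pi> * N / 16) \<le> ?q * d2 * (?\<pi> * N / 16)" using A by (intro mult_right_mono) auto
      then have "\<epsilon> * ?\<pi> / 8 * N \<le> ?q * (?\<pi> * N / 8 * (d2 / 2))" by (simp add: mult_ac)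
      then show "exp (- ?q * (?\<pi> * N / 8 * (d2 / 2))) \<le> exp (- (\<epsilon> * ?\<pi> / 8 * N))"
        unfolding exp_le_cancel_iff by (metis minus_mult_left neg_le_iff_le)
    qed auto
    also have "\<dots> = exp (- (\<epsilon> * ?\<pi> / 16) * N)" unfolding exp_add[symmetric] by simp
    finally show ?thesis .
  qed
  have "measure_pmf.prob (bind_pmf (random_graph n ds) (coupled_percolation p p2))
      {(G1, G2). \<not> c * N \<le> real (L1 V G2) - real (L1 V G1)}
    \<le> measure_pmf.prob (percolated_graph n ds p) {(G, E1). \<not> ready G E1} + exp (- (\<epsilon> * ?\<pi> / 16) * N)"
    unfolding coupled_percolation_of_random_graph
  proof (rule prob_bind_pmf_le)
    fix x assume x: "x \<in> set_pmf (percolated_graph n ds p)" "x \<notin> {(G, E1). \<not> ready G E1}"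
    obtain G E1 where xe: "x = (G, E1)" by (cases x)
    have GE: "G \<in> graphs_with_degrees n ds" "E1 \<subseteq> G" "ready G E1"
      using set_percolated_graph[OF feas] x xe by auto
    show "measure_pmf.prob (case x of (G, E1) \<Rightarrow> map_pmf (\<lambda>F. (E1, E1 \<union> F)) (percolation ?q (G - E1)))
        {(G1, G2). \<not> c * N \<le> real (L1 V G2) - real (L1 V G1)} \<le> exp (- (\<epsilon> * ?\<pi> / 16) * N)"
      using sprinkle[OF GE] by (simp add: xe measure_map_pmf vimage_def not_le)
  qed simp
  then show ?thesis using prob_not_ready by (simp add: mult.assoc)
qed

end

section \<open>The limit\<close>

lemma exp_neg_tendsto_0:
  fixes f :: "nat \<Rightarrow> real"
  assumes "0 < a" "filterlim f at_top sequentially"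
  shows "(\<lambda>n. exp (- (a * f n))) \<longlonglongrightarrow> 0"
proof -
  have "filterlim (\<lambda>n. a * f n) at_top sequentially"
    by (rule filterlim_tendsto_pos_mult_at_top[OF tendsto_const assms])
  then have "filterlim (\<lambda>n. - (a * f n)) at_bot sequentially" by (simp add: filterlim_uminus_at_top)
  then show ?thesis by (rule filterlim_compose[OF exp_at_bot])
qed

lemma failure_bound_tendsto_0:
  assumes "0 < \<epsilon>" "\<epsilon> < 1" "0 < \<eta>'" "0 < \<kappa>1" and \<kappa>: "filterlim \<kappa> at_top sequentially"
  shows "(\<lambda>n. failure_bound \<epsilon> \<delta> \<delta>' \<eta> \<eta>' \<rho> \<kappa>1 (\<kappa> n) n) \<longlonglongrightarrow> 0"
proof -
  have n: "filterlim (\<lambda>n. real n) at_top sequentially" by (rule filterlim_real_sequentially)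
  have inv: "(\<lambda>n. inverse (\<kappa> n)) \<longlonglongrightarrow> 0" by (rule tendsto_inverse_0_at_top[OF \<kappa>])
  have 1: "(\<lambda>n. 4 * exp (- ((\<epsilon> / 4) * \<kappa> n)) / \<rho>) \<longlonglongrightarrow> 4 * 0 / \<rho>"
    unfolding divide_inverse using assms by (intro tendsto_mult tendsto_const exp_neg_tendsto_0) auto
  have 2: "(\<lambda>n. (2 / exp 1 :: real) ^ n) \<longlonglongrightarrow> 0"
  proof (rule LIMSEQ_realpow_zero)
    show "2 / exp 1 < (1 :: real)" using exp_lower_Taylor_quadratic[of 1] by simp
  qed simp
  have 3: "(\<lambda>n. exp (- (((1 - \<epsilon>) * \<eta>' / 2) * real n))) \<longlonglongrightarrow> 0"
    using assms by (intro exp_neg_tendsto_0 n) auto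
  have 4: "(\<lambda>n. exp (- ((\<kappa>1 * ln (1 + \<epsilon>) / 4) * real n))) \<longlonglongrightarrow> 0"
    using assms by (intro exp_neg_tendsto_0 n) (auto intro!: mult_pos_pos)
  have power: "(\<lambda>n. a * inverse (\<kappa> n) ^ Suc k) \<longlonglongrightarrow> 0" for a and k :: nat
    using tendsto_mult[OF tendsto_const tendsto_power[OF inv, of "Suc k"], of a] by simp
  have "(\<lambda>n. 4 * exp (- ((\<epsilon> / 4) * \<kappa> n)) / \<rho> + ((2 / exp 1) ^ n + (exp (- (((1 - \<epsilon>) * \<eta>' / 2) * real n)) +
    (exp (- ((\<kappa>1 * ln (1 + \<epsilon>) / 4) * real n)) + (8 / (exp (- 1 / \<epsilon>) * \<delta>)\<^sup>2 * inverse (\<kappa> n) ^ Suc 2 +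
    ((32 * (1 / (1 - \<epsilon>) + 2) / (\<rho> * \<epsilon>))\<^sup>2 * inverse (\<kappa> n) ^ Suc 1 + (256 * (\<eta>' + 1) / (\<eta> * \<delta>' * \<epsilon>) * inverse (\<kappa> n) ^ Suc 1 +
    2 / (\<eta> * \<delta>') * inverse (\<kappa> n) ^ Suc 0)))))))
    \<longlonglongrightarrow> 4 * 0 / \<rho> + (0 + (0 + (0 + (0 + (0 + (0 + 0))))))"
    by (intro tendsto_add 1 2 3 4 power)
  moreover have "failure_bound \<epsilon> \<delta> \<delta>' \<eta> \<eta>' \<rho> \<kappa>1 (\<kappa> n) n =
    4 * exp (- ((\<epsilon> / 4) * \<kappa> n)) / \<rho> + ((2 / exp 1) ^ n + (exp (- (((1 - \<epsilon>) * \<eta>' / 2) * real n)) +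
    (exp (- ((\<kappa>1 * ln (1 + \<epsilon>) / 4) * real n)) + (8 / (exp (- 1 / \<epsilon>) * \<delta>)\<^sup>2 * inverse (\<kappa> n) ^ Suc 2 +
    ((32 * (1 / (1 - \<epsilon>) + 2) / (\<rho> * \<epsilon>))\<^sup>2 * inverse (\<kappa> n) ^ Suc 1 + (256 * (\<eta>' + 1) / (\<eta> * \<delta>' * \<epsilon>) * inverse (\<kappa> n) ^ Suc 1 +
    2 / (\<eta> * \<delta>') * inverse (\<kappa> n) ^ Suc 0))))))" for n
  proof -
    have e: "x / (y * \<kappa> n ^ k) = x / y * inverse (\<kappa> n) ^ k" for x y k
      by (simp add: divide_inverse power_inverse mult.assoc)
    have "(x / (y * \<kappa> n))\<^sup>2 = (x / y)\<^sup>2 * inverse (\<kappa> n) ^ 2" "x / (y * \<kappa> n) = x / y * inverse (\<kappa> n) ^ 1" for x y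
      using e[of x y 1] by (simp_all only: power_one_right power_mult_distrib)
    note e = e this
    show ?thesis unfolding failure_bound_def by (simp only: e numeral_3_eq_3 numeral_2_eq_2 One_nat_def) simp
  qed
  ultimately show ?thesis by simp
qed

theorem corollary1p8:
  fixes \<delta> \<delta>' \<epsilon> :: real
  assumes "0 < \<delta>" and "0 < \<delta>'" and "0 < \<epsilon>" and "\<epsilon> < 1"
  shows "\<exists>C::real. 0 < C \<and>
    (\<forall>(D :: nat \<Rightarrow> nat \<Rightarrow> nat) (d1 :: nat \<Rightarrow> real) (d2 :: nat \<Rightarrow> real) (d :: nat \<Rightarrow> real)
       (p1 :: nat \<Rightarrow> real) (p2 :: nat \<Rightarrow> real).
      (\<forall>\<^sub>F n in sequentially. (\<forall>i\<in>{1..n}. 1 \<le> D n i) \<and> feasible n (D n)) \<longrightarrow>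
      (\<forall>\<^sub>F n in sequentially. 0 < d2 n \<and> d2 n < d1 n) \<longrightarrow>
      (\<lambda>n. d1 n / d2 n) \<longlonglongrightarrow> 1 \<longrightarrow>
      (\<forall>\<^sub>F n in sequentially. real (card (S n (D n) (d2 n) - S n (D n) (d1 n))) \<ge> \<delta> * real n) \<longrightarrow>
      (\<forall>\<^sub>F n in sequentially. 0 < d n) \<longrightarrow>
      (\<lambda>n. d1 n / d n) \<longlonglongrightarrow> 0 \<longrightarrow>
      (\<forall>\<^sub>F n in sequentially. real (card (S n (D n) (d n))) \<ge> \<delta>' * real n) \<longrightarrow>
      (\<forall>n. p1 n = (1 - \<epsilon>) / d1 n) \<longrightarrow>
      (\<forall>n. p2 n = (1 + \<epsilon>) / d2 n) \<longrightarrow>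
      (\<forall>\<^sub>F n in sequentially. p2 n \<le> 1) \<longrightarrow>
      (\<lambda>n. measure_pmf.prob
             (bind_pmf (random_graph n (D n)) (coupled_percolation (p1 n) (p2 n)))
             {(G1, G2). real (L1 {1..n} G2) - real (L1 {1..n} G1) \<ge> C * real n})
        \<longlonglongrightarrow> 1)"
proof -
  let ?\<pi> = "exp (- 1 / \<epsilon>)"
  define \<kappa>1 where "\<kappa>1 = \<delta>' / 4"
  \<comment> \<open>\<eta> depends on \<kappa>1, \<eta>' on \<eta>, \<theta> on \<eta>', and \<rho> on \<theta>; \<sigma> governs the union bound in the second round and determines the constant c.\<close>
  define \<eta> where "\<eta> = min (?\<pi> * \<delta> / 32) (\<epsilon> * \<kappa>1 * ln (1 + \<epsilon>) / 16)"
  define \<eta>' where "\<eta>' = \<eta> * \<delta>' / 8"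
  define \<theta> where "\<theta> = min ((1 - \<epsilon>) * \<eta>' / 2) (\<kappa>1 * ln (1 + \<epsilon>) / 8)"
  define \<sigma> where "\<sigma> = \<epsilon> * ?\<pi> * \<delta> / 16"
  have pos: "0 < \<kappa>1" "0 < \<eta>" "0 < \<eta>'" "0 < \<theta>" "0 < \<sigma>"
    using assms by (auto simp: \<kappa>1_def \<eta>_def \<eta>'_def \<theta>_def \<sigma>_def)
  obtain \<rho>0 where \<rho>0: "0 < \<rho>0" "\<And>V :: nat set. finite V \<Longrightarrow>
      real (card {Y. Y \<subseteq> V \<and> real (card Y) \<le> \<rho>0 * real (card V)}) \<le> exp (\<theta> * real (card V))"
    using few_small_subsets[OF pos(4)] by blast
  obtain c0 where c0: "0 < c0" "\<And>V :: nat set. finite V \<Longrightarrow>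
      real (card {Y. Y \<subseteq> V \<and> real (card Y) \<le> c0 * real (card V)}) \<le> exp (\<sigma> * real (card V))"
    using few_small_subsets[OF pos(5)] by blast
  define \<rho> where "\<rho> = min \<rho>0 (\<delta>' / 4)"
  define c where "c = min c0 (?\<pi> * \<delta> / 8)"
  have small: "real (card {Y. Y \<subseteq> {1..n} \<and> real (card Y) \<le> x * real n}) \<le> exp (t * real n)"
    if "x \<le> x0" "\<And>V :: nat set. finite V \<Longrightarrow>
      real (card {Y. Y \<subseteq> V \<and> real (card Y) \<le> x0 * real (card V)}) \<le> exp (t * real (card V))" for x x0 t and n :: nat
  proof -
    have "x * real n \<le> x0 * real n" using that(1) by (intro mult_right_mono) auto
    then have "card {Y. Y \<subseteq> {1..n} \<and> real (card Y) \<le> x * real n} \<le> card {Y. Y \<subseteq> {1..n} \<and> real (card Y) \<le> x0 * real n}"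
      by (intro card_mono) auto
    then show ?thesis using that(2)[of "{1..n}"] by simp
  qed
  have \<rho>: "0 < \<rho>" "\<rho> \<le> \<delta>' / 4" and c: "0 < c" "c \<le> ?\<pi> * \<delta> / 8" using \<rho>0 c0 assms by (auto simp: \<rho>_def c_def)
  show ?thesis
  proof (intro exI[of _ c] conjI allI impI)
    show "0 < c" by fact
    fix D :: "nat \<Rightarrow> nat \<Rightarrow> nat" and d1 d2 d p1 p2 :: "nat \<Rightarrow> real"
    assume feas: "\<forall>\<^sub>F n in sequentially. (\<forall>i\<in>{1..n}. 1 \<le> D n i) \<and> feasible n (D n)"
      and d12: "\<forall>\<^sub>F n in sequentially. 0 < d2 n \<and> d2 n < d1 n"
      and ratio: "(\<lambda>n. d1 n / d2 n) \<longlonglongrightarrow> 1"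
      and mid: "\<forall>\<^sub>F n in sequentially. real (card (S n (D n) (d2 n) - S n (D n) (d1 n))) \<ge> \<delta> * real n"
      and dpos: "\<forall>\<^sub>F n in sequentially. 0 < d n"
      and d1d: "(\<lambda>n. d1 n / d n) \<longlonglongrightarrow> 0"
      and top: "\<forall>\<^sub>F n in sequentially. real (card (S n (D n) (d n))) \<ge> \<delta>' * real n"
      and p1: "\<forall>n. p1 n = (1 - \<epsilon>) / d1 n" and p2: "\<forall>n. p2 n = (1 + \<epsilon>) / d2 n"
      and p2_le: "\<forall>\<^sub>F n in sequentially. p2 n \<le> 1"
    define \<kappa> where "\<kappa> n = root 3 (d n / d1 n)" for n
    have \<kappa>_top: "filterlim \<kappa> at_top sequentially"
    proof -
      have "\<forall>\<^sub>F n in sequentially. 0 < d1 n / d n" using d12 dpos by eventually_elim auto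
      then have "filterlim (\<lambda>n. inverse (d1 n / d n)) at_top sequentially" by (rule filterlim_inverse_at_top[OF d1d])
      then have lim: "filterlim (\<lambda>n. d n / d1 n) at_top sequentially" by simp
      show ?thesis
        unfolding filterlim_at_top
      proof
        fix Z :: real
        have "\<forall>\<^sub>F n in sequentially. Z ^ 3 \<le> d n / d1 n" using lim by (simp add: filterlim_at_top)
        then show "\<forall>\<^sub>F n in sequentially. Z \<le> \<kappa> n"
        proof eventually_elim
          case (elim n)
          then have "root 3 (Z ^ 3) \<le> \<kappa> n" unfolding \<kappa>_def by (intro real_root_le_mono) auto
          then show ?case by (simp add: odd_real_root_power_cancel)
        qed
      qed
    qed
    \<comment> \<open>Each summand makes one of the conditions on a large \<kappa> in the locale hold.\<close>
    define K where "K = 1 + 64 / (\<rho> * \<epsilon> * (1 - \<epsilon>)) + 16 / \<epsilon> + 128 * \<eta>' / (\<delta>' * \<epsilon>) + 8 / \<delta>'"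
    have large: "\<forall>\<^sub>F n in sequentially. K \<le> \<kappa> n" using \<kappa>_top by (simp add: filterlim_at_top)
    have ratio2: "\<forall>\<^sub>F n in sequentially. d1 n / d2 n < 2" using order_tendstoD(2)[OF ratio] by simp
    let ?P = "\<lambda>n. measure_pmf.prob (bind_pmf (random_graph n (D n)) (coupled_percolation (p1 n) (p2 n)))
             {(G1, G2). real (L1 {1..n} G2) - real (L1 {1..n} G1) \<ge> c * real n}"
    let ?g = "\<lambda>n. failure_bound \<epsilon> \<delta> \<delta>' \<eta> \<eta>' \<rho> \<kappa>1 (\<kappa> n) n + exp (- (\<epsilon> * ?\<pi> * \<delta> / 16 * real n))"
    have lower: "\<forall>\<^sub>F n in sequentially. 1 - ?g n \<le> ?P n"
      using feas d12 mid dpos top p2_le large ratio2 eventually_gt_at_top[of 0]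
    proof eventually_elim
      case (elim n)
      have terms: "0 \<le> 64 / (\<rho> * \<epsilon> * (1 - \<epsilon>))" "0 \<le> 16 / \<epsilon>" "0 \<le> 128 * \<eta>' / (\<delta>' * \<epsilon>)" "0 \<le> 8 / \<delta>'"
        using assms \<rho> pos by auto
      have \<kappa>n: "1 \<le> \<kappa> n" "64 / (\<rho> * \<epsilon> * (1 - \<epsilon>)) \<le> \<kappa> n" "16 / \<epsilon> \<le> \<kappa> n"
          "128 * \<eta>' / (\<delta>' * \<epsilon>) \<le> \<kappa> n" "8 / \<delta>' \<le> \<kappa> n"
        using elim(7) terms unfolding K_def by linarith+
      have sq: "\<kappa> n \<le> \<kappa> n ^ 2" "\<kappa> n \<le> \<kappa> n ^ 3"
        using power_increasing[of 1 2 "\<kappa> n"] power_increasing[of 1 3 "\<kappa> n"] \<kappa>n(1) by simp_all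
      have cube: "\<kappa> n ^ 3 * d1 n = d n" using elim(2) by (simp add: \<kappa>_def odd_real_root_pow)
      have d2n: "1 + \<epsilon> \<le> d2 n" using elim(2,6) p2 by (simp add: pos_divide_le_eq)
      interpret percolation_setting n "D n" "d1 n" "d2 n" "p1 n" "\<kappa> n" \<epsilon> \<delta> \<delta>' \<eta> \<eta>' \<rho> \<kappa>1 \<theta>
      proof
        show "feasible n (D n)" "0 < n" "0 < d2 n" using elim by auto
        show "1 < d1 n" using elim(2) d2n assms by linarith
        show "d1 n \<le> 2 * d2 n" using elim(2,8) by (simp add: pos_divide_less_eq)
        show "\<delta>' * real n \<le> real (card (S n (D n) (\<kappa> n ^ 3 * d1 n)))" using elim(5) cube by simp
        show "\<eta> \<le> ?\<pi> * \<delta> / 32" by (simp add: \<eta>_def)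
        have "\<eta> \<le> \<epsilon> * \<kappa>1 * ln (1 + \<epsilon>) / 16" by (simp add: \<eta>_def)
        then show "2 * \<eta> / \<epsilon> \<le> \<kappa>1 * ln (1 + \<epsilon>) / 8" using assms by (simp add: pos_divide_le_eq mult_ac)
        show "\<theta> \<le> (1 - \<epsilon>) * \<eta>' / 2" "\<theta> \<le> \<kappa>1 * ln (1 + \<epsilon>) / 8" by (auto simp: \<theta>_def)
        show "real (card {Y. Y \<subseteq> {1..n} \<and> real (card Y) \<le> \<rho> * real n}) \<le> exp (\<theta> * real n)"
          by (rule small[OF _ \<rho>0(2)]) (auto simp: \<rho>_def)
        have "16 \<le> \<epsilon> * \<kappa> n" using \<kappa>n(3) assms by (simp add: pos_divide_le_eq mult.commute)
        also have "\<dots> \<le> \<epsilon> * \<kappa> n ^ 2" using sq assms by simp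
        finally have "16 * \<kappa> n \<le> \<epsilon> * \<kappa> n ^ 2 * \<kappa> n" using \<kappa>n(1) by (intro mult_right_mono) auto
        also have "\<epsilon> * \<kappa> n ^ 2 * \<kappa> n = \<epsilon> * \<kappa> n ^ 3" by (simp add: power3_eq_cube power2_eq_square)
        finally show "\<kappa> n + 1 \<le> \<epsilon> * \<kappa> n ^ 3 / 8" using \<kappa>n(1) by linarith
        have "128 * \<eta>' \<le> \<delta>' * \<epsilon> * \<kappa> n" using \<kappa>n(4) assms by (simp add: pos_divide_le_eq mult_ac)
        also have "\<dots> \<le> \<delta>' * \<epsilon> * \<kappa> n ^ 3" using sq assms by (intro mult_left_mono) auto
        finally show "128 * \<eta>' \<le> \<delta>' * \<epsilon> * \<kappa> n ^ 3" .
        have "8 \<le> \<delta>' * \<kappa> n" using \<kappa>n(5) assms by (simp add: pos_divide_le_eq mult_ac)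
        also have "\<dots> \<le> \<delta>' * (\<kappa> n)\<^sup>2" using sq assms by (intro mult_left_mono) auto
        finally show "8 \<le> \<delta>' * (\<kappa> n)\<^sup>2" .
      qed (use elim p1 assms pos \<rho> \<kappa>n in \<open>auto simp: \<kappa>1_def \<eta>'_def\<close>)
      let ?M = "bind_pmf (random_graph n (D n)) (coupled_percolation (p1 n) (p2 n))"
      have "measure_pmf.prob ?M {(G1, G2). \<not> c * real n \<le> real (L1 {1..n} G2) - real (L1 {1..n} G1)}
        \<le> failure_bound \<epsilon> \<delta> \<delta>' \<eta> \<eta>' \<rho> \<kappa>1 (\<kappa> n) n + exp (- (\<epsilon> * ?\<pi> * \<delta> / 16) * real n)"
      proof (rule prob_no_growth[where \<sigma> = \<sigma>])
        show "real (card {Y. Y \<subseteq> {1..n} \<and> real (card Y) \<le> c * real n}) \<le> exp (\<sigma> * real n)"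
          by (rule small[OF _ c0(2)]) (auto simp: c_def)
      qed (use elim p2 c in \<open>auto simp: \<sigma>_def\<close>)
      moreover have "?P n = 1 - measure_pmf.prob ?M {(G1, G2). \<not> c * real n \<le> real (L1 {1..n} G2) - real (L1 {1..n} G1)}"
        by (subst measure_pmf.prob_compl[symmetric]) (auto intro!: arg_cong[where f = "measure_pmf.prob _"])
      ultimately show "1 - ?g n \<le> ?P n" by simp
    qed
    have "(\<lambda>n. exp (- (\<epsilon> * ?\<pi> * \<delta> / 16 * real n))) \<longlonglongrightarrow> 0"
      using assms by (intro exp_neg_tendsto_0 filterlim_real_sequentially) auto
    then have "?g \<longlonglongrightarrow> 0 + 0"
      using assms pos by (intro tendsto_add failure_bound_tendsto_0 \<kappa>_top) auto
    then have "(\<lambda>n. 1 - ?g n) \<longlonglongrightarrow> 1 - (0 + 0)" by (intro tendsto_diff tendsto_const)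
    then have lim: "(\<lambda>n. 1 - ?g n) \<longlonglongrightarrow> 1" by simp
    show "?P \<longlonglongrightarrow> 1"
      by (rule tendsto_sandwich[OF lower _ lim tendsto_const]) simp
  qed
qed

end
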